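(* Let $p<q$ be primes, let $a,b\ge 1$ be integers, and let $K\subset S^3$ be the $(p^a,q^b)$-torus knot with knot group $G(K)=\pi_1(S^3\setminus K)$. Then for every non-trivial $g\in G(K)$, $t(g)\subset p\mathbb{N}\cup\mathbb{N}_{\ge q}$; that is, every $n\in t(g)$ is divisible by $p$ or satisfies $n\ge q$.
   Context: For elements $g,x$ of a group $G$ put $g^x=xgx^{-1}$. The generalized torsion equation spectrum of $g\in G$ is the set of positive integers $t(g)=\{n\ge 1 : g^{x_1}\cdots g^{x_n}=1\text{ for some }x_1,\dots,x_n\in G\}$. *)

theory Defs
  imports
    "HOL-Analysis.Analysis"
    "HOL-Algebra.Group"
    "HOL-Computational_Algebra.Primes"
begin

section \<open>The fundamental group\<close>

definition loops_at :: "'a::topological_space set \<Rightarrow> 'a \<Rightarrow> (real \<Rightarrow> 'a) set" where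
  "loops_at S x0 = {p. path p \<and> path_image p \<subseteq> S \<and> pathstart p = x0 \<and> pathfinish p = x0}"

text \<open>A path is a total function on the reals of which only the restriction to \<open>{0..1}\<close> matters;
  functions agreeing there are homotopic, so the class below forgets the values elsewhere.\<close>

definition loop_class :: "'a::topological_space set \<Rightarrow> (real \<Rightarrow> 'a) \<Rightarrow> (real \<Rightarrow> 'a) set" where
  "loop_class S p = {q. homotopic_paths S p q}"

definition fundamental_group :: "'a::topological_space set \<Rightarrow> 'a \<Rightarrow> (real \<Rightarrow> 'a) set monoid" where
  "fundamental_group S x0 =
     \<lparr>carrier = loop_class S ` loops_at S x0,
      mult = (\<lambda>X Y. {r. \<exists>p\<in>X. \<exists>q\<in>Y. homotopic_paths S (p +++ q) r}),
      one = loop_class S (\<lambda>_. x0)\<rparr>"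

lemma loop_class_eq_iff:
  assumes "p \<in> loops_at S x0"
  shows "loop_class S p = loop_class S q \<longleftrightarrow> homotopic_paths S p q"
proof
  assume "loop_class S p = loop_class S q"
  moreover have "p \<in> loop_class S p"
    using assms by (simp add: loop_class_def loops_at_def)
  ultimately show "homotopic_paths S p q"
    by (simp add: loop_class_def homotopic_paths_sym_eq)
next
  assume "homotopic_paths S p q"
  then show "loop_class S p = loop_class S q"
    unfolding loop_class_def
    by (auto intro: homotopic_paths_trans dest: homotopic_paths_sym)
qed

lemma mult_loop_class:
  assumes "p \<in> loops_at S x0" "q \<in> loops_at S x0"
  shows "loop_class S p \<otimes>\<^bsub>fundamental_group S x0\<^esub> loop_class S q = loop_class S (p +++ q)"
proof -
  have "homotopic_paths S (p +++ q) r"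
    if "homotopic_paths S p p'" "homotopic_paths S q q'" "homotopic_paths S (p' +++ q') r" for p' q' r
    using that homotopic_paths_join[of S p p' q q'] assms
    by (auto simp: loops_at_def intro: homotopic_paths_trans)
  moreover have "homotopic_paths S p p" "homotopic_paths S q q"
    using assms by (auto simp: loops_at_def)
  ultimately show ?thesis
    unfolding fundamental_group_def loop_class_def monoid.simps by blast
qed

lemma loops_at_join:
  "p \<in> loops_at S x0 \<Longrightarrow> q \<in> loops_at S x0 \<Longrightarrow> p +++ q \<in> loops_at S x0"
  by (auto simp: loops_at_def path_image_join)

lemma loops_at_reversepath: "p \<in> loops_at S x0 \<Longrightarrow> reversepath p \<in> loops_at S x0"
  by (auto simp: loops_at_def)

lemma group_fundamental_group:
  fixes S :: "'a::real_normed_vector set"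
  assumes "x0 \<in> S"
  shows "group (fundamental_group S x0)"
proof (rule groupI)
  let ?G = "fundamental_group S x0"
  have carr: "carrier ?G = loop_class S ` loops_at S x0"
    by (simp add: fundamental_group_def)
  have const: "(\<lambda>_. x0) = linepath x0 x0"
    by (simp add: linepath_def fun_eq_iff flip: scaleR_add_left)
  have const_loop: "linepath x0 x0 \<in> loops_at S x0"
    using assms by (auto simp: loops_at_def)
  have one: "\<one>\<^bsub>?G\<^esub> = loop_class S (linepath x0 x0)"
    by (simp add: fundamental_group_def const)
  show "\<one>\<^bsub>?G\<^esub> \<in> carrier ?G"
    using const_loop by (simp add: one carr)
  show "x \<otimes>\<^bsub>?G\<^esub> y \<in> carrier ?G" if "x \<in> carrier ?G" "y \<in> carrier ?G" for x y
    using that by (auto simp: carr mult_loop_class loops_at_join)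
  show "x \<otimes>\<^bsub>?G\<^esub> y \<otimes>\<^bsub>?G\<^esub> z = x \<otimes>\<^bsub>?G\<^esub> (y \<otimes>\<^bsub>?G\<^esub> z)"
    if xyz: "x \<in> carrier ?G" "y \<in> carrier ?G" "z \<in> carrier ?G" for x y z
  proof -
    obtain p q r where pqr: "p \<in> loops_at S x0" "q \<in> loops_at S x0" "r \<in> loops_at S x0"
      and eqs: "x = loop_class S p" "y = loop_class S q" "z = loop_class S r"
      using xyz by (auto simp: carr)
    have "homotopic_paths S ((p +++ q) +++ r) (p +++ (q +++ r))"
      using pqr by (intro homotopic_paths_sym[OF homotopic_paths_assoc]) (auto simp: loops_at_def)
    then show ?thesis
      using pqr by (simp add: eqs mult_loop_class loops_at_join loop_class_eq_iff[of _ S x0])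
  qed
  show "\<one>\<^bsub>?G\<^esub> \<otimes>\<^bsub>?G\<^esub> x = x" if x: "x \<in> carrier ?G" for x
  proof -
    obtain p where p: "p \<in> loops_at S x0" "x = loop_class S p"
      using x by (auto simp: carr)
    then have "homotopic_paths S (linepath x0 x0 +++ p) p"
      by (intro homotopic_paths_lid') (auto simp: loops_at_def)
    then show ?thesis
      using p const_loop by (simp add: one mult_loop_class loops_at_join loop_class_eq_iff[of _ S x0])
  qed
  show "\<exists>y\<in>carrier ?G. y \<otimes>\<^bsub>?G\<^esub> x = \<one>\<^bsub>?G\<^esub>" if x: "x \<in> carrier ?G" for x
  proof -
    obtain p where p: "p \<in> loops_at S x0" "x = loop_class S p"
      using x by (auto simp: carr)
    then have "homotopic_paths S (reversepath p +++ p) (linepath x0 x0)"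
      using homotopic_paths_linv[of p S] by (auto simp: loops_at_def)
    then have "loop_class S (reversepath p) \<otimes>\<^bsub>?G\<^esub> x = \<one>\<^bsub>?G\<^esub>"
      using p by (simp add: one mult_loop_class loops_at_join loops_at_reversepath
          loop_class_eq_iff[of _ S x0])
    then show ?thesis
      using loops_at_reversepath[OF p(1)] by (auto simp: carr)
  qed
qed


section \<open>Torus knots\<close>

abbreviation sphere3 :: "(complex \<times> complex) set" where
  "sphere3 \<equiv> sphere 0 1"

text \<open>For coprime \<open>m\<close> and \<open>n\<close> this is a simple closed curve on the Clifford torus
  \<open>{(z, w). norm z = norm w = 1 / sqrt 2}\<close>, winding \<open>m\<close> times around in the first coordinate and
  \<open>n\<close> times in the second.\<close>

definition standard_torus_knot :: "nat \<Rightarrow> nat \<Rightarrow> (complex \<times> complex) set" where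
  "standard_torus_knot m n = range (\<lambda>t. (1 / sqrt 2) *\<^sub>R (cis (real m * t), cis (real n * t)))"

definition ambient_isotopic :: "'a::topological_space set \<Rightarrow> 'a set \<Rightarrow> 'a set \<Rightarrow> bool" where
  "ambient_isotopic M A B \<longleftrightarrow>
     (\<exists>H :: real \<Rightarrow> 'a \<Rightarrow> 'a.
        continuous_on ({0..1} \<times> M) (\<lambda>(t, x). H t x) \<and>
        (\<forall>t\<in>{0..1}. \<exists>g. homeomorphism M M (H t) g) \<and>
        (\<forall>x\<in>M. H 0 x = x) \<and>
        H 1 ` A = B)"

text \<open>Knots are considered up to ambient isotopy, so \<open>K\<close> need not be the standard model.
  Coprimality of \<open>m\<close> and \<open>n\<close> is left to the places where the predicate is used.\<close>

definition is_torus_knot :: "nat \<Rightarrow> nat \<Rightarrow> (complex \<times> complex) set \<Rightarrow> bool" where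
  "is_torus_knot m n K \<longleftrightarrow> ambient_isotopic sphere3 (standard_torus_knot m n) K"

lemma standard_torus_knot_subset: "standard_torus_knot m n \<subseteq> sphere3"
  by (auto simp: standard_torus_knot_def norm_Pair power_divide)

abbreviation knot_group ::
  "(complex \<times> complex) set \<Rightarrow> complex \<times> complex \<Rightarrow> (real \<Rightarrow> complex \<times> complex) set monoid" where
  "knot_group K x0 \<equiv> fundamental_group (sphere3 - K) x0"


section \<open>The generalized torsion equation spectrum\<close>

definition conj_by :: "('a, 'b) monoid_scheme \<Rightarrow> 'a \<Rightarrow> 'a \<Rightarrow> 'a" where
  "conj_by G g x = x \<otimes>\<^bsub>G\<^esub> g \<otimes>\<^bsub>G\<^esub> inv\<^bsub>G\<^esub> x"

text \<open>The list \<open>xs\<close> is the tuple of conjugating elements, and the fold is the ordered product of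
  the corresponding conjugates of \<open>g\<close>.\<close>

definition torsion_spectrum :: "('a, 'b) monoid_scheme \<Rightarrow> 'a \<Rightarrow> nat set" where
  "torsion_spectrum G g =
     {n. n \<ge> 1 \<and> (\<exists>xs. length xs = n \<and> set xs \<subseteq> carrier G \<and>
                     foldr (\<otimes>\<^bsub>G\<^esub>) (map (conj_by G g) xs) \<one>\<^bsub>G\<^esub> = \<one>\<^bsub>G\<^esub>)}"

end

theory Submission
  imports Defs "HOL-Algebra.Generated_Groups" "HOL-Complex_Analysis.Riemann_Mapping"
begin

text \<open>
  Put \<open>m = p ^ a\<close> and \<open>n = q ^ b\<close>. The knot group embeds into the group \<open>G\<close> of the exterior of
  the torus knot, which has the presentation \<open>x ^ n = y ^ m\<close> on two generators. The proof turns a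
  relation \<open>g ^ x1 \<cdots> g ^ xr = 1\<close> with \<open>g \<noteq> 1\<close> into a vanishing sum of \<open>r\<close> roots of unity of order
  dividing \<open>m * n\<close>, and then proves that such a sum needs \<open>p dvd r\<close> or \<open>q \<le> r\<close>.

  \<^emph>\<open>From the group to roots of unity.\<close> Let \<open>x\<close> and \<open>y\<close> act on the plane over \<open>\<complex>[s]\<close> by matrices whose
  \<open>n\<close>-th and \<open>m\<close>-th powers are the same scalar: \<open>x\<close> is diagonal, and the eigenlines of \<open>y\<close> move away from
  the coordinate axes as \<open>s\<close> varies. For generic \<open>s\<close> this representation is faithful, because in a
  reduced word the degrees in \<open>s\<close> cannot cancel (\<open>\<rho>_injective\<close>). At \<open>s = 0\<close> it is diagonal, with
  entries \<open>\<zeta> ^ d\<close> and \<open>2 ^ d\<close>, where \<open>d\<close> is the image in the abelianisation and \<open>\<zeta> = 2 * \<eta>\<close> for a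
  primitive root of unity \<open>\<eta>\<close> of order \<open>m * n\<close>. A relation forces \<open>d = 0\<close> for \<open>g\<close>, so \<open>g\<close> acts as
  \<open>1 + s ^ k * M\<close> with \<open>k \<ge> 1\<close> and \<open>M\<close> nonzero at \<open>s = 0\<close>. Leading terms of such matrices add under
  multiplication, and conjugation by an element of degree \<open>e\<close> multiplies the off-diagonal entries of the
  leading term by \<open>\<eta> ^ e\<close> and \<open>\<eta> ^ - e\<close> and fixes the diagonal ones. Hence the diagonal entries of \<open>M\<close>
  vanish at \<open>s = 0\<close>, some off-diagonal entry does not, and \<open>r\<close> powers of \<open>\<eta>\<close> add up to zero
  (\<open>torsion_spectrum_root_sum\<close>).

  \<^emph>\<open>Roots of unity.\<close> Suppose that \<open>r < q\<close> powers \<open>\<eta> ^ e i\<close> add up to zero. By the Frobenius congruence the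
  sum \<open>w\<close> of their \<open>q ^ b\<close>-th powers is \<open>q\<close> times an element of the ring \<open>\<int>[\<eta>]\<close>. The coordinates of
  \<open>w ^ k\<close> are at most a constant times \<open>r ^ k\<close> and divisible by \<open>q ^ k\<close>, so they are zero for large \<open>k\<close>.
  On the other hand, \<open>w ^ (p ^ a)\<close> is congruent to \<open>r\<close> modulo \<open>p\<close>; so \<open>p dvd r\<close>
  (\<open>vanishing_sum_of_roots_of_unity\<close>).

  \<^emph>\<open>The presentation.\<close> Up to radial scaling, the exterior is the union of two open solid tori whose
  intersection is path connected, and in each solid torus a loop is determined by a winding number. Half of
  van Kampen's theorem gives the generators (\<open>fundamental_group_generated_by_cover\<close>). The other half,
  the existence of homomorphisms into a group with suitable elements, is obtained from a local
  holonomy: a rule that assigns group elements to paths inside one of the tori extends uniquely to all paths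
  (\<open>holonomy_homotopic\<close>, \<open>holonomy_representation\<close>).
\<close>

section \<open>Vanishing sums of roots of unity\<close>

text \<open>The subring \<open>\<int>[\<eta>]\<close> of the complex numbers.\<close>
inductive_set int_span :: "complex \<Rightarrow> complex set" for \<eta> :: complex where
  power: "\<eta> ^ n \<in> int_span \<eta>"
| diff: "x \<in> int_span \<eta> \<Longrightarrow> y \<in> int_span \<eta> \<Longrightarrow> x - y \<in> int_span \<eta>"

lemma int_span_0: "0 \<in> int_span \<eta>"
  using int_span.diff[OF int_span.power[of \<eta> 0] int_span.power[of \<eta> 0]] by simp

lemma int_span_uminus: "x \<in> int_span \<eta> \<Longrightarrow> - x \<in> int_span \<eta>"
  using int_span.diff[OF int_span_0] by fastforce

lemma int_span_add: "x \<in> int_span \<eta> \<Longrightarrow> y \<in> int_span \<eta> \<Longrightarrow> x + y \<in> int_span \<eta>"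
  using int_span.diff[OF _ int_span_uminus, of x \<eta> y] by simp

lemma int_span_mult: "x \<in> int_span \<eta> \<Longrightarrow> y \<in> int_span \<eta> \<Longrightarrow> x * y \<in> int_span \<eta>"
proof (induction rule: int_span.induct)
  case (power n)
  from power.prems show ?case
    by (induction rule: int_span.induct)
      (auto simp: algebra_simps power_add[symmetric] intro: int_span.intros)
qed (auto simp: algebra_simps intro: int_span.diff)

lemma int_span_1: "1 \<in> int_span \<eta>"
  using int_span.power[of \<eta> 0] by simp

lemma int_span_power: "x \<in> int_span \<eta> \<Longrightarrow> x ^ n \<in> int_span \<eta>"
  by (induction n) (auto intro: int_span_1 int_span_mult)

lemma int_span_sum: "(\<And>i. i \<in> I \<Longrightarrow> f i \<in> int_span \<eta>) \<Longrightarrow> sum f I \<in> int_span \<eta>"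
  by (induction I rule: infinite_finite_induct) (auto intro: int_span_0 int_span_add)

lemma int_span_of_nat: "of_nat n \<in> int_span \<eta>"
  by (induction n) (auto intro: int_span_0 int_span_add int_span_1)

lemma freshman_add:
  assumes "prime q" "x \<in> int_span \<eta>" "y \<in> int_span \<eta>"
  shows "\<exists>z\<in>int_span \<eta>. (x + y) ^ q = x ^ q + y ^ q + of_nat q * z"
proof -
  have q: "q > 1" using assms(1) prime_gt_1_nat by blast
  have "(x + y) ^ q = (\<Sum>k\<le>q. of_nat (q choose k) * x ^ k * y ^ (q - k))"
    by (rule binomial_ring)
  also have "{..q} = insert 0 (insert q {0<..<q})" using q by auto
  also have "(\<Sum>k\<in>\<dots>. of_nat (q choose k) * x ^ k * y ^ (q - k)) =
     y ^ q + (x ^ q + (\<Sum>k\<in>{0<..<q}. of_nat (q choose k) * x ^ k * y ^ (q - k)))"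
    using q by simp
  also have "(\<Sum>k\<in>{0<..<q}. of_nat (q choose k) * x ^ k * y ^ (q - k)) =
     of_nat q * (\<Sum>k\<in>{0<..<q}. of_nat ((q choose k) div q) * (x ^ k * y ^ (q - k)))"
    unfolding sum_distrib_left
  proof (rule sum.cong)
    fix k assume k: "k \<in> {0<..<q}"
    have "q dvd (q choose k)" using dvd_choose_prime[of k q] k assms(1) by auto
    then have "(q choose k) = q * ((q choose k) div q)" by simp
    then have "(of_nat (q choose k) :: complex) = of_nat q * of_nat ((q choose k) div q)"
      by (metis of_nat_mult)
    then show "of_nat (q choose k) * x ^ k * y ^ (q - k) =
      of_nat q * (of_nat ((q choose k) div q) * (x ^ k * y ^ (q - k)))" by simp
  qed simp
  finally have "(x + y) ^ q = x ^ q + y ^ q +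
      of_nat q * (\<Sum>k\<in>{0<..<q}. of_nat ((q choose k) div q) * (x ^ k * y ^ (q - k)))"
    by simp
  then show ?thesis
    by (rule bexI) (intro int_span_sum int_span_mult int_span_of_nat int_span_power assms)
qed

lemma freshman_sum:
  assumes "prime q" "\<And>i. i \<in> I \<Longrightarrow> u i \<in> int_span \<eta>"
  shows "\<exists>z\<in>int_span \<eta>. (sum u I) ^ q = (\<Sum>i\<in>I. u i ^ q) + of_nat q * z"
  using assms(2)
proof (induction I rule: infinite_finite_induct)
  case (insert i I)
  then obtain z where z: "z \<in> int_span \<eta>" "(sum u I) ^ q = (\<Sum>i\<in>I. u i ^ q) + of_nat q * z" by auto
  obtain w where w: "w \<in> int_span \<eta>" "(u i + sum u I) ^ q = u i ^ q + (sum u I) ^ q + of_nat q * w"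
    using freshman_add[OF assms(1), of "u i" \<eta> "sum u I"] insert.prems int_span_sum[of I u \<eta>] by auto
  show ?case
    by (rule bexI[of _ "z + w"]) (use insert.hyps z w in \<open>auto simp: algebra_simps intro: int_span_add\<close>)
qed (use prime_gt_0_nat[OF assms(1)] in \<open>auto intro!: bexI[of _ 0] int_span_0\<close>)

text \<open>An error term that is divisible by \<open>q\<close> stays divisible by \<open>q\<close> when the next \<open>q\<close>-th power is taken.\<close>
lemma freshman_iterate:
  assumes "prime q" "\<And>i. i \<in> I \<Longrightarrow> u i \<in> int_span \<eta>"
  shows "\<exists>z\<in>int_span \<eta>. (sum u I) ^ (q ^ b) = (\<Sum>i\<in>I. u i ^ (q ^ b)) + of_nat q * z"
proof (induction b)
  case 0
  then show ?case by (auto intro!: bexI[of _ 0] int_span_0)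
next
  case (Suc b)
  then obtain z where z: "z \<in> int_span \<eta>" "(sum u I) ^ (q ^ b) = (\<Sum>i\<in>I. u i ^ (q ^ b)) + of_nat q * z" by auto
  let ?s = "\<Sum>i\<in>I. u i ^ (q ^ b)"
  have mem: "?s \<in> int_span \<eta>" "of_nat q * z \<in> int_span \<eta>"
    using assms z by (auto intro!: int_span_sum int_span_power int_span_mult int_span_of_nat)
  obtain w where w: "w \<in> int_span \<eta>" "(?s + of_nat q * z) ^ q = ?s ^ q + (of_nat q * z) ^ q + of_nat q * w"
    using freshman_add[OF assms(1) mem] by auto
  obtain v where v: "v \<in> int_span \<eta>" "?s ^ q = (\<Sum>i\<in>I. (u i ^ (q ^ b)) ^ q) + of_nat q * v"
    using freshman_sum[OF assms(1), of I "\<lambda>i. u i ^ (q ^ b)" \<eta>] assms int_span_power by auto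
  obtain q' where q': "q = Suc q'" using prime_gt_0_nat[OF assms(1)] gr0_implies_Suc by blast
  have "(sum u I) ^ (q ^ Suc b) = ((sum u I) ^ (q ^ b)) ^ q"
    by (simp add: power_mult[symmetric] mult.commute)
  also have "\<dots> = (\<Sum>i\<in>I. u i ^ (q ^ Suc b)) + of_nat q * (v + w + z * (of_nat q * z) ^ q')"
  proof -
    have "(\<Sum>i\<in>I. (u i ^ (q ^ b)) ^ q) = (\<Sum>i\<in>I. u i ^ (q ^ Suc b))"
      by (simp add: power_mult[symmetric] mult.commute)
    moreover have "(of_nat q * z) ^ q = of_nat q * (z * (of_nat q * z) ^ q')"
      by (simp add: q')
    ultimately show ?thesis using z(2) w(2) v(2) by (simp add: distrib_left)
  qed
  finally show ?case
    by (rule bexI) (use v w z in \<open>auto intro!: int_span_add int_span_mult int_span_power int_span_of_nat\<close>)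
qed

text \<open>Coordinates on \<open>\<int>[\<eta>]\<close> come from a functional that is linear over the rationals; it exists because a nonzero
  vector can be extended to a basis.\<close>
lemma rational_functional:
  fixes x :: complex assumes "x \<noteq> 0"
  obtains \<phi> :: "complex \<Rightarrow> rat" where "\<And>y z. \<phi> (y - z) = \<phi> y - \<phi> z"
    "\<And>c y. \<phi> (of_rat c * y) = c * \<phi> y" "\<phi> x = 1"
proof -
  interpret vp: vector_space_pair "\<lambda>(r::rat) (z::complex). of_rat r * z" "(*) :: rat \<Rightarrow> rat \<Rightarrow> rat"
    by unfold_locales (auto simp: algebra_simps of_rat_add of_rat_mult)
  have "vp.vs1.independent {x}" using assms by (simp add: vp.vs1.dependent_single)
  from vp.linear_independent_extend[OF this, of "\<lambda>_. 1"]
  obtain g where g: "Vector_Spaces.linear (\<lambda>(r::rat) (z::complex). of_rat r * z) (*) g" "g x = 1" by auto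
  show ?thesis
    by (rule that[of g]) (use vp.linear_diff[OF g(1)] vp.linear_scale[OF g(1)] g(2) in auto)
qed

lemma power_mod_period:
  fixes \<eta> :: complex
  assumes "\<eta> ^ N = 1"
  shows "\<eta> ^ j = \<eta> ^ (j mod N)"
proof -
  have "\<eta> ^ j = \<eta> ^ (N * (j div N) + j mod N)" by simp
  also have "\<dots> = \<eta> ^ (j mod N)" unfolding power_add power_mult assms by simp
  finally show ?thesis .
qed

text \<open>Clearing the denominators of the finitely many values at powers of \<open>\<eta>\<close> makes the functional integral on
  \<open>\<int>[\<eta>]\<close>.\<close>
lemma integer_functional:
  fixes \<eta> x :: complex
  assumes N: "\<eta> ^ N = 1" "N > 0" and x: "x \<noteq> 0"
  obtains f :: "complex \<Rightarrow> real" where "\<And>y z. f (y - z) = f y - f z"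
    "\<And>k y. f (of_nat k * y) = of_nat k * f y" "\<And>y. y \<in> int_span \<eta> \<Longrightarrow> f y \<in> \<int>" "f x \<noteq> 0"
proof -
  from rational_functional[OF x] obtain \<phi> :: "complex \<Rightarrow> rat" where \<phi>: "\<And>y z. \<phi> (y - z) = \<phi> y - \<phi> z"
    "\<And>c y. \<phi> (of_rat c * y) = c * \<phi> y" "\<phi> x = 1" by metis
  define d where "d j = snd (quotient_of (\<phi> (\<eta> ^ j)))" for j
  define D where "D = (\<Prod>j<N. d j)"
  have d: "d j > 0" "of_int (d j) * \<phi> (\<eta> ^ j) \<in> \<int>" for j
  proof -
    show d0: "d j > 0" by (simp add: d_def quotient_of_denom_pos')
    obtain n m where nm: "quotient_of (\<phi> (\<eta> ^ j)) = (n, m)" by fastforce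
    then have "\<phi> (\<eta> ^ j) = of_int n / of_int m" by (rule quotient_of_div)
    moreover have "d j = m" using nm by (simp add: d_def)
    ultimately have "of_int (d j) * \<phi> (\<eta> ^ j) = of_int n" using d0 by simp
    then show "of_int (d j) * \<phi> (\<eta> ^ j) \<in> \<int>" by simp
  qed
  have D: "D > 0" using d by (simp add: D_def prod_pos)
  have int0: "of_int D * \<phi> (\<eta> ^ j) \<in> \<int>" for j
  proof -
    have j: "j mod N < N" using N by simp
    note power_mod_period[OF N(1), of j]
    moreover have "D = d (j mod N) * (\<Prod>i\<in>{..<N}-{j mod N}. d i)"
      unfolding D_def by (rule prod.remove) (use j in auto)
    ultimately have "of_int D * \<phi> (\<eta> ^ j) = of_int (\<Prod>i\<in>{..<N}-{j mod N}. d i) * (of_int (d (j mod N)) * \<phi> (\<eta> ^ (j mod N)))"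
      by (simp add: ac_simps)
    then show ?thesis using d(2)[of "j mod N"] by (auto intro!: Ints_mult)
  qed
  have int: "of_int D * \<phi> y \<in> \<int>" if "y \<in> int_span \<eta>" for y
    using that by (induction) (use int0 in \<open>auto simp: \<phi>(1) right_diff_distrib intro: Ints_diff\<close>)
  show ?thesis
  proof (rule that[of "\<lambda>y. of_rat (of_int D * \<phi> y)"])
    show "of_rat (of_int D * \<phi> (of_nat k * y)) = of_nat k * (of_rat (of_int D * \<phi> y) :: real)" for k y
      using \<phi>(2)[of "of_nat k" y] by (simp add: of_rat_mult)
    show "of_rat (of_int D * \<phi> y) \<in> (\<int> :: real set)" if "y \<in> int_span \<eta>" for y
      using int[OF that] by (auto simp: Ints_def)
  qed (use \<phi> D in \<open>auto simp: of_rat_mult of_rat_diff right_diff_distrib\<close>)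
qed

lemma functional_sum:
  fixes f :: "complex \<Rightarrow> real"
  assumes "\<And>y z. f (y - z) = f y - f z"
  shows "f 0 = 0" "f (x + y) = f x + f y" "f (sum g I) = (\<Sum>i\<in>I. f (g i))"
proof -
  show f0: "f 0 = 0" using assms[of 0 0] by simp
  show add: "f (x + y) = f x + f y" for x y using assms[of x "0 - y"] assms[of 0 y] f0 by simp
  show "f (sum g I) = (\<Sum>i\<in>I. f (g i))"
    by (induction I rule: infinite_finite_induct) (auto simp: f0 add)
qed

text \<open>Since \<open>r\<close> is invertible modulo \<open>p\<close>, the relation makes every value of \<open>g\<close> divisible by \<open>p\<close> once more than all
  values are known to be; an integer divisible by all powers of \<open>p\<close> is zero.\<close>
lemma infinitely_divisible_imp_zero:
  fixes g :: "complex \<Rightarrow> real"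
  assumes p: "prime p" "\<not> p dvd r"
    and int: "\<And>x. x \<in> S \<Longrightarrow> g x \<in> \<int>"
    and rel: "\<And>x. x \<in> S \<Longrightarrow> real r * g x = - real p * g (x * y)"
    and closed: "\<And>x. x \<in> S \<Longrightarrow> x * y \<in> S"
  shows "\<forall>x\<in>S. g x = 0"
proof
  fix x assume x: "x \<in> S"
  define G where "G x = \<lfloor>g x\<rfloor>" for x
  have G: "g x = of_int (G x)" if "x \<in> S" for x
    using int[OF that] by (auto simp: G_def elim!: Ints_cases)
  have relG: "int r * G x = - int p * G (x * y)" if "x \<in> S" for x
  proof -
    have "real_of_int (int r * G x) = real_of_int (- int p * G (x * y))"
      using rel[OF that] G[OF that] G[OF closed[OF that]] by simp
    then show ?thesis by (simp only: of_int_eq_iff)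
  qed
  have "int p ^ n dvd G x" if "x \<in> S" for x n
    using that
  proof (induction n arbitrary: x)
    case (Suc n)
    have "int p ^ n dvd G (x * y)" by (rule Suc.IH[OF closed[OF Suc.prems]])
    then have "int p ^ Suc n dvd int r * G x"
      unfolding relG[OF Suc.prems] by simp
    moreover have "coprime (int p ^ Suc n) (int r)"
      using p by (simp add: prime_imp_coprime)
    ultimately show ?case by (simp only: coprime_dvd_mult_right_iff)
  qed simp
  from this[OF x] have "int p ^ n dvd G x" for n .
  moreover obtain n where "\<bar>G x\<bar> < int p ^ n"
  proof -
    have "nat \<bar>G x\<bar> < 2 ^ nat \<bar>G x\<bar>" by (rule less_exp)
    also have "\<dots> \<le> p ^ nat \<bar>G x\<bar>" using prime_ge_2_nat[OF p(1)] by (rule power_mono) simp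
    finally show ?thesis by (intro that[of "nat \<bar>G x\<bar>"]) (simp add: nat_less_iff)
  qed
  ultimately obtain n where n: "int p ^ n dvd G x" "\<bar>G x\<bar> < int p ^ n" by blast
  have "G x = 0"
  proof (rule ccontr)
    assume "G x \<noteq> 0"
    from dvd_imp_le_int[OF this n(1)] n(2) show False by simp
  qed
  then show "g x = 0" using G[OF x] by simp
qed

text \<open>By the theorem of Lam and Leung the number of summands lies in \<open>p\<nat> + q\<nat>\<close>. That it is at least \<open>q\<close> or
  divisible by \<open>p\<close> follows from congruences modulo \<open>q\<close> and \<open>p\<close> together with a size estimate: integers below \<open>C * r ^ k\<close> in absolute value that are
  divisible by \<open>q ^ k\<close> vanish for large \<open>k\<close> if \<open>r < q\<close>.\<close>
theorem vanishing_sum_of_roots_of_unity: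
  fixes \<eta> :: complex and e :: "nat \<Rightarrow> nat"
  assumes p: "prime p" and q: "prime q" and \<eta>: "\<eta> ^ (p ^ a * q ^ b) = 1"
    and sum: "(\<Sum>i<r. \<eta> ^ e i) = 0"
  shows "p dvd r \<or> q \<le> r"
proof (rule ccontr)
  assume "\<not> (p dvd r \<or> q \<le> r)"
  then have r: "\<not> p dvd r" "r < q" by auto
  define N where "N = p ^ a * q ^ b"
  have N: "N > 0" "\<eta> ^ N = 1" using p q \<eta> by (simp_all add: N_def prime_gt_0_nat)
  define w where "w = (\<Sum>i<r. (\<eta> ^ e i) ^ (q ^ b))"
  have "\<exists>z\<in>int_span \<eta>. (\<Sum>i<r. \<eta> ^ e i) ^ (q ^ b) = w + of_nat q * z"
    unfolding w_def by (rule freshman_iterate[OF q]) (rule int_span.power)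
  then obtain z where z: "z \<in> int_span \<eta>" "(\<Sum>i<r. \<eta> ^ e i) ^ (q ^ b) = w + of_nat q * z" by blast
  have "w + of_nat q * z = 0"
    unfolding z(2)[symmetric] sum using prime_gt_0_nat[OF q] by (simp add: zero_power)
  then have wz: "w = - (of_nat q * z)" by (rule add_eq_0_iff2[THEN iffD1])
  have "\<exists>z\<in>int_span \<eta>. w ^ (p ^ a) = (\<Sum>i<r. ((\<eta> ^ e i) ^ (q ^ b)) ^ (p ^ a)) + of_nat p * z"
    unfolding w_def by (rule freshman_iterate[OF p]) (intro int_span_power int_span.power)
  moreover have "((\<eta> ^ e i) ^ (q ^ b)) ^ (p ^ a) = 1" for i
  proof -
    have "((\<eta> ^ e i) ^ (q ^ b)) ^ (p ^ a) = (\<eta> ^ (p ^ a * q ^ b)) ^ e i"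
      by (simp add: power_mult[symmetric] mult.commute mult.left_commute)
    then show ?thesis using \<eta> by simp
  qed
  ultimately obtain y where y: "y \<in> int_span \<eta>" "w ^ (p ^ a) = of_nat r + of_nat p * y"
    by auto
  obtain f :: "complex \<Rightarrow> real" where f: "\<And>y z. f (y - z) = f y - f z"
    "\<And>k y. f (of_nat k * y) = of_nat k * f y" "\<And>y. y \<in> int_span \<eta> \<Longrightarrow> f y \<in> \<int>" "f 1 \<noteq> 0"
    using integer_functional[OF N(2,1) one_neq_zero] by metis
  note fs = functional_sum[of f, OF f(1)]
  \<comment> \<open>The powers of \<open>\<eta>\<close> are finite in number, so \<open>f\<close> is bounded on them; expanding \<open>w ^ k\<close> into \<open>r ^ k\<close> of
    them bounds \<open>f\<close> on the powers of \<open>w\<close>.\<close>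
  obtain C where C: "C > 0" "\<And>j. \<bar>f (\<eta> ^ j)\<bar> \<le> C"
  proof (rule that[of "1 + (\<Sum>j<N. \<bar>f (\<eta> ^ j)\<bar>)"])
    fix j
    note power_mod_period[OF N(2), of j]
    moreover have "\<bar>f (\<eta> ^ (j mod N))\<bar> \<le> (\<Sum>j<N. \<bar>f (\<eta> ^ j)\<bar>)"
      using N(1) by (intro member_le_sum) auto
    ultimately show "\<bar>f (\<eta> ^ j)\<bar> \<le> 1 + (\<Sum>j<N. \<bar>f (\<eta> ^ j)\<bar>)" by simp
  qed (simp add: add_pos_nonneg sum_nonneg)
  have bound: "\<bar>f (\<eta> ^ j * w ^ k)\<bar> \<le> C * real r ^ k" for j k
  proof (induction k arbitrary: j)
    case (Suc k)
    have "\<eta> ^ j * w ^ Suc k = (\<Sum>i<r. \<eta> ^ (j + e i * q ^ b) * w ^ k)"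
      by (simp add: w_def sum_distrib_left sum_distrib_right power_add power_mult algebra_simps)
    then have "\<bar>f (\<eta> ^ j * w ^ Suc k)\<bar> \<le> (\<Sum>i<r. \<bar>f (\<eta> ^ (j + e i * q ^ b) * w ^ k)\<bar>)"
      by (simp add: fs sum_abs)
    also have "\<dots> \<le> (\<Sum>i<r. C * real r ^ k)" by (intro sum_mono Suc.IH)
    finally show ?case by (simp add: algebra_simps)
  qed (use C in auto)
  have "(\<lambda>k. C * (real r / real q) ^ k) \<longlonglongrightarrow> C * 0"
    using r(2) by (intro tendsto_intros LIMSEQ_power_zero) auto
  then have "eventually (\<lambda>k. C * (real r / real q) ^ k < 1) sequentially"
    by (rule order_tendstoD) simp
  then obtain K where K: "\<And>k. k \<ge> K \<Longrightarrow> C * (real r / real q) ^ k < 1"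
    by (auto simp: eventually_sequentially)
  have zero: "f (\<eta> ^ j * w ^ k) = 0" if "k \<ge> K" for j k
  proof -
    have q0: "real q ^ k > 0" using q by (simp add: prime_gt_0_nat)
    have wk: "w ^ k = of_nat (q ^ k) * (- z) ^ k" by (simp add: wz power_mult_distrib[symmetric])
    have "f (\<eta> ^ j * w ^ k) = f (of_nat (q ^ k) * (\<eta> ^ j * (- z) ^ k))"
      unfolding wk by (simp add: mult.left_commute)
    also have "\<dots> = of_nat (q ^ k) * f (\<eta> ^ j * (- z) ^ k)" by (rule f(2))
    finally have eq: "f (\<eta> ^ j * w ^ k) = real q ^ k * f (\<eta> ^ j * (- z) ^ k)" by simp
    then have "real q ^ k * \<bar>f (\<eta> ^ j * (- z) ^ k)\<bar> \<le> C * real r ^ k"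
      using bound[of j k] by (simp add: abs_mult)
    then have "\<bar>f (\<eta> ^ j * (- z) ^ k)\<bar> \<le> C * (real r / real q) ^ k"
      using q0 by (simp add: power_divide field_simps)
    also have "\<dots> < 1" using K that by auto
    finally have "\<bar>f (\<eta> ^ j * (- z) ^ k)\<bar> < 1" .
    moreover have "f (\<eta> ^ j * (- z) ^ k) \<in> \<int>"
      using z(1) by (intro f(3) int_span_mult int_span_power int_span.power int_span_uminus)
    ultimately have "f (\<eta> ^ j * (- z) ^ k) = 0" by (metis Ints_nonzero_abs_less1)
    then show ?thesis using eq by simp
  qed
  have zero': "f (x * w ^ k) = 0" if "k \<ge> K" "x \<in> int_span \<eta>" for x k
    using that(2) by induction (auto simp: zero[OF that(1)] left_diff_distrib f(1))
  \<comment> \<open>Since \<open>v\<close> is \<open>r\<close> modulo \<open>p\<close>, its factors can be removed one by one from the products on which \<open>f\<close> vanishes.\<close>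
  define v where "v = w ^ (p ^ a)"
  have v: "v \<in> int_span \<eta>" unfolding v_def y(2)
    by (intro int_span_add int_span_mult int_span_of_nat y(1))
  have step: "\<forall>x\<in>int_span \<eta>. f (x * v ^ k) = 0" if IH: "\<forall>x\<in>int_span \<eta>. f (x * v ^ Suc k) = 0" for k
  proof (rule infinitely_divisible_imp_zero[OF p r(1)])
    fix x assume x: "x \<in> int_span \<eta>"
    show "f (x * v ^ k) \<in> \<int>" using x v by (intro f(3) int_span_mult int_span_power)
    have "0 = f (of_nat r * (x * v ^ k) + of_nat p * (x * y * v ^ k))"
      using IH x y(2) by (auto simp: v_def[symmetric] algebra_simps)
    also have "\<dots> = real r * f (x * v ^ k) + real p * f (x * y * v ^ k)"
      using f(2) by (simp add: fs)
    finally show "real r * f (x * v ^ k) = - real p * f (x * y * v ^ k)" by simp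
    show "x * y \<in> int_span \<eta>" using x y(1) by (rule int_span_mult)
  qed
  have "\<forall>x\<in>int_span \<eta>. f (x * v ^ (K - k)) = 0" for k
  proof (induction k)
    case 0
    have "K \<le> p ^ a * K" using p by (simp add: prime_gt_0_nat Suc_le_eq)
    then show ?case using zero' by (auto simp: v_def power_mult[symmetric])
  next
    case (Suc k)
    show ?case
    proof (cases "k < K")
      case True
      then have "K - k = Suc (K - Suc k)" by simp
      then show ?thesis using step[of "K - Suc k"] Suc by simp
    qed (use Suc in simp)
  qed
  from this[of K] have "f 1 = 0" using int_span_1 by force
  then show False using f(4) by simp
qed

section \<open>Two-by-two matrices over the polynomial ring\<close>

definition mat2 :: "'a \<Rightarrow> 'a \<Rightarrow> 'a \<Rightarrow> 'a \<Rightarrow> 'a::comm_ring_1^2^2" where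
  "mat2 p q r s = vector [vector [p, q], vector [r, s]]"

lemma mat2_nth [simp]:
  "mat2 p q r s $ 1 $ 1 = p" "mat2 p q r s $ 1 $ 2 = q" "mat2 p q r s $ 2 $ 1 = r" "mat2 p q r s $ 2 $ 2 = s"
  by (simp_all add: mat2_def)

lemma mat2_eq_iff [simp]: "mat2 p q r s = mat2 p' q' r' s' \<longleftrightarrow> p = p' \<and> q = q' \<and> r = r' \<and> s = s'"
  by (auto simp: vec_eq_iff forall_2)

lemma mat2_mult [simp]: "mat2 p q r s ** mat2 p' q' r' s' =
    mat2 (p * p' + q * r') (p * q' + q * s') (r * p' + s * r') (r * q' + s * s')"
  by (simp add: vec_eq_iff forall_2 matrix_matrix_mult_def sum_2)

lemma mat2_one: "mat 1 = mat2 1 0 0 1"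
  by (simp add: vec_eq_iff forall_2 mat_def)

lemma mat2_cases: obtains p q r s where "A = mat2 p q r s"
  by (rule that[of "A $ 1 $ 1" "A $ 1 $ 2" "A $ 2 $ 1" "A $ 2 $ 2"]) (simp add: vec_eq_iff forall_2)

definition GL2_poly :: "(complex poly^2^2) monoid" where
  "GL2_poly = units_of \<lparr>carrier = UNIV, mult = (**), one = mat 1\<rparr>"

lemma group_GL2_poly: "group GL2_poly"
  unfolding GL2_poly_def
  by (rule monoid.units_group, unfold_locales) (auto simp: matrix_mul_assoc matrix_mul_lid matrix_mul_rid)

lemma GL2_poly_simps [simp]: "mult GL2_poly = (**)" "one GL2_poly = mat2 1 0 0 1"
  by (simp_all add: GL2_poly_def units_of_def mat2_one)

lemma GL2_polyI: "A ** B = mat2 1 0 0 1 \<Longrightarrow> B ** A = mat2 1 0 0 1 \<Longrightarrow> A \<in> carrier GL2_poly"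
  by (auto simp: GL2_poly_def units_of_def Units_def mat2_one)

definition diag_mat :: "complex \<Rightarrow> complex \<Rightarrow> complex poly^2^2" where
  "diag_mat u v = mat2 [:u:] 0 0 [:v:]"

text \<open>This is \<open>v\<close> times the identity plus \<open>u - v\<close> times the idempotent with columns \<open>(1 + s\<^sup>2, s)\<close> and
  \<open>(- s - s ^ 3, - s\<^sup>2)\<close>: a matrix with eigenvalues \<open>u\<close> and \<open>v\<close> whose eigenlines depend on \<open>s\<close> and are the coordinate
  axes at \<open>s = 0\<close>.\<close>
definition tilted_mat :: "complex \<Rightarrow> complex \<Rightarrow> complex poly^2^2" where
  "tilted_mat u v = mat2 [:u, 0, u - v:] [:0, v - u, 0, v - u:] [:0, u - v:] [:v, 0, v - u:]"

lemma diag_mat_mult: "diag_mat u v ** diag_mat u' v' = diag_mat (u * u') (v * v')"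
  by (simp add: diag_mat_def)

lemma tilted_mat_mult: "tilted_mat u v ** tilted_mat u' v' = tilted_mat (u * u') (v * v')"
  by (simp add: tilted_mat_def algebra_simps)

lemma diag_mat_1: "diag_mat 1 1 = mat2 1 0 0 1" by (simp add: diag_mat_def one_pCons)

lemma tilted_mat_scalar: "tilted_mat u u = diag_mat u u"
  by (simp add: tilted_mat_def diag_mat_def)

lemma diag_mat_pow: "diag_mat u v [^]\<^bsub>GL2_poly\<^esub> (k::nat) = diag_mat (u ^ k) (v ^ k)"
  by (induction k) (simp_all add: diag_mat_1 diag_mat_mult mult.commute)

lemma tilted_mat_pow: "tilted_mat u v [^]\<^bsub>GL2_poly\<^esub> (k::nat) = tilted_mat (u ^ k) (v ^ k)"
  by (induction k) (simp_all add: tilted_mat_scalar diag_mat_1 tilted_mat_mult mult.commute)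

lemma diag_mat_closed: "u \<noteq> 0 \<Longrightarrow> v \<noteq> 0 \<Longrightarrow> diag_mat u v \<in> carrier GL2_poly"
  by (rule GL2_polyI[of _ "diag_mat (1/u) (1/v)"]) (simp_all add: diag_mat_mult diag_mat_1)

lemma tilted_mat_closed: "u \<noteq> 0 \<Longrightarrow> v \<noteq> 0 \<Longrightarrow> tilted_mat u v \<in> carrier GL2_poly"
  by (rule GL2_polyI[of _ "tilted_mat (1/u) (1/v)"]) (simp_all add: tilted_mat_mult tilted_mat_scalar diag_mat_1)

text \<open>Bounds for the degrees in the second column, with the coefficients at these bounds. Both are allowed to be zero, because
  the constant matrix at the right end of a word has upper entry zero.\<close>
definition column_growth :: "nat \<Rightarrow> complex \<Rightarrow> complex \<Rightarrow> complex poly^2^2 \<Rightarrow> bool" where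
  "column_growth d k l A \<longleftrightarrow> coeff (A $ 1 $ 2) (Suc d) = k \<and> coeff (A $ 2 $ 2) d = l \<and>
     (\<forall>i>Suc d. coeff (A $ 1 $ 2) i = 0) \<and> (\<forall>i>d. coeff (A $ 2 $ 2) i = 0)"

lemma column_growth_diag_mat: "column_growth 0 0 v (diag_mat u v)"
  by (auto simp: column_growth_def diag_mat_def coeff_pCons split: nat.splits)

lemma column_growth_diag_mat_mult: "column_growth d k l A \<Longrightarrow> column_growth d (u * k) (v * l) (diag_mat u v ** A)"
  by (cases A rule: mat2_cases) (auto simp: column_growth_def diag_mat_def)

text \<open>The idempotent in \<open>tilted_mat\<close> has rank one, so it makes the two leading coefficients equal, to a constant times their
  former difference. Growth therefore continues as long as they differ before the multiplication.\<close>
lemma column_growth_tilted_mat_mult: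
  assumes "column_growth d k l A"
  shows "column_growth (Suc (Suc d)) ((u - v) * (k - l)) ((u - v) * (k - l)) (tilted_mat u v ** A)"
proof (cases A rule: mat2_cases)
  case (1 p q r s)
  have c: "coeff ([:0, w:] * f) i = (case i of 0 \<Rightarrow> 0 | Suc j \<Rightarrow> w * coeff f j)"
    "coeff ([:x, 0, w:] * f) i = x * coeff f i + (case i of Suc (Suc j) \<Rightarrow> w * coeff f j | _ \<Rightarrow> 0)"
    "coeff ([:0, w, 0, w:] * f) i = (case i of 0 \<Rightarrow> 0 | Suc j \<Rightarrow> w * coeff f j) +
        (case i of Suc (Suc (Suc j)) \<Rightarrow> w * coeff f j | _ \<Rightarrow> 0)" for w x :: complex and f i
    by (auto simp: coeff_pCons split: nat.splits)
  show ?thesis using assms unfolding 1 column_growth_def tilted_mat_def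
    by (auto simp: c coeff_pCons algebra_simps split: nat.splits)
qed

definition prim_root :: "nat \<Rightarrow> complex" where
  "prim_root k = exp (2 * of_real pi * \<i> / of_nat k)"

lemma prim_root_power: "prim_root k ^ j = exp (2 * of_real pi * \<i> * of_nat j / of_nat k)"
  by (simp add: prim_root_def exp_of_nat_mult[symmetric] mult_ac)

lemma prim_root_power_eq_1_iff: "k > 0 \<Longrightarrow> prim_root k ^ j = 1 \<longleftrightarrow> k dvd j"
  unfolding prim_root_power by (rule complex_root_unity_eq_1) simp

lemma prim_root_nonzero [simp]: "prim_root k \<noteq> 0" by (simp add: prim_root_def)

lemma prim_root_mult_power: "k > 0 \<Longrightarrow> prim_root (j * k) ^ k = prim_root j"
  by (simp add: prim_root_power) (simp add: prim_root_def)

lemma power_int_mod_period: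
  fixes \<eta> :: complex
  assumes "\<eta> ^ N = 1" "\<eta> \<noteq> 0" "N > 0"
  shows "\<eta> powi z = \<eta> ^ nat (z mod int N)"
proof -
  have "\<eta> powi z = \<eta> powi (int N * (z div int N) + z mod int N)" by simp
  also have "\<dots> = (\<eta> powi int N) powi (z div int N) * \<eta> powi (z mod int N)"
    using assms(2) by (simp only: power_int_add power_int_mult simp_thms)
  also have "\<eta> powi int N = 1" using assms(1) by simp
  finally show ?thesis using assms(3) by (simp add: power_int_def)
qed

text \<open>The factors \<open>2 ^ m\<close> and \<open>2 ^ n\<close> record the degree in the abelianisation, so that the central element
  \<open>x ^ n\<close> does not become trivial.\<close>
definition X_mat :: "nat \<Rightarrow> nat \<Rightarrow> complex poly^2^2" where
  "X_mat m n = diag_mat (2 ^ m * prim_root n) (2 ^ m)"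

definition Y_mat :: "nat \<Rightarrow> nat \<Rightarrow> complex poly^2^2" where
  "Y_mat m n = tilted_mat (2 ^ n * prim_root m) (2 ^ n)"

lemma X_mat_closed: "X_mat m n \<in> carrier GL2_poly"
  unfolding X_mat_def by (rule diag_mat_closed) auto

lemma Y_mat_closed: "Y_mat m n \<in> carrier GL2_poly"
  unfolding Y_mat_def by (rule tilted_mat_closed) auto

lemma X_mat_Y_mat_relation:
  assumes "m > 0" "n > 0"
  shows "X_mat m n [^]\<^bsub>GL2_poly\<^esub> n = Y_mat m n [^]\<^bsub>GL2_poly\<^esub> m"
  using assms prim_root_power_eq_1_iff[of n n] prim_root_power_eq_1_iff[of m m]
  by (simp add: X_mat_def Y_mat_def diag_mat_pow tilted_mat_pow tilted_mat_scalar power_mult_distrib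
      power_mult[symmetric] mult.commute)

section \<open>A faithful representation and its constant term\<close>

locale torus_knot_rep = group G for G :: "'a monoid" (structure) +
  fixes x y and m n :: nat and \<rho>
  assumes xy: "x \<in> carrier G" "y \<in> carrier G" and gen: "generate G {x, y} = carrier G"
    and mn: "m > 1" "n > 1" and rel: "x [^] n = y [^] m"
    and \<rho>: "\<rho> \<in> hom G GL2_poly" "\<rho> x = X_mat m n" "\<rho> y = Y_mat m n"
begin

text \<open>Reduced words of the free product of cyclic groups that remains modulo the centre. They start with a power of \<open>y\<close>, the
  generator that increases degrees; the final power of \<open>x\<close> needs no normalisation, since it acts by a constant diagonal matrix.\<close>
inductive_set reduced where
  last: "0 < (j::nat) \<Longrightarrow> j < m \<Longrightarrow> y [^] j \<otimes> x [^] (i::nat) \<in> reduced"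
| step: "0 < (j::nat) \<Longrightarrow> j < m \<Longrightarrow> 0 < (i::nat) \<Longrightarrow> i < n \<Longrightarrow> w \<in> reduced \<Longrightarrow> y [^] j \<otimes> (x [^] i \<otimes> w) \<in> reduced"

lemma reduced_closed: "w \<in> reduced \<Longrightarrow> w \<in> carrier G"
  by (induction rule: reduced.induct) (auto simp: xy)

lemma pow_Suc_left: "z \<in> carrier G \<Longrightarrow> w \<in> carrier G \<Longrightarrow> z \<otimes> (z [^] (j::nat) \<otimes> w) = z [^] Suc j \<otimes> w"
  by (metis nat_pow_Suc2 m_assoc nat_pow_closed)

lemma c_pow_commute:
  assumes "w \<in> carrier G"
  shows "x [^] (n * k) \<otimes> (x \<otimes> w) = x \<otimes> (x [^] (n * k) \<otimes> w)"
    "x [^] (n * k) \<otimes> (y \<otimes> w) = y \<otimes> (x [^] (n * k) \<otimes> w)"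
proof -
  have "x [^] (n * k) \<otimes> x = x \<otimes> x [^] (n * k)"
    using xy by (simp add: nat_pow_Suc2[symmetric])
  then show "x [^] (n * k) \<otimes> (x \<otimes> w) = x \<otimes> (x [^] (n * k) \<otimes> w)"
    using xy assms by (simp add: m_assoc[symmetric])
  have "x [^] (n * k) = y [^] (m * k)"
    using rel xy by (simp add: nat_pow_pow[symmetric])
  moreover have "y [^] (m * k) \<otimes> y = y \<otimes> y [^] (m * k)"
    using xy by (simp add: nat_pow_Suc2[symmetric])
  ultimately show "x [^] (n * k) \<otimes> (y \<otimes> w) = y \<otimes> (x [^] (n * k) \<otimes> w)"
    using xy assms by (simp add: m_assoc[symmetric])
qed

text \<open>The power \<open>x ^ (n * k)\<close> is central. Putting it on the side of \<open>g\<close> keeps all exponents natural numbers although \<open>g\<close> may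
  involve negative central powers.\<close>
definition normal_forms where
  "normal_forms = {g \<in> carrier G. \<exists>k (e::nat). \<exists>w \<in> insert \<one> reduced. x [^] (n * k) \<otimes> g = x [^] e \<otimes> w}"

lemma normal_formsI:
  "g \<in> carrier G \<Longrightarrow> w \<in> insert \<one> reduced \<Longrightarrow> x [^] (n * k) \<otimes> g = x [^] (e::nat) \<otimes> w \<Longrightarrow> g \<in> normal_forms"
  by (auto simp: normal_forms_def)

lemma normal_formsE:
  assumes "g \<in> normal_forms"
  obtains k e :: nat and w where "g \<in> carrier G" "w \<in> insert \<one> reduced" "w \<in> carrier G"
    "x [^] (n * k) \<otimes> g = x [^] e \<otimes> w"
  using assms reduced_closed by (auto simp: normal_forms_def)

lemma normal_forms_x: "g \<in> normal_forms \<Longrightarrow> x \<otimes> g \<in> normal_forms"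
proof (elim normal_formsE)
  fix k e :: nat and w
  assume g: "g \<in> carrier G" "w \<in> insert \<one> reduced" "w \<in> carrier G" "x [^] (n * k) \<otimes> g = x [^] e \<otimes> w"
  have "x [^] (n * k) \<otimes> (x \<otimes> g) = x \<otimes> (x [^] e \<otimes> w)"
    using c_pow_commute(1)[OF g(1)] g(4) by simp
  also have "\<dots> = x [^] Suc e \<otimes> w"
    by (rule pow_Suc_left[OF xy(1) g(3)])
  finally have "x [^] (n * k) \<otimes> (x \<otimes> g) = x [^] Suc e \<otimes> w" .
  from normal_formsI[OF _ g(2) this] show "x \<otimes> g \<in> normal_forms" using g xy by simp
qed

lemma y_reduced:
  assumes "w \<in> insert \<one> reduced"
  shows "\<exists>e. \<exists>w'\<in>insert \<one> reduced. y \<otimes> w = x [^] (e::nat) \<otimes> w'"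
proof -
  have Y: "y \<otimes> (y [^] j \<otimes> v) = y [^] Suc j \<otimes> v" if "v \<in> carrier G" for v j
    by (rule pow_Suc_left[OF xy(2) that])
  consider "w = \<one>" | j i where "0 < j" "j < m" "w = y [^] j \<otimes> x [^] (i::nat)"
    | j i v where "0 < j" "j < m" "0 < i" "i < n" "v \<in> reduced" "w = y [^] j \<otimes> (x [^] (i::nat) \<otimes> v)"
    using assms by (auto elim: reduced.cases)
  then show ?thesis
  proof cases
    case 1
    have "y [^] (1::nat) \<otimes> x [^] (0::nat) \<in> reduced" using mn by (intro reduced.last) auto
    then show ?thesis using xy 1 by (intro exI[of _ 0] bexI[of _ y]) auto
  next
    case 2
    have eq: "y \<otimes> w = y [^] Suc j \<otimes> x [^] i" using Y[of "x [^] i" j] 2 xy by simp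
    show ?thesis
    proof (cases "Suc j = m")
      case True
      then have "y \<otimes> w = x [^] n \<otimes> x [^] i" using eq rel by simp
      then show ?thesis using xy by (intro exI[of _ "n + i"] bexI[of _ \<one>]) (auto simp: nat_pow_mult)
    next
      case False
      then have "y [^] Suc j \<otimes> x [^] i \<in> reduced" using 2 by (intro reduced.last) auto
      then show ?thesis using eq xy by (intro exI[of _ 0] bexI[of _ "y [^] Suc j \<otimes> x [^] i"]) auto
    qed
  next
    case 3
    note v = reduced_closed[OF 3(5)]
    have eq: "y \<otimes> w = y [^] Suc j \<otimes> (x [^] i \<otimes> v)" using Y[of "x [^] i \<otimes> v" j] 3 xy v by simp
    show ?thesis
    proof (cases "Suc j = m")
      case True
      then have "y \<otimes> w = x [^] n \<otimes> (x [^] i \<otimes> v)" using eq rel by simp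
      then show ?thesis using xy v 3
        by (intro exI[of _ "n + i"] bexI[of _ v]) (auto simp: nat_pow_mult[symmetric] m_assoc)
    next
      case False
      then have "y [^] Suc j \<otimes> (x [^] i \<otimes> v) \<in> reduced" using 3 by (intro reduced.step) auto
      then show ?thesis using eq xy v by (intro exI[of _ 0] bexI[of _ "y [^] Suc j \<otimes> (x [^] i \<otimes> v)"]) auto
    qed
  qed
qed

lemma normal_forms_y:
  assumes "g \<in> normal_forms"
  shows "y \<otimes> g \<in> normal_forms"
proof -
  obtain k e :: nat and w where g: "g \<in> carrier G" "w \<in> insert \<one> reduced" "w \<in> carrier G"
    "x [^] (n * k) \<otimes> g = x [^] e \<otimes> w" using assms by (rule normal_formsE)
  \<comment> \<open>Split off a central power of \<open>x\<close>, so that the remaining power is proper.\<close>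
  define w0 where "w0 = x [^] (e mod n) \<otimes> w"
  have w0: "w0 \<in> carrier G" using g xy by (simp add: w0_def)
  have "x [^] e = x [^] (n * (e div n)) \<otimes> x [^] (e mod n)" using xy by (simp add: nat_pow_mult)
  then have w0e: "x [^] e \<otimes> w = x [^] (n * (e div n)) \<otimes> w0" using xy g by (simp add: w0_def m_assoc)
  have eq: "x [^] (n * k) \<otimes> (y \<otimes> g) = x [^] (n * (e div n)) \<otimes> (y \<otimes> w0)"
    using c_pow_commute(2)[OF g(1), of k] c_pow_commute(2)[OF w0, of "e div n"] g(4) w0e by simp
  have "\<exists>e'. \<exists>w'\<in>insert \<one> reduced. y \<otimes> w0 = x [^] (e'::nat) \<otimes> w'"
  proof (cases "e mod n = 0")
    case True
    then have "w0 = w" using g by (simp add: w0_def)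
    then show ?thesis using y_reduced[OF g(2)] by simp
  next
    case False
    have "e mod n < n" using mn by simp
    have "y \<otimes> w0 \<in> reduced"
    proof (cases "w = \<one>")
      case True
      then show ?thesis using reduced.last[of 1 "e mod n"] mn xy by (simp add: w0_def)
    next
      case False
      then show ?thesis using reduced.step[of 1 "e mod n" w] mn xy g \<open>e mod n \<noteq> 0\<close> \<open>e mod n < n\<close> by (simp add: w0_def)
    qed
    then show ?thesis using xy w0 by (intro exI[of _ 0] bexI[of _ "y \<otimes> w0"]) auto
  qed
  then obtain e' :: nat and w' where w': "w' \<in> insert \<one> reduced" "y \<otimes> w0 = x [^] e' \<otimes> w'" by blast
  have "w' \<in> carrier G" using w' reduced_closed by auto
  then have "x [^] (n * k) \<otimes> (y \<otimes> g) = x [^] (n * (e div n) + e') \<otimes> w'"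
    unfolding eq w' using xy by (simp add: nat_pow_mult[symmetric] m_assoc)
  then show ?thesis using g xy w' by (intro normal_formsI[of _ w']) auto
qed

text \<open>An inverse of a generator is a positive power of it, up to the inverse of the central element \<open>x ^ n\<close>.\<close>
lemma normal_forms_inverse:
  assumes "g \<in> normal_forms" "z \<in> {x, y}"
  shows "inv z \<otimes> g \<in> normal_forms"
proof -
  define N where "N = (if z = x then n else m)"
  have N: "N > 0" "z [^] N = x [^] n" using assms(2) rel mn by (auto simp: N_def)
  have z: "z \<in> carrier G" using assms xy by auto
  have "z [^] j \<otimes> g \<in> normal_forms" for j :: nat
  proof (induction j)
    case 0
    then show ?case using assms(1) by (metis l_one nat_pow_0 normal_formsE)
  next
    case (Suc j)
    have "z \<otimes> (z [^] j \<otimes> g) \<in> normal_forms" using normal_forms_x[OF Suc] normal_forms_y[OF Suc] assms(2) by auto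
    moreover have "g \<in> carrier G" using assms(1) by (auto elim: normal_formsE)
    ultimately show ?case using z by (simp only: nat_pow_Suc2 m_assoc nat_pow_closed)
  qed
  from this[of "N - 1"] obtain k e :: nat and w where w: "w \<in> insert \<one> reduced"
    "x [^] (n * k) \<otimes> (z [^] (N - 1) \<otimes> g) = x [^] e \<otimes> w" by (rule normal_formsE)
  have g: "g \<in> carrier G" using assms(1) by (auto elim: normal_formsE)
  have "x [^] (n * k + n) \<otimes> (inv z \<otimes> g) = x [^] (n * k) \<otimes> (z [^] N \<otimes> (inv z \<otimes> g))"
    using xy z g N(2) by (simp add: nat_pow_mult[symmetric] m_assoc)
  also have "z [^] N \<otimes> (inv z \<otimes> g) = z [^] (N - 1) \<otimes> g"
    using N(1) z g by (cases N) (auto simp: m_assoc, simp add: m_assoc[symmetric])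
  finally have "x [^] (n * Suc k) \<otimes> (inv z \<otimes> g) = x [^] e \<otimes> w" using w by (simp add: add.commute)
  from normal_formsI[OF _ w(1) this] show ?thesis using z g by simp
qed

lemma carrier_normal_forms: "carrier G \<subseteq> normal_forms"
proof -
  have *: "h \<otimes> g \<in> normal_forms" if "h \<in> generate G {x, y}" "g \<in> normal_forms" for h g
    using that
  proof (induction arbitrary: g rule: generate.induct)
    case one
    then show ?case by (metis l_one normal_formsE)
  next
    case (eng h1 h2)
    have "h1 \<in> carrier G" "h2 \<in> carrier G" "g \<in> carrier G" using eng gen by (auto elim: normal_formsE)
    then show ?case using eng by (simp add: m_assoc)
  qed (auto simp: normal_forms_x normal_forms_y normal_forms_inverse elim: normal_formsE)
  have 1: "\<one> \<in> normal_forms" using xy by (intro normal_formsI[of _ \<one> 0 0]) auto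
  show ?thesis
  proof
    fix h assume h: "h \<in> carrier G"
    then show "h \<in> normal_forms" using *[of h \<one>] 1 gen by simp
  qed
qed

lemma \<rho>_mult: "g \<in> carrier G \<Longrightarrow> h \<in> carrier G \<Longrightarrow> \<rho> (g \<otimes> h) = \<rho> g ** \<rho> h"
  using hom_mult[OF \<rho>(1)] by simp

lemma \<rho>_pow: "g \<in> carrier G \<Longrightarrow> \<rho> (g [^] (k::nat)) = \<rho> g [^]\<^bsub>GL2_poly\<^esub> k"
  using hom_nat_pow[OF \<rho>(1)] group_GL2_poly is_group by (simp add: group.is_monoid)

lemma \<rho>_one: "\<rho> \<one> = mat2 1 0 0 1"
  using hom_one[OF \<rho>(1)] group_GL2_poly is_group by simp

lemma \<rho>_x_pow: "\<rho> (x [^] k) = diag_mat ((2 ^ m * prim_root n) ^ k) ((2 ^ m) ^ k)"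
  using \<rho>_pow[of x k] xy by (simp add: \<rho> X_mat_def diag_mat_pow)

lemma \<rho>_y_pow: "\<rho> (y [^] k) = tilted_mat ((2 ^ n * prim_root m) ^ k) ((2 ^ n) ^ k)"
  using \<rho>_pow[of y k] xy by (simp add: \<rho> Y_mat_def tilted_mat_pow)

lemma eigenvalues_differ: "0 < i \<Longrightarrow> i < k \<Longrightarrow> (2 ^ l * prim_root k) ^ i \<noteq> (2 ^ l) ^ i"
  using prim_root_power_eq_1_iff[of k i] by (auto simp: power_mult_distrib nat_dvd_not_less)

text \<open>Multiplication by a proper power of \<open>x\<close> separates the leading coefficients of the second column, because its two
  eigenvalues are different; a proper power of \<open>y\<close> then raises the degrees.\<close>
lemma reduced_column_growth:
  "w \<in> reduced \<Longrightarrow> \<exists>d l. l \<noteq> 0 \<and> column_growth d l l (\<rho> w)"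
proof (induction rule: reduced.induct)
  case (last j i)
  show ?case
    unfolding \<rho>_mult[OF nat_pow_closed[OF xy(2)] nat_pow_closed[OF xy(1)]] \<rho>_x_pow \<rho>_y_pow
    using column_growth_tilted_mat_mult[OF column_growth_diag_mat, of "(2 ^ n * prim_root m) ^ j" "(2 ^ n) ^ j" "(2 ^ m) ^ i" "(2 ^ m * prim_root n) ^ i"]
      eigenvalues_differ[OF last, of n]
    by (intro exI conjI) auto
next
  case (step j i w)
  then obtain d l where l: "l \<noteq> 0" "column_growth d l l (\<rho> w)" by blast
  have w: "w \<in> carrier G" using step reduced_closed by blast
  have "\<rho> (y [^] j \<otimes> (x [^] i \<otimes> w)) = \<rho> (y [^] j) ** (\<rho> (x [^] i) ** \<rho> w)"
    using w xy by (simp add: \<rho>_mult)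
  moreover have "((2 ^ n * prim_root m) ^ j - (2 ^ n) ^ j) * ((2 ^ m * prim_root n) ^ i * l - (2 ^ m) ^ i * l) \<noteq> 0"
    using eigenvalues_differ[OF step(1,2), of n] eigenvalues_differ[OF step(3,4), of m] l
    by (simp add: left_diff_distrib[symmetric])
  ultimately show ?case
    using column_growth_tilted_mat_mult[OF column_growth_diag_mat_mult[OF l(2)]] unfolding \<rho>_x_pow \<rho>_y_pow by metis
qed

text \<open>The second column of a reduced word has a nonconstant upper entry, whereas powers of \<open>x\<close> act by constant diagonal matrices.
  For powers of \<open>x\<close> the entry \<open>(2 ^ m) ^ e\<close> determines the exponent.\<close>
lemma \<rho>_injective:
  assumes "g \<in> carrier G" "\<rho> g = mat2 1 0 0 1"
  shows "g = \<one>"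
proof -
  have "g \<in> normal_forms" using assms carrier_normal_forms by blast
  then obtain k e :: nat and w where w: "w \<in> insert \<one> reduced" "w \<in> carrier G"
    "x [^] (n * k) \<otimes> g = x [^] e \<otimes> w" by (rule normal_formsE)
  have "\<rho> (x [^] (n * k)) ** \<rho> g = \<rho> (x [^] (n * k) \<otimes> g)"
    using \<rho>_mult[OF nat_pow_closed[OF xy(1)] assms(1)] by simp
  also have "\<dots> = \<rho> (x [^] e) ** \<rho> w"
    unfolding w(3) by (rule \<rho>_mult[OF nat_pow_closed[OF xy(1)] w(2)])
  finally have "\<rho> (x [^] (n * k)) ** \<rho> g = \<rho> (x [^] e) ** \<rho> w" .
  then have eq: "\<rho> (x [^] (n * k)) = \<rho> (x [^] e) ** \<rho> w"
    unfolding assms(2) mat2_one[symmetric] by (simp add: matrix_mul_rid)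
  have "w = \<one>"
  proof (rule ccontr)
    assume "w \<noteq> \<one>"
    then obtain d l where l: "l \<noteq> 0" "column_growth d l l (\<rho> w)" using w(1) reduced_column_growth[of w] by blast
    from column_growth_diag_mat_mult[OF this(2)] have "column_growth d ((2 ^ m * prim_root n) ^ e * l) ((2 ^ m) ^ e * l) (\<rho> (x [^] (n * k)))"
      unfolding eq unfolding \<rho>_x_pow .
    then show False using l unfolding \<rho>_x_pow by (simp add: column_growth_def diag_mat_def)
  qed
  then have "\<rho> (x [^] (n * k)) = \<rho> (x [^] e)"
    using eq \<rho>_one unfolding mat2_one[symmetric] by (simp add: matrix_mul_rid)
  then have "((2 ^ m) ^ (n * k) :: complex) = (2 ^ m) ^ e" unfolding \<rho>_x_pow by (simp add: diag_mat_def)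
  then have "(of_nat (2 ^ (m * (n * k))) :: complex) = of_nat (2 ^ (m * e))"
    by (simp add: power_mult)
  then have "(2::nat) ^ (m * (n * k)) = 2 ^ (m * e)" by (simp only: of_nat_eq_iff)
  then have "n * k = e" using mn by simp
  then show "g = \<one>" using w(3) \<open>w = \<one>\<close> xy assms(1) by simp
qed

text \<open>The representation at \<open>s = 0\<close> is commutative: both generators lie in the family of the matrices with diagonal
  \<open>(\<zeta> ^ d, 2 ^ d)\<close>, where \<open>\<zeta> = 2 * prim_root (m * n)\<close>, with \<open>d = m\<close> for \<open>x\<close> and \<open>d = n\<close> for \<open>y\<close>.\<close>
definition constant_term_degree :: "'a \<Rightarrow> int \<Rightarrow> bool" where
  "constant_term_degree g d \<longleftrightarrow> (\<exists>p q r s. \<rho> g = mat2 p q r s \<and>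
     poly p 0 = (2 * prim_root (m * n)) powi d \<and> poly q 0 = 0 \<and> poly r 0 = 0 \<and> poly s 0 = 2 powi d)"

lemma constant_term_degree_mult:
  assumes "constant_term_degree g d" "constant_term_degree h e" "g \<in> carrier G" "h \<in> carrier G"
  shows "constant_term_degree (g \<otimes> h) (d + e)"
  using assms by (auto simp: constant_term_degree_def \<rho>_mult power_int_add)

lemma constant_term_degree_inverse:
  assumes "constant_term_degree g d" "g \<in> carrier G"
  shows "constant_term_degree (inv g) (- d)"
proof -
  obtain p q r s where A: "\<rho> g = mat2 p q r s" "poly p 0 = (2 * prim_root (m * n)) powi d"
     "poly q 0 = 0" "poly r 0 = 0" "poly s 0 = 2 powi d" using assms by (auto simp: constant_term_degree_def)
  obtain p' q' r' s' where B: "\<rho> (inv g) = mat2 p' q' r' s'" by (rule mat2_cases)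
  have "mat2 p q r s ** mat2 p' q' r' s' = mat2 1 0 0 1"
    using \<rho>_mult[of g "inv g"] assms(2) A B \<rho>_one by simp
  then have "p * p' + q * r' = 1" "p * q' + q * s' = 0" "r * p' + s * r' = 0" "r * q' + s * s' = 1"
    by simp_all
  from this[THEN arg_cong[where f = "\<lambda>p. poly p 0"]]
  show ?thesis using A B unfolding constant_term_degree_def
    by (simp add: power_int_minus field_simps)
qed

lemma constant_term_degree_exists:
  assumes "g \<in> carrier G"
  shows "\<exists>d. constant_term_degree g d"
proof -
  have x: "constant_term_degree x (int m)"
  proof -
    have "(2 * prim_root (m * n)) ^ m = 2 ^ m * prim_root n"
      using prim_root_mult_power[of m n] mn by (simp add: power_mult_distrib mult.commute)
    then show ?thesis by (simp add: constant_term_degree_def \<rho> X_mat_def diag_mat_def)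
  qed
  have y: "constant_term_degree y (int n)"
  proof -
    have "(2 * prim_root (m * n)) ^ n = 2 ^ n * prim_root m"
      using prim_root_mult_power[of n m] mn by (simp add: power_mult_distrib)
    then show ?thesis by (simp add: constant_term_degree_def \<rho> Y_mat_def tilted_mat_def)
  qed
  have "g \<in> generate G {x, y}" using assms gen by simp
  then show ?thesis
  proof (induction rule: generate.induct)
    case one
    then show ?case by (intro exI[of _ 0]) (simp add: constant_term_degree_def \<rho>_one)
  next
    case (inv h)
    then show ?case using constant_term_degree_inverse[of h] x y xy by blast
  next
    case (eng h1 h2)
    then show ?case using constant_term_degree_mult gen by blast
  qed (use x y in auto)
qed

text \<open>Modulo a higher power of \<open>S\<close>, matrices \<open>1 + S * M\<close> multiply by adding the \<open>M\<close>, and conjugation acts on the value of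
  \<open>M\<close> at \<open>s = 0\<close> through the diagonal value of the conjugating matrix.\<close>
lemma product_of_conjugates:
  assumes g: "g \<in> carrier G" "\<rho> g = mat2 (1 + S * a) (S * b) (S * c) (1 + S * d)" "poly S 0 = 0"
    and deg: "\<And>h. h \<in> carrier G \<Longrightarrow> constant_term_degree h (deg h)"
    and hs: "set hs \<subseteq> carrier G"
  shows "\<exists>a' b' c' d'. \<rho> (foldr (\<otimes>) (map (conj_by G g) hs) \<one>) = mat2 (1 + S * a') (S * b') (S * c') (1 + S * d') \<and>
    poly a' 0 = of_nat (length hs) * poly a 0 \<and> poly d' 0 = of_nat (length hs) * poly d 0 \<and>
    poly b' 0 = (\<Sum>h\<leftarrow>hs. prim_root (m * n) powi deg h) * poly b 0 \<and>
    poly c' 0 = (\<Sum>h\<leftarrow>hs. prim_root (m * n) powi (- deg h)) * poly c 0"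
  using hs
proof (induction hs)
  case Nil
  show ?case by (rule exI[of _ 0])+ (simp add: \<rho>_one)
next
  case (Cons h hs)
  let ?P = "foldr (\<otimes>) (map (conj_by G g) hs) \<one>"
  obtain a' b' c' d' where IH: "\<rho> ?P = mat2 (1 + S * a') (S * b') (S * c') (1 + S * d')"
    "poly a' 0 = of_nat (length hs) * poly a 0" "poly d' 0 = of_nat (length hs) * poly d 0"
    "poly b' 0 = (\<Sum>h\<leftarrow>hs. prim_root (m * n) powi deg h) * poly b 0"
    "poly c' 0 = (\<Sum>h\<leftarrow>hs. prim_root (m * n) powi (- deg h)) * poly c 0"
    using Cons by auto
  have h: "h \<in> carrier G" using Cons by auto
  have P: "?P \<in> carrier G"
  proof -
    have "foldr (\<otimes>) (map (conj_by G g) ks) \<one> \<in> carrier G" if "set ks \<subseteq> carrier G" for ks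
      using that by (induction ks) (auto simp: conj_by_def g)
    then show ?thesis using Cons.prems by simp
  qed
  obtain p q r s where H: "\<rho> h = mat2 p q r s" "poly p 0 = (2 * prim_root (m * n)) powi deg h"
     "poly q 0 = 0" "poly r 0 = 0" "poly s 0 = 2 powi deg h" using deg[OF h] by (auto simp: constant_term_degree_def)
  obtain p' q' r' s' where K: "\<rho> (inv h) = mat2 p' q' r' s'" "poly p' 0 = (2 * prim_root (m * n)) powi (- deg h)"
     "poly q' 0 = 0" "poly r' 0 = 0" "poly s' 0 = 2 powi (- deg h)"
     using constant_term_degree_inverse[OF deg[OF h] h] by (auto simp: constant_term_degree_def)
  have "mat2 p q r s ** mat2 p' q' r' s' = mat2 1 0 0 1"
    using \<rho>_mult[of h "inv h"] h H K \<rho>_one by simp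
  then have HK: "p * p' + q * r' = 1" "p * q' + q * s' = 0" "r * p' + s * r' = 0" "r * q' + s * s' = 1"
    by simp_all
  define A where "A = p * (a * p' + b * r') + q * (c * p' + d * r')"
  define B where "B = p * (a * q' + b * s') + q * (c * q' + d * s')"
  define C where "C = r * (a * p' + b * r') + s * (c * p' + d * r')"
  define D where "D = r * (a * q' + b * s') + s * (c * q' + d * s')"
  have "\<rho> (conj_by G g h) = mat2 p q r s ** mat2 (1 + S * a) (S * b) (S * c) (1 + S * d) ** mat2 p' q' r' s'"
    using h g H K by (simp add: conj_by_def \<rho>_mult)
  also have "\<dots> = mat2 ((p * p' + q * r') + S * A) ((p * q' + q * s') + S * B)
     ((r * p' + s * r') + S * C) ((r * q' + s * s') + S * D)"
    by (simp add: A_def B_def C_def D_def algebra_simps)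
  finally have conj: "\<rho> (conj_by G g h) = mat2 (1 + S * A) (S * B) (S * C) (1 + S * D)"
    by (simp add: HK)
  have z: "(2 * prim_root (m * n)) powi deg h \<noteq> 0" "(2::complex) powi deg h \<noteq> 0" by simp_all
  have conj0: "poly A 0 = poly a 0" "poly B 0 = prim_root (m * n) powi deg h * poly b 0"
    "poly C 0 = prim_root (m * n) powi (- deg h) * poly c 0" "poly D 0 = poly d 0"
    using H K z by (simp_all add: A_def B_def C_def D_def power_int_minus power_int_mult_distrib field_simps)
  have "\<rho> (conj_by G g h \<otimes> ?P) = \<rho> (conj_by G g h) ** \<rho> ?P"
    using h g P by (intro \<rho>_mult) (auto simp: conj_by_def)
  also have "\<dots> = mat2 (1 + S * (A + a' + S * (A * a' + B * c'))) (S * (B + b' + S * (A * b' + B * d')))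
     (S * (C + c' + S * (C * a' + D * c'))) (1 + S * (D + d' + S * (C * b' + D * d')))"
    unfolding conj IH by (simp add: algebra_simps)
  finally have "\<rho> (foldr (\<otimes>) (map (conj_by G g) (h # hs)) \<one>) = \<dots>" by simp
  then show ?case
    by (intro exI conjI, assumption) (simp_all add: g(3) conj0 IH algebra_simps)
qed

text \<open>The bottom right entry at \<open>s = 0\<close> shows that \<open>g\<close> has degree zero. Then the leading term of the relation at
  \<open>s = 0\<close> is the sum of the conjugated leading terms of \<open>g\<close>; its diagonal is \<open>r\<close> times that of \<open>g\<close>, so the nonzero
  entry of \<open>g\<close> is off the diagonal.\<close>
theorem torsion_spectrum_root_sum:
  assumes g: "g \<in> carrier G" "g \<noteq> \<one>" and r: "r \<in> torsion_spectrum G g"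
  shows "\<exists>e :: nat \<Rightarrow> nat. (\<Sum>i<r. prim_root (m * n) ^ e i) = 0"
proof -
  obtain hs where hs: "length hs = r" "set hs \<subseteq> carrier G" "r \<ge> 1"
    "foldr (\<otimes>) (map (conj_by G g) hs) \<one> = \<one>" using r by (auto simp: torsion_spectrum_def)
  obtain deg where deg: "\<And>h. h \<in> carrier G \<Longrightarrow> constant_term_degree h (deg h)"
    using constant_term_degree_exists by metis
  \<comment> \<open>The degree can be read off from the entry \<open>2 ^ d\<close>.\<close>
  have uniq: "d = e" if "constant_term_degree h d" "constant_term_degree h e" for h d e
  proof -
    have "(2::complex) powi d = 2 powi e" using that by (auto simp: constant_term_degree_def)
    then have "norm ((2::complex) powi d) = norm ((2::complex) powi e)" by simp
    then have "(2::real) powi d = 2 powi e" by (simp add: norm_power_int)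
    then show ?thesis
      using power_int_strict_increasing[of d e "2::real"] power_int_strict_increasing[of e d "2::real"]
      by (cases d e rule: linorder_cases) auto
  qed
  have one: "constant_term_degree \<one> 0" by (simp add: constant_term_degree_def \<rho>_one)
  have "constant_term_degree (foldr (\<otimes>) (map (conj_by G g) ks) \<one>) (int (length ks) * deg g) \<and>
     foldr (\<otimes>) (map (conj_by G g) ks) \<one> \<in> carrier G" if "set ks \<subseteq> carrier G" for ks
    using that
  proof (induction ks)
    case (Cons k ks)
    then have k: "k \<in> carrier G" by auto
    have ck: "conj_by G g k \<in> carrier G" using k g by (simp add: conj_by_def)
    have "constant_term_degree (conj_by G g k) (deg k + deg g + - deg k)" unfolding conj_by_def
      using k g by (intro constant_term_degree_mult constant_term_degree_inverse deg) auto
    then have "constant_term_degree (conj_by G g k \<otimes> foldr (\<otimes>) (map (conj_by G g) ks) \<one>) (deg g + int (length ks) * deg g)"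
      using Cons ck by (intro constant_term_degree_mult) auto
    then show ?case using Cons ck by (simp add: algebra_simps)
  qed (simp add: one)
  from this[OF hs(2)] have "constant_term_degree \<one> (int r * deg g)" using hs by simp
  from uniq[OF this one] have "deg g = 0" using hs(3) by simp
  then obtain p q t s where P: "\<rho> g = mat2 p q t s" "poly p 0 = 1" "poly q 0 = 0" "poly t 0 = 0" "poly s 0 = 1"
    using deg[OF g(1)] by (auto simp: constant_term_degree_def)
  have "p - 1 \<noteq> 0 \<or> q \<noteq> 0 \<or> t \<noteq> 0 \<or> s - 1 \<noteq> 0" using \<rho>_injective[OF g(1)] g(2) P by auto
  then have ex: "\<exists>k. coeff (p - 1) k \<noteq> 0 \<or> coeff q k \<noteq> 0 \<or> coeff t k \<noteq> 0 \<or> coeff (s - 1) k \<noteq> 0"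
    by (metis leading_coeff_0_iff)
  \<comment> \<open>The lowest power of \<open>s\<close> that occurs in the difference between \<open>g\<close> and the identity; it is positive because
    \<open>g\<close> has degree zero.\<close>
  define k where "k = (LEAST k. coeff (p - 1) k \<noteq> 0 \<or> coeff q k \<noteq> 0 \<or> coeff t k \<noteq> 0 \<or> coeff (s - 1) k \<noteq> 0)"
  have k: "coeff (p - 1) k \<noteq> 0 \<or> coeff q k \<noteq> 0 \<or> coeff t k \<noteq> 0 \<or> coeff (s - 1) k \<noteq> 0"
    unfolding k_def by (rule LeastI_ex[OF ex])
  have less: "coeff (p - 1) j = 0 \<and> coeff q j = 0 \<and> coeff t j = 0 \<and> coeff (s - 1) j = 0" if "j < k" for j
    using not_less_Least[OF that[unfolded k_def]] by blast
  have "k \<noteq> 0"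
  proof
    assume "k = 0"
    with k P show False by (simp add: poly_0_coeff_0)
  qed
  define S :: "complex poly" where "S = monom 1 k"
  have S: "S \<noteq> 0" "poly S 0 = 0" using \<open>k \<noteq> 0\<close> by (simp_all add: S_def poly_monom)
  have "S dvd p - 1" "S dvd q" "S dvd t" "S dvd s - 1"
    unfolding S_def monom_1_dvd_iff' using less by auto
  then obtain a b c d where abcd: "p - 1 = S * a" "q = S * b" "t = S * c" "s - 1 = S * d" by (auto elim!: dvdE)
  have lead: "poly a 0 \<noteq> 0 \<or> poly b 0 \<noteq> 0 \<or> poly c 0 \<noteq> 0 \<or> poly d 0 \<noteq> 0"
    using k unfolding abcd by (simp add: S_def coeff_monom_mult poly_0_coeff_0)
  have "\<rho> g = mat2 (1 + S * a) (S * b) (S * c) (1 + S * d)" using P abcd by (simp add: diff_eq_eq add.commute)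
  from product_of_conjugates[OF g(1) this S(2) deg hs(2)] obtain a' b' c' d' where
    Q: "mat2 1 0 0 1 = mat2 (1 + S * a') (S * b') (S * c') (1 + S * d')"
    "poly a' 0 = of_nat r * poly a 0" "poly d' 0 = of_nat r * poly d 0"
    "poly b' 0 = (\<Sum>h\<leftarrow>hs. prim_root (m * n) powi deg h) * poly b 0"
    "poly c' 0 = (\<Sum>h\<leftarrow>hs. prim_root (m * n) powi (- deg h)) * poly c 0"
    by (auto simp: hs \<rho>_one)
  then have "a' = 0" "b' = 0" "c' = 0" "d' = 0" using S(1) by simp_all
  with Q lead hs(3) have "(\<Sum>h\<leftarrow>hs. prim_root (m * n) powi deg h) = 0 \<or> (\<Sum>h\<leftarrow>hs. prim_root (m * n) powi (- deg h)) = 0"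
    by auto
  then have "\<exists>f :: 'a \<Rightarrow> int. (\<Sum>h\<leftarrow>hs. prim_root (m * n) powi f h) = 0"
    by (elim disjE) (rule exI[of _ deg], assumption, rule exI[of _ "\<lambda>h. - deg h"], assumption)
  then obtain f :: "'a \<Rightarrow> int" where f: "(\<Sum>h\<leftarrow>hs. prim_root (m * n) powi f h) = 0" by blast
  have "prim_root (m * n) powi z = prim_root (m * n) ^ nat (z mod int (m * n))" for z
    using prim_root_power_eq_1_iff[of "m * n" "m * n"] mn by (intro power_int_mod_period) auto
  then have "(\<Sum>i<r. prim_root (m * n) ^ nat (f (hs ! i) mod int (m * n))) = 0"
    using f by (simp add: sum_list_sum_nth hs(1) atLeast0LessThan)
  then show ?thesis by (rule exI[of _ "\<lambda>i. nat (f (hs ! i) mod int (m * n))"])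
qed

end

section \<open>Generating the fundamental group from a cover\<close>

lemma homotopic_paths_cancel:
  fixes d :: "real \<Rightarrow> 'a::real_normed_vector"
  assumes "path d" "path_image d \<subseteq> S" "path q" "path_image q \<subseteq> S" "pathfinish d = pathstart q"
  shows "homotopic_paths S (reversepath d +++ (d +++ q)) q"
proof -
  have "homotopic_paths S (reversepath d +++ (d +++ q)) ((reversepath d +++ d) +++ q)"
    by (rule homotopic_paths_assoc) (use assms in auto)
  also have "homotopic_paths S \<dots> (linepath (pathfinish d) (pathfinish d) +++ q)"
    by (rule homotopic_paths_join) (use assms homotopic_paths_linv[of d S] in auto)
  also have "homotopic_paths S \<dots> q"
    by (rule homotopic_paths_lid') (use assms in auto)
  finally show ?thesis .
qed

text \<open>Consecutive pieces that are closed up along \<open>d\<close> and back along \<open>d\<close> multiply to the joined piece.\<close>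
lemma homotopic_paths_splice:
  fixes g :: "real \<Rightarrow> 'a::real_normed_vector"
  assumes "path g" "path_image g \<subseteq> S" "path s" "path_image s \<subseteq> S" "path s'" "path_image s' \<subseteq> S"
    "path d" "path_image d \<subseteq> S" "path r" "path_image r \<subseteq> S"
    "pathfinish g = pathstart s" "pathfinish s = pathfinish d" "pathstart s' = pathfinish s" "pathfinish s' = pathstart r"
  shows "homotopic_paths S ((g +++ (s +++ reversepath d)) +++ (d +++ (s' +++ r))) (g +++ ((s +++ s') +++ r))"
proof -
  have "homotopic_paths S ((g +++ (s +++ reversepath d)) +++ (d +++ (s' +++ r)))
      (g +++ ((s +++ reversepath d) +++ (d +++ (s' +++ r))))"
    by (rule homotopic_paths_sym, rule homotopic_paths_assoc) (use assms in \<open>auto simp: path_image_join\<close>)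
  also have "homotopic_paths S \<dots> (g +++ (s +++ (reversepath d +++ (d +++ (s' +++ r)))))"
    by (rule homotopic_paths_join, simp add: assms, rule homotopic_paths_sym, rule homotopic_paths_assoc)
      (use assms in \<open>auto simp: path_image_join\<close>)
  also have "homotopic_paths S \<dots> (g +++ (s +++ (s' +++ r)))"
    by (rule homotopic_paths_join, simp add: assms, rule homotopic_paths_join, simp add: assms, rule homotopic_paths_cancel)
      (use assms in \<open>simp_all add: path_image_join\<close>)
  also have "homotopic_paths S \<dots> (g +++ ((s +++ s') +++ r))"
    by (intro homotopic_paths_join homotopic_paths_assoc) (use assms in \<open>auto simp: path_image_join\<close>)
  finally show ?thesis .
qed

lemma fundamental_group_carrier: "carrier (fundamental_group S b) = loop_class S ` loops_at S b"
  by (simp add: fundamental_group_def)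

lemma loop_class_eqI: "homotopic_paths S p q \<Longrightarrow> loop_class S p = loop_class S q"
  unfolding loop_class_def by (auto intro: homotopic_paths_trans dest: homotopic_paths_sym)

lemma fundamental_group_one:
  fixes b :: "'a::real_normed_vector"
  shows "\<one>\<^bsub>fundamental_group S b\<^esub> = loop_class S (linepath b b)"
  by (simp add: fundamental_group_def linepath_refl)

lemma inv_loop_class:
  fixes b :: "'a::real_normed_vector"
  assumes "b \<in> S" "p \<in> loops_at S b"
  shows "inv\<^bsub>fundamental_group S b\<^esub> loop_class S p = loop_class S (reversepath p)"
proof -
  interpret group "fundamental_group S b" by (rule group_fundamental_group[OF assms(1)])
  have "homotopic_paths S (reversepath p +++ p) (linepath b b)"
    using homotopic_paths_linv[of p S] assms by (auto simp: loops_at_def)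
  then have "loop_class S (reversepath p) \<otimes>\<^bsub>fundamental_group S b\<^esub> loop_class S p = \<one>\<^bsub>fundamental_group S b\<^esub>"
    by (simp add: mult_loop_class assms loops_at_reversepath loop_class_eqI fundamental_group_one)
  then show ?thesis using assms loops_at_reversepath[OF assms(2)]
    by (intro inv_equality) (auto simp: fundamental_group_carrier)
qed

text \<open>Choose for every point a path to it from the base point, inside the intersection where possible. Closing up a short
  piece of a loop by these paths gives a loop in \<open>U\<close> or in \<open>V\<close>, and the classes of adjacent pieces multiply.\<close>
theorem fundamental_group_generated_by_cover:
  fixes U V :: "'a::real_normed_vector set"
  assumes UV: "open U" "open V" "path_connected U" "path_connected V" "path_connected (U \<inter> V)" and b: "b \<in> U \<inter> V"
  shows "carrier (fundamental_group (U \<union> V) b) =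
    generate (fundamental_group (U \<union> V) b) (loop_class (U \<union> V) ` (loops_at U b \<union> loops_at V b))"
proof -
  let ?Y = "U \<union> V" and ?G = "fundamental_group (U \<union> V) b"
  let ?S = "generate ?G (loop_class ?Y ` (loops_at U b \<union> loops_at V b))"
  interpret group ?G by (rule group_fundamental_group) (use b in auto)
  have sub: "loops_at U b \<union> loops_at V b \<subseteq> loops_at ?Y b" by (auto simp: loops_at_def)
  then have S: "subgroup ?S ?G" by (intro generate_is_subgroup) (auto simp: fundamental_group_carrier)
  have "\<exists>g. \<forall>W\<in>{U, V}. z \<in> W \<longrightarrow> path g \<and> path_image g \<subseteq> W \<and> pathstart g = b \<and> pathfinish g = z" if z: "z \<in> ?Y" for z
  proof -
    consider "z \<in> U \<inter> V" | "z \<in> U" "z \<notin> V" | "z \<in> V" "z \<notin> U" using z by blast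
    then show ?thesis
    proof cases
      case 1
      then obtain g where "path g" "path_image g \<subseteq> U \<inter> V" "pathstart g = b" "pathfinish g = z"
        using UV(5) b unfolding path_connected_def by blast
      then show ?thesis by blast
    next
      case 2
      then obtain g where "path g" "path_image g \<subseteq> U" "pathstart g = b" "pathfinish g = z"
        using UV(3) b unfolding path_connected_def by blast
      then show ?thesis using 2 by blast
    next
      case 3
      then obtain g where "path g" "path_image g \<subseteq> V" "pathstart g = b" "pathfinish g = z"
        using UV(4) b unfolding path_connected_def by blast
      then show ?thesis using 3 by blast
    qed
  qed
  then have "\<exists>\<delta>. \<forall>z\<in>?Y. \<forall>W\<in>{U, V}. z \<in> W \<longrightarrow> path (\<delta> z) \<and> path_image (\<delta> z) \<subseteq> W \<and> pathstart (\<delta> z) = b \<and> pathfinish (\<delta> z) = z"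
    by (intro bchoice ballI)
  then obtain \<delta> where "\<forall>z\<in>?Y. \<forall>W\<in>{U, V}. z \<in> W \<longrightarrow> path (\<delta> z) \<and> path_image (\<delta> z) \<subseteq> W \<and> pathstart (\<delta> z) = b \<and> pathfinish (\<delta> z) = z" ..
  then have \<delta>: "path (\<delta> z) \<and> path_image (\<delta> z) \<subseteq> W \<and> pathstart (\<delta> z) = b \<and> pathfinish (\<delta> z) = z"
    if "z \<in> ?Y" "W \<in> {U, V}" "z \<in> W" for z W using that by blast
  then have \<delta>Y: "path (\<delta> z)" "path_image (\<delta> z) \<subseteq> ?Y" "pathstart (\<delta> z) = b" "pathfinish (\<delta> z) = z" if z: "z \<in> ?Y" for z
  proof -
    obtain W where W: "W \<in> {U, V}" "z \<in> W" using z by blast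
    show "path (\<delta> z)" "path_image (\<delta> z) \<subseteq> ?Y" "pathstart (\<delta> z) = b" "pathfinish (\<delta> z) = z"
      using \<delta>[OF z W] W(1) by auto
  qed
  show ?thesis
  proof
    show "?S \<subseteq> carrier ?G" using S by (rule subgroup.subset)
    show "carrier ?G \<subseteq> ?S"
    proof
      fix X assume "X \<in> carrier ?G"
      then obtain p where X: "X = loop_class ?Y p" and p: "p \<in> loops_at ?Y b" by (auto simp: fundamental_group_carrier)
      have pp: "path p" "path_image p \<subseteq> ?Y" "p 0 = b" "p 1 = b"
        using p by (auto simp: loops_at_def pathstart_def pathfinish_def)
      have pY: "p t \<in> ?Y" if "t \<in> {0..1}" for t using pp(2) that unfolding path_image_def by blast
      have subp: "path (subpath s t p)" "path_image (subpath s t p) \<subseteq> ?Y" if "s \<in> {0..1}" "t \<in> {0..1}" for s t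
        using path_subpath[OF pp(1) that(1,2)] path_image_subpath_subset[OF that(1,2), of p] pp(2) by blast+
      define seg where "seg s t = \<delta> (p s) +++ (subpath s t p +++ reversepath (\<delta> (p t)))" for s t
      have segY: "seg s t \<in> loops_at ?Y b" if "s \<in> {0..1}" "t \<in> {0..1}" for s t
        using that subp[OF that] \<delta>Y[OF pY[OF that(1)]] \<delta>Y[OF pY[OF that(2)]]
        by (simp add: seg_def loops_at_def path_image_join)
      have "0 \<le> (0::real) \<longrightarrow> 1 \<le> (1::real) \<longrightarrow> loop_class ?Y (seg 0 1) \<in> ?S"
      proof (rule Bolzano[of 0 1 "\<lambda>s t. 0 \<le> s \<longrightarrow> t \<le> 1 \<longrightarrow> loop_class ?Y (seg s t) \<in> ?S"])
        fix r s t :: real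
        assume 1: "0 \<le> r \<longrightarrow> s \<le> 1 \<longrightarrow> loop_class ?Y (seg r s) \<in> ?S"
          and 2: "0 \<le> s \<longrightarrow> t \<le> 1 \<longrightarrow> loop_class ?Y (seg s t) \<in> ?S" and rst: "r \<le> s" "s \<le> t"
        show "0 \<le> r \<longrightarrow> t \<le> 1 \<longrightarrow> loop_class ?Y (seg r t) \<in> ?S"
        proof (intro impI)
          assume rt: "0 \<le> r" "t \<le> 1"
          then have r01: "r \<in> {0..1}" "s \<in> {0..1}" "t \<in> {0..1}" using rst by auto
          note dr = \<delta>Y[OF pY[OF r01(1)]] and ds = \<delta>Y[OF pY[OF r01(2)]] and dt = \<delta>Y[OF pY[OF r01(3)]]
          have "loop_class ?Y (seg r s) \<otimes>\<^bsub>?G\<^esub> loop_class ?Y (seg s t) \<in> ?S"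
            using 1 2 rt rst S by (intro subgroup.m_closed) auto
          also have "loop_class ?Y (seg r s) \<otimes>\<^bsub>?G\<^esub> loop_class ?Y (seg s t) = loop_class ?Y (seg r s +++ seg s t)"
            using segY r01 by (intro mult_loop_class) auto
          also have "\<dots> = loop_class ?Y (seg r t)"
          proof (rule loop_class_eqI)
            have "homotopic_paths ?Y (seg r s +++ seg s t)
               (\<delta> (p r) +++ ((subpath r s p +++ subpath s t p) +++ reversepath (\<delta> (p t))))"
              unfolding seg_def
              by (rule homotopic_paths_splice)
                (use dr ds dt subp[OF r01(1,2)] subp[OF r01(2,3)] in auto)
            also have "homotopic_paths ?Y \<dots> (seg r t)"
              unfolding seg_def
              by (rule homotopic_paths_join, simp add: dr, rule homotopic_paths_join,
                  rule homotopic_join_subpaths[OF pp(1,2) r01]) (simp_all add: dr ds dt)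
            finally show "homotopic_paths ?Y (seg r s +++ seg s t) (seg r t)" .
          qed
          finally show "loop_class ?Y (seg r t) \<in> ?S" .
        qed
      next
        fix x :: real assume x: "0 \<le> x" "x \<le> 1"
        then obtain W where W: "W \<in> {U, V}" "p x \<in> W" using pY[of x] by auto
        then have "open W" using UV by auto
        then obtain e where e: "e > 0" "ball (p x) e \<subseteq> W" using W(2) open_contains_ball by metis
        have "continuous_on {0..1} p" using pp(1) by (simp add: path_def)
        then obtain d where d: "d > 0" "\<And>y. y \<in> {0..1} \<Longrightarrow> dist y x < d \<Longrightarrow> dist (p y) (p x) < e"
          using x e(1) unfolding continuous_on_iff by (metis atLeastAtMost_iff)
        show "\<exists>d>0. \<forall>s t. s \<le> x \<and> x \<le> t \<and> t - s < d \<longrightarrow> 0 \<le> s \<longrightarrow> t \<le> 1 \<longrightarrow> loop_class ?Y (seg s t) \<in> ?S"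
        proof (intro exI[of _ d] conjI allI impI d(1))
          fix s t assume st: "s \<le> x \<and> x \<le> t \<and> t - s < d" "0 \<le> s" "t \<le> 1"
          have pW: "p y \<in> W" if "y \<in> {s..t}" for y
          proof -
            have "dist (p y) (p x) < e" using that st by (intro d(2)) (auto simp: dist_real_def)
            then show ?thesis using e(2) by (auto simp: subset_eq dist_commute)
          qed
          have st01: "s \<in> {0..1}" "t \<in> {0..1}" using st by auto
          have "path_image (subpath s t p) \<subseteq> W"
            using pW st by (auto simp: path_image_subpath)
          moreover have "path (subpath s t p)" using subp[OF st01] by simp
          moreover note \<delta>[OF pY[OF st01(1)] W(1)] \<delta>[OF pY[OF st01(2)] W(1)] pW[of s] pW[of t]
          ultimately have "seg s t \<in> loops_at W b"
            using st by (simp add: seg_def loops_at_def path_image_join)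
          then show "loop_class ?Y (seg s t) \<in> ?S" using W(1) by (intro generate.incl) auto
        qed
      qed simp
      then have S1: "loop_class ?Y (seg 0 1) \<in> ?S" by simp
      have d: "\<delta> b \<in> loops_at U b" using \<delta>[of b U] b by (auto simp: loops_at_def)
      then have d': "\<delta> b \<in> loops_at ?Y b" using sub by auto
      have d2: "loop_class ?Y (\<delta> b) \<in> ?S" using d by (intro generate.incl) auto
      have bY: "b \<in> ?Y" using b by simp
      have "seg 0 1 = \<delta> b +++ (p +++ reversepath (\<delta> b))" by (simp add: seg_def pp)
      then have "loop_class ?Y (seg 0 1) = loop_class ?Y (\<delta> b) \<otimes>\<^bsub>?G\<^esub> (loop_class ?Y p \<otimes>\<^bsub>?G\<^esub> inv\<^bsub>?G\<^esub> loop_class ?Y (\<delta> b))"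
        using p d' by (simp add: inv_loop_class[OF bY d'] mult_loop_class loops_at_join loops_at_reversepath)
      then have "X = inv\<^bsub>?G\<^esub> loop_class ?Y (\<delta> b) \<otimes>\<^bsub>?G\<^esub> loop_class ?Y (seg 0 1) \<otimes>\<^bsub>?G\<^esub> loop_class ?Y (\<delta> b)"
      proof -
        have c: "loop_class ?Y p \<in> carrier ?G" "loop_class ?Y (\<delta> b) \<in> carrier ?G"
          using p d' by (auto simp: fundamental_group_carrier)
        have "inv\<^bsub>?G\<^esub> d \<otimes>\<^bsub>?G\<^esub> (d \<otimes>\<^bsub>?G\<^esub> (x \<otimes>\<^bsub>?G\<^esub> inv\<^bsub>?G\<^esub> d)) = x \<otimes>\<^bsub>?G\<^esub> inv\<^bsub>?G\<^esub> d"
          if "x \<in> carrier ?G" "d \<in> carrier ?G" for x d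
          using that by (simp add: m_assoc[symmetric])
        with c show ?thesis
          unfolding X \<open>loop_class ?Y (seg 0 1) = _\<close> by (simp add: m_assoc)
      qed
      then show "X \<in> ?S" using S S1 d2 by (simp add: subgroup.m_closed subgroup.m_inv_closed)
    qed
  qed
qed

section \<open>Extending local holonomies along a cover\<close>

text \<open>A functor from the paths that stay in one set of the cover, up to homotopy there, to a group. It extends to all
  paths in the union; this is the part of van Kampen's theorem that produces homomorphisms.\<close>
locale local_holonomy = group H for H (structure) +
  fixes \<W> :: "'a::real_normed_vector set set" and h :: "(real \<Rightarrow> 'a) \<Rightarrow> 'b"
  assumes open_cover: "W \<in> \<W> \<Longrightarrow> open W"
    and h_closed: "W \<in> \<W> \<Longrightarrow> path p \<Longrightarrow> path_image p \<subseteq> W \<Longrightarrow> h p \<in> carrier H"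
    and h_join: "W \<in> \<W> \<Longrightarrow> path p \<Longrightarrow> path_image p \<subseteq> W \<Longrightarrow> path q \<Longrightarrow> path_image q \<subseteq> W \<Longrightarrow>
      pathfinish p = pathstart q \<Longrightarrow> h (p +++ q) = h p \<otimes> h q"
    and h_homotopic: "W \<in> \<W> \<Longrightarrow> homotopic_paths W p q \<Longrightarrow> h p = h q"
begin

lemma cancel_inv [simp]:
  "x \<in> carrier H \<Longrightarrow> y \<in> carrier H \<Longrightarrow> inv x \<otimes> (x \<otimes> y) = y"
  "x \<in> carrier H \<Longrightarrow> y \<in> carrier H \<Longrightarrow> x \<otimes> (inv x \<otimes> y) = y"
  by (simp_all add: m_assoc[symmetric])

text \<open>The holonomy of \<open>p\<close> along \<open>[s, t]\<close> is going to be \<open>inv (D s) \<otimes> D t\<close>. Near each \<open>x\<close> the condition concerns only intervals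
  that contain \<open>x\<close>: this is the form of hypothesis that the bisection principle \<open>Bolzano\<close> takes, through which all
  arguments about short pieces of paths and small squares are globalised.\<close>
definition developing :: "(real \<Rightarrow> 'a) \<Rightarrow> real \<Rightarrow> real \<Rightarrow> (real \<Rightarrow> 'b) \<Rightarrow> bool" where
  "developing p a b D \<longleftrightarrow> (\<forall>t\<in>{a..b}. D t \<in> carrier H) \<and>
     (\<forall>x\<in>{a..b}. \<exists>d>0. \<forall>s t. a \<le> s \<longrightarrow> s \<le> x \<longrightarrow> x \<le> t \<longrightarrow> t \<le> b \<longrightarrow> t - s < d \<longrightarrow>
        D t = D s \<otimes> h (subpath s t p))"

lemma subpath_in_cover:
  assumes "path p" "path_image p \<subseteq> \<Union>\<W>" "x \<in> {0..1}"
  obtains d W where "d > 0" "W \<in> \<W>"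
    "\<And>s t. 0 \<le> s \<Longrightarrow> s \<le> x \<Longrightarrow> x \<le> t \<Longrightarrow> t \<le> 1 \<Longrightarrow> t - s < d \<Longrightarrow> p ` {s..t} \<subseteq> W"
proof -
  have "p x \<in> \<Union>\<W>" using assms(2,3) unfolding path_image_def by blast
  then obtain W where W: "W \<in> \<W>" "p x \<in> W" by blast
  have c: "continuous_on {0..1} p" using assms by (simp add: path_def)
  obtain d where d: "d > 0" "\<And>y. y \<in> {0..1} \<Longrightarrow> dist y x < d \<Longrightarrow> p y \<in> W"
  proof -
    obtain e where e: "e > 0" "ball (p x) e \<subseteq> W"
      using open_cover[OF W(1)] W(2) open_contains_ball by metis
    from c assms(3) e(1) obtain d where "d > 0" "\<forall>y\<in>{0..1}. dist y x < d \<longrightarrow> dist (p y) (p x) < e"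
      unfolding continuous_on_iff by metis
    then show ?thesis using e that[of d] by (auto simp: subset_eq dist_commute)
  qed
  show ?thesis
    by (rule that[OF d(1) W(1)]) (auto intro!: d(2) simp: dist_real_def)
qed

lemma h_subpath:
  assumes "W \<in> \<W>" "path p" "p ` {a..b} \<subseteq> W" "0 \<le> a" "a \<le> s" "s \<le> t" "t \<le> u" "u \<le> b" "b \<le> 1"
  shows "h (subpath s u p) = h (subpath s t p) \<otimes> h (subpath t u p)"
    and "h (subpath s t p) \<in> carrier H"
proof -
  have sub: "path (subpath x y p)" "path_image (subpath x y p) \<subseteq> W"
    if "a \<le> x" "x \<le> y" "y \<le> b" for x y
    using that assms by (auto simp: path_image_subpath intro!: path_subpath)
  let ?q = "subpath a b p"
  have "homotopic_paths W (subpath s t p +++ subpath t u p) (subpath s u p)"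
  proof (cases "a = b")
    case True
    then have "s = a" "t = a" "u = a" using assms by auto
    moreover have "p a \<in> W" using assms True by auto
    ultimately show ?thesis
      using homotopic_paths_lid[of "linepath (p a) (p a)" W] by (simp add: subpath_refl)
  next
    case False
    then have ab: "a < b" using assms by auto
    have eq: "subpath x y p = subpath ((x-a)/(b-a)) ((y-a)/(b-a)) ?q" for x y
    proof
      fix r
      have "(b-a) * ((y-x)/(b-a) * r + (x-a)/(b-a)) + a = (y-x)*r + x"
        using ab by (simp add: distrib_left)
      then have "(b-a) * (((y-a)/(b-a) - (x-a)/(b-a)) * r + (x-a)/(b-a)) + a = (y-x)*r + x"
        by (simp add: diff_divide_distrib[symmetric])
      then show "subpath x y p r = subpath ((x-a)/(b-a)) ((y-a)/(b-a)) ?q r"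
        by (simp add: subpath_def)
    qed
    show ?thesis
      unfolding eq[of s t] eq[of t u] eq[of s u]
      by (rule homotopic_join_subpaths) (use sub[of a b] ab assms in \<open>auto simp: field_simps\<close>)
  qed
  from h_homotopic[OF assms(1) this]
  have "h (subpath s u p) = h (subpath s t p +++ subpath t u p)" by simp
  also have "\<dots> = h (subpath s t p) \<otimes> h (subpath t u p)"
    by (rule h_join[OF assms(1)]) (use sub[of s t] sub[of t u] assms in auto)
  finally show "h (subpath s u p) = h (subpath s t p) \<otimes> h (subpath t u p)" .
  show "h (subpath s t p) \<in> carrier H"
    using h_closed[OF assms(1)] sub[of s t] assms by auto
qed

lemma developing_h:
  assumes "W \<in> \<W>" "path p" "p ` {a..b} \<subseteq> W" "0 \<le> a" "b \<le> 1"
  shows "developing p a b (\<lambda>t. h (subpath a t p))"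
proof -
  have hs: "h (subpath a s p) \<in> carrier H"
    "h (subpath a t p) = h (subpath a s p) \<otimes> h (subpath s t p)" if "a \<le> s" "s \<le> t" "t \<le> b" for s t
    using h_subpath[OF assms(1-3), of a s t] that assms by auto
  have "\<forall>x\<in>{a..b}. \<exists>d>0. \<forall>s t. a \<le> s \<longrightarrow> s \<le> x \<longrightarrow> x \<le> t \<longrightarrow> t \<le> b \<longrightarrow> t - s < d \<longrightarrow>
    h (subpath a t p) = h (subpath a s p) \<otimes> h (subpath s t p)"
    by (intro ballI exI[of _ 1] conjI allI impI hs(2)) auto
  then show ?thesis
    unfolding developing_def using hs(1) by auto
qed

text \<open>Two developing maps on adjacent intervals are glued after translating the second to agree at the common end.\<close>
lemma developing_exists:
  assumes p: "path p" "path_image p \<subseteq> \<Union>\<W>"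
  shows "\<exists>D. developing p 0 1 D"
proof -
  have "0 \<le> (0::real) \<longrightarrow> 1 \<le> (1::real) \<longrightarrow> (\<exists>D. developing p 0 1 D)"
  proof (rule Bolzano[of 0 1 "\<lambda>a b. 0 \<le> a \<longrightarrow> b \<le> 1 \<longrightarrow> (\<exists>D. developing p a b D)"])
    show "(0::real) \<le> 1" by simp
  next
    fix a b c :: real
    assume 1: "0 \<le> a \<longrightarrow> b \<le> 1 \<longrightarrow> (\<exists>D. developing p a b D)"
      and 2: "0 \<le> b \<longrightarrow> c \<le> 1 \<longrightarrow> (\<exists>D. developing p b c D)" and abc: "a \<le> b" "b \<le> c"
    show "0 \<le> a \<longrightarrow> c \<le> 1 \<longrightarrow> (\<exists>D. developing p a c D)"
    proof (intro impI)
      assume ac: "0 \<le> a" "c \<le> 1"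
      obtain D where D: "developing p a b D" using 1 ac abc by auto
      obtain E where E: "developing p b c E" using 2 ac abc by auto
      \<comment> \<open>The translated second map takes the value \<open>D b\<close> at \<open>b\<close>.\<close>
      define F where "F t = (if t \<le> b then D t else D b \<otimes> inv E b \<otimes> E t)" for t
      have Dc: "D t \<in> carrier H" if "a \<le> t" "t \<le> b" for t using D that by (auto simp: developing_def)
      have Ec: "E t \<in> carrier H" if "b \<le> t" "t \<le> c" for t using E that by (auto simp: developing_def)
      have Fb: "F t = D b \<otimes> inv E b \<otimes> E t" if "b \<le> t" "t \<le> c" for t
        using that Dc[of b] Ec[of b] abc by (cases "t = b") (auto simp: F_def m_assoc)
      have "developing p a c F"
        unfolding developing_def
      proof (intro conjI ballI)
        fix t assume "t \<in> {a..c}"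
        then show "F t \<in> carrier H" using Dc[of t] Dc[of b] Ec[of b] Ec[of t] abc by (auto simp: F_def)
      next
        fix x assume x: "x \<in> {a..c}"
        have "x \<in> {0..1}" using x ac by auto
        from subpath_in_cover[OF p this]
        obtain d0 W where d0: "d0 > 0" "W \<in> \<W>"
          "\<And>s t. 0 \<le> s \<Longrightarrow> s \<le> x \<Longrightarrow> x \<le> t \<Longrightarrow> t \<le> 1 \<Longrightarrow> t - s < d0 \<Longrightarrow> p ` {s..t} \<subseteq> W"
          by metis
        obtain d1 where d1: "d1 > 0" "\<And>s t. x \<le> b \<Longrightarrow> a \<le> s \<Longrightarrow> s \<le> x \<Longrightarrow> x \<le> t \<Longrightarrow> t \<le> b \<Longrightarrow> t - s < d1 \<Longrightarrow>
           D t = D s \<otimes> h (subpath s t p)"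
          using D x unfolding developing_def
          by (metis atLeastAtMost_iff zero_less_one)
        obtain d2 where d2: "d2 > 0" "\<And>s t. b \<le> x \<Longrightarrow> b \<le> s \<Longrightarrow> s \<le> x \<Longrightarrow> x \<le> t \<Longrightarrow> t \<le> c \<Longrightarrow> t - s < d2 \<Longrightarrow>
           E t = E s \<otimes> h (subpath s t p)"
          using E x unfolding developing_def
          by (metis atLeastAtMost_iff zero_less_one)
        define d where "d = Min {d0, d1, d2, if x = b then 1 else \<bar>x - b\<bar>}"
        have d: "d > 0" "d \<le> d0" "d \<le> d1" "d \<le> d2" "x \<noteq> b \<Longrightarrow> d \<le> \<bar>x - b\<bar>"
          using d0(1) d1(1) d2(1) by (auto simp: d_def)
        show "\<exists>d>0. \<forall>s t. a \<le> s \<longrightarrow> s \<le> x \<longrightarrow> x \<le> t \<longrightarrow> t \<le> c \<longrightarrow> t - s < d \<longrightarrow> F t = F s \<otimes> h (subpath s t p)"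
        proof (intro exI[of _ d] conjI allI impI d(1))
          fix s t assume st: "a \<le> s" "s \<le> x" "x \<le> t" "t \<le> c" "t - s < d"
          have im: "p ` {s..t} \<subseteq> W" using d0(3)[of s t] st ac d by auto
          note hs = h_subpath[OF d0(2) p(1) im]
          consider "x < b" | "x > b" | "x = b" by linarith
          then show "F t = F s \<otimes> h (subpath s t p)"
          proof cases
            case 1
            then have "t \<le> b" "s \<le> b" using d(5) st by auto
            then show ?thesis using d1(2)[of s t] 1 st d by (simp add: F_def)
          next
            case 2
            then have b: "b \<le> t" "b \<le> s" using d(5) st by auto
            then have "E t = E s \<otimes> h (subpath s t p)" using d2(2)[of s t] 2 st d by simp
            then show ?thesis using b st Fb[of s] Fb[of t] hs(2)[of s t] Dc[of b] Ec[of b] Ec[of s] ac abc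
              by (simp add: m_assoc)
          next
            case 3
            have "D b = D s \<otimes> h (subpath s b p)" using d1(2)[of s b] 3 st d by auto
            moreover have "E t = E b \<otimes> h (subpath b t p)" using d2(2)[of b t] 3 st d by auto
            moreover have "h (subpath s t p) = h (subpath s b p) \<otimes> h (subpath b t p)"
              using hs(1)[of s b t] 3 st ac by auto
            moreover have "h (subpath s b p) \<in> carrier H" "h (subpath b t p) \<in> carrier H"
              using hs(2)[of s b] hs(2)[of b t] 3 st ac by auto
            moreover have "D b \<in> carrier H" "D s \<in> carrier H" "E b \<in> carrier H"
              using Dc[of b] Dc[of s] Ec[of b] st 3 abc by auto
            ultimately show ?thesis using Fb[of t] st 3
              by (simp add: F_def m_assoc)
          qed
        qed
      qed
      then show "\<exists>D. developing p a c D" by blast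
    qed
  next
    fix x :: real assume "0 \<le> x" "x \<le> 1"
    then have x: "x \<in> {0..1}" by simp
    from subpath_in_cover[OF p this]
    obtain d0 W where d0: "d0 > 0" "W \<in> \<W>"
      "\<And>s t. 0 \<le> s \<Longrightarrow> s \<le> x \<Longrightarrow> x \<le> t \<Longrightarrow> t \<le> 1 \<Longrightarrow> t - s < d0 \<Longrightarrow> p ` {s..t} \<subseteq> W"
      by metis
    show "\<exists>d>0. \<forall>a b. a \<le> x \<and> x \<le> b \<and> b - a < d \<longrightarrow> 0 \<le> a \<longrightarrow> b \<le> 1 \<longrightarrow> (\<exists>D. developing p a b D)"
    proof (intro exI[of _ d0] conjI allI impI d0(1))
      fix a b assume ab: "a \<le> x \<and> x \<le> b \<and> b - a < d0" "0 \<le> a" "b \<le> 1"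
      then have "p ` {a..b} \<subseteq> W" using d0(3)[of a b] by auto
      then have "developing p a b (\<lambda>t. h (subpath a t p))"
        using developing_h[OF d0(2) p(1)] ab by auto
      then show "\<exists>D. developing p a b D" by blast
    qed
  qed
  then show ?thesis by simp
qed

lemma developing_unique:
  assumes "developing p a b D" "developing p a b E" "path p" "path_image p \<subseteq> \<Union>\<W>" "0 \<le> a" "a \<le> b" "b \<le> 1"
  shows "inv (D a) \<otimes> D b = inv (E a) \<otimes> E b"
proof -
  have c: "D t \<in> carrier H" "E t \<in> carrier H" if "a \<le> t" "t \<le> b" for t
    using assms that by (auto simp: developing_def)
  have "a \<le> a \<longrightarrow> b \<le> b \<longrightarrow> inv (D a) \<otimes> D b = inv (E a) \<otimes> E b"
  proof (rule Bolzano[of a b "\<lambda>r s. a \<le> r \<longrightarrow> s \<le> b \<longrightarrow> inv (D r) \<otimes> D s = inv (E r) \<otimes> E s"])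
    fix r s t assume "a \<le> r \<longrightarrow> s \<le> b \<longrightarrow> inv (D r) \<otimes> D s = inv (E r) \<otimes> E s"
      "a \<le> s \<longrightarrow> t \<le> b \<longrightarrow> inv (D s) \<otimes> D t = inv (E s) \<otimes> E t" "r \<le> s" "s \<le> t"
    moreover have "inv (F r) \<otimes> F t = inv (F r) \<otimes> F s \<otimes> (inv (F s) \<otimes> F t)"
      if "F r \<in> carrier H" "F s \<in> carrier H" "F t \<in> carrier H" for F :: "real \<Rightarrow> 'b"
      using that by (simp add: m_assoc)
    ultimately show "a \<le> r \<longrightarrow> t \<le> b \<longrightarrow> inv (D r) \<otimes> D t = inv (E r) \<otimes> E t"
      using c[of r] c[of s] c[of t] by simp
  next
    fix x assume x: "a \<le> x" "x \<le> b"
    obtain d1 where d1: "d1 > 0" "\<And>s t. a \<le> s \<Longrightarrow> s \<le> x \<Longrightarrow> x \<le> t \<Longrightarrow> t \<le> b \<Longrightarrow> t - s < d1 \<Longrightarrow>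
       D t = D s \<otimes> h (subpath s t p)"
      using bspec[OF conjunct2[OF assms(1)[unfolded developing_def]], of x] x by (auto simp: Ball_def)
    obtain d2 where d2: "d2 > 0" "\<And>s t. a \<le> s \<Longrightarrow> s \<le> x \<Longrightarrow> x \<le> t \<Longrightarrow> t \<le> b \<Longrightarrow> t - s < d2 \<Longrightarrow>
       E t = E s \<otimes> h (subpath s t p)"
      using bspec[OF conjunct2[OF assms(2)[unfolded developing_def]], of x] x by (auto simp: Ball_def)
    have "x \<in> {0..1}" using x assms by auto
    from subpath_in_cover[OF assms(3,4) this]
    obtain d0 W where d0: "d0 > 0" "W \<in> \<W>"
      "\<And>s t. 0 \<le> s \<Longrightarrow> s \<le> x \<Longrightarrow> x \<le> t \<Longrightarrow> t \<le> 1 \<Longrightarrow> t - s < d0 \<Longrightarrow> p ` {s..t} \<subseteq> W"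
      by metis
    show "\<exists>d>0. \<forall>s t. s \<le> x \<and> x \<le> t \<and> t - s < d \<longrightarrow> a \<le> s \<longrightarrow> t \<le> b \<longrightarrow> inv (D s) \<otimes> D t = inv (E s) \<otimes> E t"
    proof (intro exI[of _ "min d0 (min d1 d2)"] conjI allI impI)
      fix s t assume st: "s \<le> x \<and> x \<le> t \<and> t - s < min d0 (min d1 d2)" "a \<le> s" "t \<le> b"
      have "h (subpath s t p) \<in> carrier H"
        using h_subpath(2)[OF d0(2) assms(3) d0(3)[of s t], of s t t] st assms by auto
      then show "inv (D s) \<otimes> D t = inv (E s) \<otimes> E t"
        using d1(2)[of s t] d2(2)[of s t] st c[of s] by simp
    qed (use d0 d1 d2 in auto)
  qed (use assms in auto)
  then show ?thesis by simp
qed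

lemma developing_subinterval:
  assumes "developing p a b D" "a \<le> a'" "b' \<le> b"
  shows "developing p a' b' D"
  unfolding developing_def
proof (intro conjI ballI)
  show "D t \<in> carrier H" if "t \<in> {a'..b'}" for t
    using assms that by (auto simp: developing_def)
  fix x assume x: "x \<in> {a'..b'}"
  then obtain d where "d > 0" "\<And>s t. a \<le> s \<Longrightarrow> s \<le> x \<Longrightarrow> x \<le> t \<Longrightarrow> t \<le> b \<Longrightarrow> t - s < d \<Longrightarrow>
     D t = D s \<otimes> h (subpath s t p)"
    using bspec[OF conjunct2[OF assms(1)[unfolded developing_def]], of x] assms by auto
  with assms show "\<exists>d>0. \<forall>s t. a' \<le> s \<longrightarrow> s \<le> x \<longrightarrow> x \<le> t \<longrightarrow> t \<le> b' \<longrightarrow> t - s < d \<longrightarrow>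
      D t = D s \<otimes> h (subpath s t p)"
    by (intro exI[of _ d]) auto
qed

lemma developing_increment:
  assumes "developing p 0 1 D" "path p" "path_image p \<subseteq> \<Union>\<W>" "W \<in> \<W>" "p ` {a..b} \<subseteq> W"
    "0 \<le> a" "a \<le> b" "b \<le> 1"
  shows "inv (D a) \<otimes> D b = h (subpath a b p)"
proof -
  have "inv (D a) \<otimes> D b = inv (h (subpath a a p)) \<otimes> h (subpath a b p)"
    by (rule developing_unique[OF developing_subinterval[OF assms(1)] developing_h[OF assms(4,2,5)]])
      (use assms in auto)
  also have "\<dots> = h (subpath a b p)"
    using h_subpath[OF assms(4,2,5), of a a b] h_subpath[OF assms(4,2,5), of a b b] assms by simp
  finally show ?thesis .
qed

definition holonomy :: "(real \<Rightarrow> 'a) \<Rightarrow> 'b" where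
  "holonomy p = (let D = SOME D. developing p 0 1 D in inv (D 0) \<otimes> D 1)"

lemma holonomy_developing:
  assumes "developing p 0 1 D" "path p" "path_image p \<subseteq> \<Union>\<W>"
  shows "holonomy p = inv (D 0) \<otimes> D 1"
proof -
  have "developing p 0 1 (SOME D. developing p 0 1 D)"
    by (rule someI[of "developing p 0 1"]) (rule assms)
  from developing_unique[OF this assms] show ?thesis by (simp add: holonomy_def Let_def)
qed

lemma holonomy_h:
  assumes "W \<in> \<W>" "path p" "path_image p \<subseteq> W"
  shows "holonomy p = h p"
proof -
  have p: "p ` {0..1} \<subseteq> W" "path_image p \<subseteq> \<Union>\<W>" using assms by (auto simp: path_image_def)
  obtain D where D: "developing p 0 1 D" using developing_exists[OF assms(2) p(2)] by blast
  show ?thesis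
    using holonomy_developing[OF D assms(2) p(2)] developing_increment[OF D assms(2) p(2) assms(1) p(1)] by simp
qed

lemma holonomy_closed:
  assumes "path p" "path_image p \<subseteq> \<Union>\<W>"
  shows "holonomy p \<in> carrier H"
proof -
  obtain D where D: "developing p 0 1 D" using developing_exists[OF assms] by blast
  then show ?thesis using holonomy_developing[OF D assms] by (auto simp: developing_def)
qed

lemma developing_reparametrize:
  assumes D: "developing r 0 1 D" and p: "path p" "path_image p \<subseteq> \<Union>\<W>"
    and c: "0 < c" "0 \<le> e" "c + e \<le> 1" and eq: "\<And>t. t \<in> {0..1} \<Longrightarrow> p t = r (c * t + e)"
  shows "developing p 0 1 (\<lambda>t. D (c * t + e))"
  unfolding developing_def
proof (intro conjI ballI)
  have lin: "0 \<le> c * t + e" "c * t + e \<le> 1" if "0 \<le> t" "t \<le> 1" for t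
    using mult_left_le[of t c] that c by (auto intro: order_trans[of _ "c + e"])
  show "D (c * t + e) \<in> carrier H" if "t \<in> {0..1}" for t
    using D lin[of t] that by (auto simp: developing_def)
  fix x :: real assume x: "x \<in> {0..1}"
  from subpath_in_cover[OF p this]
  obtain d0 W where d0: "d0 > 0" "W \<in> \<W>"
    "\<And>s t. 0 \<le> s \<Longrightarrow> s \<le> x \<Longrightarrow> x \<le> t \<Longrightarrow> t \<le> 1 \<Longrightarrow> t - s < d0 \<Longrightarrow> p ` {s..t} \<subseteq> W"
    by metis
  obtain d1 where d1: "d1 > 0" "\<And>s t. 0 \<le> s \<Longrightarrow> s \<le> c * x + e \<Longrightarrow> c * x + e \<le> t \<Longrightarrow> t \<le> 1 \<Longrightarrow> t - s < d1 \<Longrightarrow>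
     D t = D s \<otimes> h (subpath s t r)"
    using bspec[OF conjunct2[OF D[unfolded developing_def]], of "c * x + e"] lin[of x] x by (auto simp: Ball_def)
  show "\<exists>d>0. \<forall>s t. 0 \<le> s \<longrightarrow> s \<le> x \<longrightarrow> x \<le> t \<longrightarrow> t \<le> 1 \<longrightarrow> t - s < d \<longrightarrow>
      D (c * t + e) = D (c * s + e) \<otimes> h (subpath s t p)"
  proof (intro exI[of _ "min d0 (d1/c)"] conjI allI impI)
    fix s t assume st: "0 \<le> s" "s \<le> x" "x \<le> t" "t \<le> 1" "t - s < min d0 (d1/c)"
    have "D (c * t + e) = D (c * s + e) \<otimes> h (subpath (c * s + e) (c * t + e) r)"
    proof (rule d1(2))
      have "c * (t - s) < d1" using st c by (simp add: pos_less_divide_eq mult.commute)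
      then show "c * t + e - (c * s + e) < d1" by (simp add: algebra_simps)
    qed (use st lin[of s] lin[of t] c in auto)
    moreover have "h (subpath s t p) = h (subpath (c * s + e) (c * t + e) r)"
    proof (rule h_homotopic[OF d0(2)], rule homotopic_paths_eq)
      show "path (subpath s t p)" using p st by (auto intro!: path_subpath)
      show "path_image (subpath s t p) \<subseteq> W" using st d0(3)[of s t] by (simp add: path_image_subpath)
      fix u :: real assume u: "u \<in> {0..1}"
      have "0 \<le> u * (t - s)" "u * (t - s) \<le> t - s"
        using u st by (auto intro!: mult_left_le_one_le)
      then have "(t-s)*u+s \<in> {0..1}" using st unfolding mult.commute[of "t-s" u] by auto
      then show "subpath s t p u = subpath (c * s + e) (c * t + e) r u"
        using eq[of "(t-s)*u+s"] by (simp add: subpath_def algebra_simps)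
    qed
    ultimately show "D (c * t + e) = D (c * s + e) \<otimes> h (subpath s t p)" by simp
  qed (use d0 d1 c in auto)
qed

lemma holonomy_join:
  assumes "path p" "path_image p \<subseteq> \<Union>\<W>" "path q" "path_image q \<subseteq> \<Union>\<W>" "pathfinish p = pathstart q"
  shows "holonomy (p +++ q) = holonomy p \<otimes> holonomy q"
proof -
  have r: "path (p +++ q)" "path_image (p +++ q) \<subseteq> \<Union>\<W>"
    using assms by (auto simp: path_image_join)
  obtain D where D: "developing (p +++ q) 0 1 D" using developing_exists[OF r] by blast
  have "developing p 0 1 (\<lambda>t. D (1/2 * t + 0))"
    by (rule developing_reparametrize[OF D]) (use assms in \<open>auto simp: joinpaths_def\<close>)
  from holonomy_developing[OF this] have p: "holonomy p = inv (D 0) \<otimes> D (1/2)" using assms by simp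
  have "developing q 0 1 (\<lambda>t. D (1/2 * t + 1/2))"
    by (rule developing_reparametrize[OF D])
      (use assms in \<open>auto simp: joinpaths_def pathfinish_def pathstart_def\<close>)
  from holonomy_developing[OF this] have q: "holonomy q = inv (D (1/2)) \<otimes> D 1" using assms by simp
  have "D t \<in> carrier H" if "t \<in> {0..1}" for t using D that by (auto simp: developing_def)
  then show ?thesis
    using holonomy_developing[OF D r] p q by (simp add: m_assoc)
qed

lemma holonomy_cong:
  assumes "path p" "path_image p \<subseteq> \<Union>\<W>" "path q" "path_image q \<subseteq> \<Union>\<W>"
    and "\<And>t. t \<in> {0..1} \<Longrightarrow> p t = q t"
  shows "holonomy p = holonomy q"
proof -
  obtain D where D: "developing q 0 1 D" using developing_exists[OF assms(3,4)] by blast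
  have "developing p 0 1 (\<lambda>t. D (1 * t + 0))"
    by (rule developing_reparametrize[OF D]) (use assms in auto)
  with D show ?thesis using holonomy_developing[of q D] holonomy_developing[of p D] assms by simp
qed

text \<open>A constant path is its own square under concatenation, and the identity is the only idempotent of a group.\<close>
lemma h_constant:
  assumes "path p" "path_image p \<subseteq> {a}" "a \<in> \<Union>\<W>"
  shows "h p = \<one>"
proof -
  obtain W where W: "W \<in> \<W>" "a \<in> W" using assms by blast
  have "homotopic_paths W p (linepath a a)"
    by (rule homotopic_paths_eq) (use assms(1,2) W in \<open>force simp: path_image_def\<close>)+
  then have *: "h p = h (linepath a a)" using h_homotopic[OF W(1)] by blast
  have "linepath a a +++ linepath a a = linepath a a" by (simp add: joinpaths_def linepath_refl)
  then have "h (linepath a a) = h (linepath a a) \<otimes> h (linepath a a)"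
    using h_join[OF W(1), of "linepath a a" "linepath a a"] W by simp
  moreover have "h (linepath a a) \<in> carrier H" using h_closed[OF W(1)] W by simp
  ultimately have "h (linepath a a) = \<one>" by simp
  with * show ?thesis by simp
qed

text \<open>Bisection is used twice. On the outside it reduces the claim to curves of the homotopy near a given one, row \<open>x\<close>.
  On the inside it shows that the holonomies of two neighbouring rows over \<open>[t, t']\<close> differ by those of the short
  vertical paths \<open>V\<close> at \<open>t\<close> and \<open>t'\<close>; for a small square this is homotopy invariance in one set of the cover. At the ends
  \<open>t = 0\<close> and \<open>t = 1\<close> the vertical paths are constant.\<close>
lemma holonomy_homotopic:
  assumes "homotopic_paths (\<Union>\<W>) p q"
  shows "holonomy p = holonomy q"
proof -
  obtain k :: "real \<times> real \<Rightarrow> 'a" where k: "continuous_on ({0..1} \<times> {0..1}) k" "k ` ({0..1} \<times> {0..1}) \<subseteq> \<Union>\<W>"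
    "\<And>x. x \<in> {0..1} \<Longrightarrow> k (0, x) = p x" "\<And>x. x \<in> {0..1} \<Longrightarrow> k (1, x) = q x"
    "\<And>s. s \<in> {0..1} \<Longrightarrow> k (s, 0) = p 0" "\<And>s. s \<in> {0..1} \<Longrightarrow> k (s, 1) = p 1"
  proof -
    obtain k :: "real \<times> real \<Rightarrow> 'a" where "continuous_on ({0..1} \<times> {0..1}) k" "k \<in> {0..1} \<times> {0..1} \<rightarrow> \<Union>\<W>"
      "\<forall>x\<in>{0..1}. k (0, x) = p x" "\<forall>x\<in>{0..1}. k (1, x) = q x"
      "\<forall>t\<in>{0..1}. k (t, 0) = p 0 \<and> k (t, 1) = p 1"
      using assms unfolding homotopic_paths pathstart_def pathfinish_def o_def by blast
    then show ?thesis by (intro that[of k]) (auto simp: image_subset_iff_funcset)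
  qed
  have k2: "k (s, t) \<in> \<Union>\<W>" if "s \<in> {0..1}" "t \<in> {0..1}" for s t
    using k(2) that by blast
  define row where "row s = (\<lambda>t. k (s, t))" for s
  have row: "path (row s)" "path_image (row s) \<subseteq> \<Union>\<W>" if "s \<in> {0..1}" for s
  proof -
    show "path (row s)" unfolding path_def row_def
      by (rule continuous_on_compose2[OF k(1)]) (use that in \<open>auto intro!: continuous_intros\<close>)
    show "path_image (row s) \<subseteq> \<Union>\<W>" using k2[OF that] unfolding path_image_def row_def by blast
  qed
  define D where "D s = (SOME D. developing (row s) 0 1 D)" for s
  have D: "developing (row s) 0 1 (D s)" if "s \<in> {0..1}" for s
    unfolding D_def using developing_exists[OF row[OF that]] by (rule someI_ex)
  have Dc: "D s t \<in> carrier H" if "s \<in> {0..1}" "t \<in> {0..1}" for s t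
    using D[OF that(1)] that(2) by (auto simp: developing_def)
  define V where "V s s' t = h (k \<circ> linepath (s,t) (s',t))" for s s' t
  define F where "F s t t' = inv (D s t) \<otimes> D s t'" for s t t'
  have "0 \<le> (0::real) \<longrightarrow> 1 \<le> (1::real) \<longrightarrow> holonomy (row 0) = holonomy (row 1)"
  proof (rule Bolzano[of 0 1 "\<lambda>a b. 0 \<le> a \<longrightarrow> b \<le> 1 \<longrightarrow> holonomy (row a) = holonomy (row b)"])
    fix x :: real assume x: "0 \<le> x" "x \<le> 1"
    \<comment> \<open>The two ways around the thin rectangle between the rows \<open>s\<close> and \<open>s'\<close> over \<open>[t, t']\<close> agree.\<close>
    define Q where "Q t t' \<longleftrightarrow> 0 \<le> t \<longrightarrow> t' \<le> 1 \<longrightarrow> (\<exists>d>0. \<forall>s s'. 0 \<le> s \<longrightarrow> s \<le> x \<longrightarrow> x \<le> s' \<longrightarrow> s' \<le> 1 \<longrightarrow> s' - s < d \<longrightarrow>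
       V s s' t \<in> carrier H \<and> V s s' t' \<in> carrier H \<and> F s t t' \<otimes> V s s' t' = V s s' t \<otimes> F s' t t')" for t t' :: real
    have "Q 0 1"
    proof (rule Bolzano)
      show "(0::real) \<le> 1" by simp
    next
      fix a b c :: real assume Q: "Q a b" "Q b c" and abc: "a \<le> b" "b \<le> c"
      show "Q a c" unfolding Q_def
      proof (intro impI)
        assume ac: "0 \<le> a" "c \<le> 1"
        obtain d1 where d1: "d1 > 0" "\<And>s s'. 0 \<le> s \<Longrightarrow> s \<le> x \<Longrightarrow> x \<le> s' \<Longrightarrow> s' \<le> 1 \<Longrightarrow> s' - s < d1 \<Longrightarrow>
          V s s' a \<in> carrier H \<and> V s s' b \<in> carrier H \<and> F s a b \<otimes> V s s' b = V s s' a \<otimes> F s' a b"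
          using Q(1) ac abc unfolding Q_def by auto
        obtain d2 where d2: "d2 > 0" "\<And>s s'. 0 \<le> s \<Longrightarrow> s \<le> x \<Longrightarrow> x \<le> s' \<Longrightarrow> s' \<le> 1 \<Longrightarrow> s' - s < d2 \<Longrightarrow>
          V s s' b \<in> carrier H \<and> V s s' c \<in> carrier H \<and> F s b c \<otimes> V s s' c = V s s' b \<otimes> F s' b c"
          using Q(2) ac abc unfolding Q_def by auto
        show "\<exists>d>0. \<forall>s s'. 0 \<le> s \<longrightarrow> s \<le> x \<longrightarrow> x \<le> s' \<longrightarrow> s' \<le> 1 \<longrightarrow> s' - s < d \<longrightarrow>
          V s s' a \<in> carrier H \<and> V s s' c \<in> carrier H \<and> F s a c \<otimes> V s s' c = V s s' a \<otimes> F s' a c"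
        proof (intro exI[of _ "min d1 d2"] conjI allI impI)
          fix s s' assume s: "0 \<le> s" "s \<le> x" "x \<le> s'" "s' \<le> 1" "s' - s < min d1 d2"
          note 1 = d1(2)[of s s'] and 2 = d2(2)[of s s']
          show V: "V s s' a \<in> carrier H" "V s s' c \<in> carrier H" using 1 2 s by auto
          have Vb: "V s s' b \<in> carrier H" using 1 s by auto
          have sp: "F r a c = F r a b \<otimes> F r b c" "F r a b \<in> carrier H" "F r b c \<in> carrier H"
            if "r \<in> {0..1}" for r
            using Dc[of r a] Dc[of r b] Dc[of r c] that ac abc by (auto simp: F_def m_assoc)
          have s01: "s \<in> {0..1}" "s' \<in> {0..1}" using s x by auto
          note sp1 = sp[OF s01(1)] and sp2 = sp[OF s01(2)]
          have "F s a c \<otimes> V s s' c = F s a b \<otimes> (F s b c \<otimes> V s s' c)"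
            using sp1 V by (simp add: m_assoc)
          also have "F s b c \<otimes> V s s' c = V s s' b \<otimes> F s' b c" using 2 s by auto
          also have "F s a b \<otimes> (V s s' b \<otimes> F s' b c) = (F s a b \<otimes> V s s' b) \<otimes> F s' b c"
            using sp1 sp2 Vb by (simp add: m_assoc)
          also have "F s a b \<otimes> V s s' b = V s s' a \<otimes> F s' a b" using 1 s by auto
          also have "V s s' a \<otimes> F s' a b \<otimes> F s' b c = V s s' a \<otimes> F s' a c"
            using sp2 V by (simp add: m_assoc)
          finally show "F s a c \<otimes> V s s' c = V s s' a \<otimes> F s' a c" .
        qed (use d1 d2 in auto)
      qed
    next
      fix y :: real assume y: "0 \<le> y" "y \<le> 1"
      have "k (x, y) \<in> \<Union>\<W>" using k2 x y by simp
      then obtain W where W: "W \<in> \<W>" "k (x,y) \<in> W" by blast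
      obtain d where d: "d > 0" "\<And>z. z \<in> {0..1} \<times> {0..1} \<Longrightarrow> dist z (x,y) < d \<Longrightarrow> k z \<in> W"
      proof -
        obtain e where e: "e > 0" "ball (k (x,y)) e \<subseteq> W"
          using open_cover[OF W(1)] W(2) open_contains_ball by metis
        have "(x,y) \<in> {0..1} \<times> {0..1}" using x y by auto
        with k(1) e(1) obtain d where "d > 0" "\<forall>z\<in>{0..1} \<times> {0..1}. dist z (x,y) < d \<longrightarrow> dist (k z) (k (x,y)) < e"
          unfolding continuous_on_iff by metis
        then show ?thesis using e that[of d] by (auto simp: subset_eq dist_commute)
      qed
      show "\<exists>d>0. \<forall>a b. a \<le> y \<and> y \<le> b \<and> b - a < d \<longrightarrow> Q a b"
      proof (intro exI[of _ "d/2"] conjI allI impI)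
        fix a b assume ab: "a \<le> y \<and> y \<le> b \<and> b - a < d/2"
        show "Q a b" unfolding Q_def
        proof (intro impI exI[of _ "d/2"] conjI allI)
          fix s s' assume ab01: "0 \<le> a" "b \<le> 1" and s: "0 \<le> s" "s \<le> x" "x \<le> s'" "s' \<le> 1" "s' - s < d/2"
          define R where "R = {s..s'} \<times> {a..b}"
          have R01: "R \<subseteq> {0..1} \<times> {0..1}" using s ab01 by (auto simp: R_def)
          have kR: "k \<in> R \<rightarrow> W"
          proof
            fix z assume z: "z \<in> R"
            have "dist z (x,y) \<le> dist (fst z) x + dist (snd z) y"
              by (metis dist_Pair_Pair prod.collapse real_sqrt_sum_squares_triangle_ineq sqrt_sum_squares_le_sum zero_le_dist)
            also have "\<dots> < d" using z s ab by (auto simp: R_def dist_real_def)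
            finally show "k z \<in> W" using d(2) R01 z by blast
          qed
          have kc: "continuous_on R k" using k(1) R01 continuous_on_subset by blast
          have conv: "convex R" unfolding R_def by (intro convex_Times) auto
          have corners: "(s,a) \<in> R" "(s,b) \<in> R" "(s',a) \<in> R" "(s',b) \<in> R"
            using s ab by (auto simp: R_def)
          have seg: "closed_segment u v \<subseteq> R" if "u \<in> R" "v \<in> R" for u v
            using conv that by (simp add: closed_segment_subset)
          have side: "path (k \<circ> linepath u v)" "path_image (k \<circ> linepath u v) \<subseteq> W" if "u \<in> R" "v \<in> R" for u v
          proof -
            show "path (k \<circ> linepath u v)"
              by (rule path_continuous_image) (use seg[OF that] continuous_on_subset[OF kc] in auto)
            show "path_image (k \<circ> linepath u v) \<subseteq> W"
              using seg[OF that] kR by (auto simp: path_image_compose)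
          qed
          have hc: "h (k \<circ> linepath u v) \<in> carrier H" if "u \<in> R" "v \<in> R" for u v
            by (rule h_closed[OF W(1) side[OF that]])
          show "V s s' a \<in> carrier H" "V s s' b \<in> carrier H" unfolding V_def using hc corners by auto
          have F: "F r a b = h (k \<circ> linepath (r,a) (r,b))" if "r \<in> {s..s'}" for r
          proof -
            have r: "r \<in> {0..1}" using that s by auto
            have im: "row r ` {a..b} \<subseteq> W" using kR that by (auto simp: R_def row_def)
            have "F r a b = h (subpath a b (row r))"
              unfolding F_def using developing_increment[OF D[OF r] row[OF r] W(1) im] ab ab01 by auto
            also have "subpath a b (row r) = k \<circ> linepath (r,a) (r,b)"
              by (auto simp: fun_eq_iff subpath_def row_def linepath_def algebra_simps)
            finally show ?thesis .
          qed
          have "homotopic_paths R (linepath (s,a) (s,b) +++ linepath (s,b) (s',b))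
             (linepath (s,a) (s',a) +++ linepath (s',a) (s',b))"
            using convex_imp_simply_connected[OF conv] unfolding simply_connected_eq_homotopic_paths
            using corners seg by (auto simp: path_image_join)
          from homotopic_paths_continuous_image[OF this kc kR]
          have "h ((k \<circ> linepath (s,a) (s,b)) +++ (k \<circ> linepath (s,b) (s',b))) =
            h ((k \<circ> linepath (s,a) (s',a)) +++ (k \<circ> linepath (s',a) (s',b)))"
            by (intro h_homotopic[OF W(1)]) (simp add: path_compose_join)
          moreover have "h ((k \<circ> linepath u v) +++ (k \<circ> linepath v w)) = h (k \<circ> linepath u v) \<otimes> h (k \<circ> linepath v w)"
            if "u \<in> R" "v \<in> R" "w \<in> R" for u v w
            by (rule h_join[OF W(1)]) (use that side in \<open>auto simp: pathfinish_compose pathstart_compose\<close>)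
          ultimately show "F s a b \<otimes> V s s' b = V s s' a \<otimes> F s' a b"
            unfolding V_def using F[of s] F[of s'] s corners by auto
        qed (use d in auto)
      qed (use d in auto)
    qed
    then obtain d where d: "d > 0" "\<And>s s'. 0 \<le> s \<Longrightarrow> s \<le> x \<Longrightarrow> x \<le> s' \<Longrightarrow> s' \<le> 1 \<Longrightarrow> s' - s < d \<Longrightarrow>
          F s 0 1 \<otimes> V s s' 1 = V s s' 0 \<otimes> F s' 0 1"
      unfolding Q_def by auto
    have V1: "V s s' t = \<one>" if "0 \<le> s" "s \<le> s'" "s' \<le> 1" "t = 0 \<or> t = 1" for s s' t
      unfolding V_def
    proof (rule h_constant)
      have sub: "closed_segment (s,t) (s',t) \<subseteq> {0..1} \<times> {t}"
        by (rule closed_segment_subset) (use that in \<open>auto intro!: convex_Times\<close>)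
      show "path (k \<circ> linepath (s,t) (s',t))"
        by (rule path_continuous_image) (use sub that in \<open>auto intro!: continuous_on_subset[OF k(1)]\<close>)
      show "path_image (k \<circ> linepath (s,t) (s',t)) \<subseteq> {p t}"
        using sub that k(5,6) by (auto simp: path_image_compose)
      have "t \<in> {0..1}" using that by auto
      then show "p t \<in> \<Union>\<W>" using k2[of 0 t] k(3)[of t] by simp
    qed
    show "\<exists>d>0. \<forall>a b. a \<le> x \<and> x \<le> b \<and> b - a < d \<longrightarrow> 0 \<le> a \<longrightarrow> b \<le> 1 \<longrightarrow> holonomy (row a) = holonomy (row b)"
    proof (intro exI[of _ d] conjI allI impI d(1))
      fix a b assume ab: "a \<le> x \<and> x \<le> b \<and> b - a < d" "0 \<le> a" "b \<le> 1"
      then have ab01: "a \<in> {0..1}" "b \<in> {0..1}" using x by auto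
      have "F a 0 1 = F b 0 1"
        using d(2)[of a b] V1[of a b 0] V1[of a b 1] ab Dc ab01 by (simp add: F_def)
      then show "holonomy (row a) = holonomy (row b)"
        using holonomy_developing[OF D row] ab01 by (simp add: F_def)
    qed
  qed auto
  moreover have "holonomy (row 0) = holonomy p" "holonomy (row 1) = holonomy q"
  proof -
    have "path p" "path q" "path_image p \<subseteq> \<Union>\<W>" "path_image q \<subseteq> \<Union>\<W>"
      using assms homotopic_paths_imp_path homotopic_paths_imp_subset by blast+
    then show "holonomy (row 0) = holonomy p" "holonomy (row 1) = holonomy q"
      using holonomy_cong[OF row[of 0], of p] holonomy_cong[OF row[of 1], of q] k(3,4) by (simp_all add: row_def)
  qed
  ultimately show ?thesis by simp
qed

text \<open>The holonomy of a class is that of any of its representatives.\<close>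
lemma holonomy_hom:
  assumes "b \<in> \<Union>\<W>"
  shows "\<exists>\<phi>\<in>hom (fundamental_group (\<Union>\<W>) b) H. \<forall>p\<in>loops_at (\<Union>\<W>) b. \<phi> (loop_class (\<Union>\<W>) p) = holonomy p"
proof -
  let ?Y = "\<Union>\<W>"
  define \<phi> where "\<phi> C = holonomy (SOME p. p \<in> C)" for C
  have \<phi>: "\<phi> (loop_class ?Y p) = holonomy p" if p: "p \<in> loops_at ?Y b" for p
  proof -
    have "p \<in> loop_class ?Y p" using p by (simp add: loop_class_def loops_at_def)
    then have "(SOME q. q \<in> loop_class ?Y p) \<in> loop_class ?Y p" by (rule someI[of "\<lambda>q. q \<in> loop_class ?Y p"])
    then show ?thesis unfolding \<phi>_def using holonomy_homotopic by (simp add: loop_class_def)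
  qed
  have "\<phi> \<in> hom (fundamental_group ?Y b) H"
  proof (rule homI)
    fix A assume "A \<in> carrier (fundamental_group ?Y b)"
    then obtain p where p: "p \<in> loops_at ?Y b" "A = loop_class ?Y p" by (auto simp: fundamental_group_carrier)
    then show "\<phi> A \<in> carrier H" using \<phi> holonomy_closed by (simp add: loops_at_def)
    fix B assume "B \<in> carrier (fundamental_group ?Y b)"
    then obtain q where q: "q \<in> loops_at ?Y b" "B = loop_class ?Y q" by (auto simp: fundamental_group_carrier)
    have "holonomy (p +++ q) = holonomy p \<otimes> holonomy q" using p q by (intro holonomy_join) (auto simp: loops_at_def)
    then show "\<phi> (A \<otimes>\<^bsub>fundamental_group ?Y b\<^esub> B) = \<phi> A \<otimes> \<phi> B"
      using p q \<phi> loops_at_join[OF p(1) q(1)] by (simp add: mult_loop_class)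
  qed
  then show ?thesis using \<phi> by blast
qed

end

section \<open>Solid tori and winding numbers\<close>

lemma winding_compose:
  assumes "continuous_on W f" "0 \<notin> f ` W"
  shows "path p \<Longrightarrow> path_image p \<subseteq> W \<Longrightarrow> path (f \<circ> p) \<and> 0 \<notin> path_image (f \<circ> p)"
    "homotopic_paths W p q \<Longrightarrow> winding_number (f \<circ> p) 0 = winding_number (f \<circ> q) 0"
proof -
  show "path p \<Longrightarrow> path_image p \<subseteq> W \<Longrightarrow> path (f \<circ> p) \<and> 0 \<notin> path_image (f \<circ> p)"
    using assms by (auto intro!: path_continuous_image continuous_on_subset[OF assms(1)] simp: path_image_compose)
  show "homotopic_paths W p q \<Longrightarrow> winding_number (f \<circ> p) 0 = winding_number (f \<circ> q) 0"
    using assms by (intro winding_number_homotopic_paths homotopic_paths_continuous_image) auto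
qed

lemma winding_compose_join:
  assumes "continuous_on W f" "0 \<notin> f ` W"
    "path p" "path_image p \<subseteq> W" "path q" "path_image q \<subseteq> W" "pathfinish p = pathstart q"
  shows "winding_number (f \<circ> (p +++ q)) 0 = winding_number (f \<circ> p) 0 + winding_number (f \<circ> q) 0"
  unfolding path_compose_join
  using winding_compose(1)[OF assms(1-2), of p] winding_compose(1)[OF assms(1-2), of q] assms
  by (intro winding_number_join) (auto simp: pathfinish_compose pathstart_compose)

text \<open>If winding numbers of \<open>f\<close> separate loops in \<open>W\<close>, then a loop of winding number one generates their classes.\<close>
lemma loops_generated_by_unit_winding:
  fixes W :: "'a::real_normed_vector set" and f :: "'a \<Rightarrow> complex"
  assumes W: "W \<subseteq> Y" "b \<in> W" and f: "continuous_on W f" "0 \<notin> f ` W"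
    and inj: "\<And>p q. p \<in> loops_at W b \<Longrightarrow> q \<in> loops_at W b \<Longrightarrow>
        winding_number (f \<circ> p) 0 = winding_number (f \<circ> q) 0 \<Longrightarrow> homotopic_paths W p q"
    and l: "l \<in> loops_at W b" "winding_number (f \<circ> l) 0 = 1" and p: "p \<in> loops_at W b"
  shows "winding_number (f \<circ> p) 0 = of_nat k \<Longrightarrow> loop_class Y p = loop_class Y l [^]\<^bsub>fundamental_group Y b\<^esub> k"
    and "loop_class Y p \<in> generate (fundamental_group Y b) {loop_class Y l}"
proof -
  let ?G = "fundamental_group Y b"
  have bY: "b \<in> Y" using W by auto
  interpret group ?G by (rule group_fundamental_group[OF bY])
  have sub: "loops_at W b \<subseteq> loops_at Y b" using W(1) by (auto simp: loops_at_def)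
  have ex: "\<exists>q\<in>loops_at W b. winding_number (f \<circ> q) 0 = of_nat k \<and> loop_class Y q = loop_class Y l [^]\<^bsub>?G\<^esub> k" for k
  proof (induction k)
    case 0
    have "linepath b b \<in> loops_at W b" using W by (simp add: loops_at_def)
    moreover have "f \<circ> linepath b b = linepath (f b) (f b)" by (simp add: linepath_refl o_def)
    moreover have "f b \<noteq> 0" using f W by auto
    ultimately have "winding_number (f \<circ> linepath b b) 0 = of_nat 0" by (simp only: winding_number_trivial of_nat_0)
    moreover have "loop_class Y (linepath b b) = loop_class Y l [^]\<^bsub>?G\<^esub> (0::nat)"
      by (simp only: nat_pow_0 fundamental_group_one)
    ultimately show ?case using \<open>linepath b b \<in> loops_at W b\<close> by blast
  next
    case (Suc k)
    then obtain q where q: "q \<in> loops_at W b" "winding_number (f \<circ> q) 0 = of_nat k" "loop_class Y q = loop_class Y l [^]\<^bsub>?G\<^esub> k" by blast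
    have "winding_number (f \<circ> (q +++ l)) 0 = of_nat (Suc k)"
      using winding_compose_join[OF f, of q l] q l by (simp add: loops_at_def add.commute)
    moreover have "loop_class Y (q +++ l) = loop_class Y l [^]\<^bsub>?G\<^esub> Suc k"
      using mult_loop_class[of q Y b l] q l sub by auto
    ultimately show ?case using loops_at_join[OF q(1) l(1)] by blast
  qed
  have *: "loop_class Y p = loop_class Y l [^]\<^bsub>?G\<^esub> k"
    if pk: "p \<in> loops_at W b" "winding_number (f \<circ> p) 0 = of_nat k" for k p
  proof -
    obtain q where q: "q \<in> loops_at W b" "winding_number (f \<circ> q) 0 = of_nat k" "loop_class Y q = loop_class Y l [^]\<^bsub>?G\<^esub> k"
      using ex by blast
    have "homotopic_paths W p q" using pk q by (intro inj) auto
    then have "homotopic_paths Y p q" using W(1) homotopic_paths_subset by blast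
    then show ?thesis using q(3) loop_class_eqI by metis
  qed
  show "winding_number (f \<circ> p) 0 = of_nat k \<Longrightarrow> loop_class Y p = loop_class Y l [^]\<^bsub>?G\<^esub> k"
    using *[OF p] .
  have lG: "loop_class Y l \<in> carrier ?G" using l sub by (auto simp: fundamental_group_carrier)
  have gsub: "subgroup (generate ?G {loop_class Y l}) ?G" using lG by (intro generate_is_subgroup) auto
  have pow: "loop_class Y l [^]\<^bsub>?G\<^esub> k \<in> generate ?G {loop_class Y l}" for k :: nat
    by (induction k) (auto intro: generate.intros)
  have fp: "path (f \<circ> p)" "0 \<notin> path_image (f \<circ> p)" "pathfinish (f \<circ> p) = pathstart (f \<circ> p)"
    using winding_compose(1)[OF f, of p] p by (auto simp: loops_at_def pathfinish_compose pathstart_compose)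
  then have "winding_number (f \<circ> p) 0 \<in> \<int>" by (intro integer_winding_number)
  then obtain z where z: "winding_number (f \<circ> p) 0 = of_int z" by (auto elim: Ints_cases)
  show "loop_class Y p \<in> generate ?G {loop_class Y l}"
  proof (cases "z \<ge> 0")
    case True
    then have "winding_number (f \<circ> p) 0 = of_nat (nat z)" using z by simp
    then show ?thesis using *[OF p] pow by simp
  next
    case False
    have r: "reversepath p \<in> loops_at W b" using p by (rule loops_at_reversepath)
    have "winding_number (f \<circ> reversepath p) 0 = of_nat (nat (- z))"
      using winding_number_reversepath[OF fp(1,2)] z False by (simp add: path_compose_reversepath)
    then have "loop_class Y (reversepath p) \<in> generate ?G {loop_class Y l}" using *[OF r] pow by simp
    then have "inv\<^bsub>?G\<^esub> loop_class Y (reversepath p) \<in> generate ?G {loop_class Y l}"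
      using gsub by (rule subgroup.m_inv_closed[rotated])
    moreover have "inv\<^bsub>?G\<^esub> loop_class Y (reversepath p) = loop_class Y p"
      using inv_loop_class[OF bY, of "reversepath p"] r sub by auto
    ultimately show ?thesis by simp
  qed
qed

text \<open>Equality of the directions of \<open>z ^ n\<close> and \<open>w ^ m\<close>, in a form that is polynomial in \<open>z\<close>, \<open>w\<close> and their norms and so
  visibly continuous. It also holds if \<open>z\<close> or \<open>w\<close> is zero and the exponents are positive.\<close>
definition aligned :: "nat \<Rightarrow> nat \<Rightarrow> complex \<Rightarrow> complex \<Rightarrow> bool" where
  "aligned m n z w \<longleftrightarrow> z ^ n * of_real (norm w ^ m) = w ^ m * of_real (norm z ^ n)"

text \<open>A neighbourhood of the circle \<open>z = 0\<close> that shrinks onto it by scaling \<open>z\<close>. In each direction of \<open>z\<close> that is aligned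
  with \<open>w\<close>, the ray is cut off from the point where it meets the cone \<open>norm z = norm w\<close> over the torus knot.\<close>
definition solid_torus :: "nat \<Rightarrow> nat \<Rightarrow> (complex \<times> complex) set" where
  "solid_torus m n = {(z, w). w \<noteq> 0 \<and> \<not> (norm w \<le> norm z \<and> aligned m n z w)}"

definition opposite_torus :: "nat \<Rightarrow> nat \<Rightarrow> (complex \<times> complex) set" where
  "opposite_torus m n = prod.swap -` solid_torus n m"

lemma aligned_swap: "aligned n m w z \<longleftrightarrow> aligned m n z w"
  by (auto simp: aligned_def)

lemma opposite_torus_iff: "(z, w) \<in> opposite_torus m n \<longleftrightarrow> z \<noteq> 0 \<and> \<not> (norm z \<le> norm w \<and> aligned m n z w)"
  by (simp add: opposite_torus_def solid_torus_def aligned_swap)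

lemma intersection_iff: "(z, w) \<in> solid_torus m n \<inter> opposite_torus m n \<longleftrightarrow> z \<noteq> 0 \<and> w \<noteq> 0 \<and> \<not> aligned m n z w"
  by (auto simp: opposite_torus_iff solid_torus_def)

lemma open_solid_torus: "open (solid_torus m n)"
proof -
  have "solid_torus m n = {p. snd p \<noteq> 0} \<inter> ({p. norm (fst p) < norm (snd p)} \<union>
     {p. fst p ^ n * of_real (norm (snd p) ^ m) \<noteq> snd p ^ m * of_real (norm (fst p) ^ n)})"
    by (auto simp: solid_torus_def aligned_def)
  moreover have "open \<dots>"
    by (intro open_Int open_Un open_Collect_less open_Collect_neq continuous_intros)
  ultimately show ?thesis by simp
qed

lemma open_opposite_torus: "open (opposite_torus m n)"
  unfolding opposite_torus_def by (intro open_vimage open_solid_torus continuous_on_swap)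

lemma solid_torus_scale:
  assumes "n > 0" "(z, w) \<in> solid_torus m n" "0 \<le> s" "s \<le> 1"
  shows "(of_real s * z, w) \<in> solid_torus m n"
proof -
  have "s * norm z \<le> norm z" using assms by (simp add: mult_left_le_one_le)
  moreover have "aligned m n z w" if "aligned m n (of_real s * z) w" "s \<noteq> 0"
    using that assms(3) by (simp add: aligned_def power_mult_distrib norm_mult)
  ultimately show ?thesis using assms
    by (cases "s = 0") (auto simp: solid_torus_def norm_mult)
qed

lemma path_connected_solid_torus:
  assumes "n > 0"
  shows "path_connected (solid_torus m n)"
  unfolding path_connected_component
proof (intro ballI)
  have core: "path_component (solid_torus m n) p (0, snd p)" if "p \<in> solid_torus m n" for p
  proof (rule path_component_linepath)
    show "closed_segment p (0, snd p) \<subseteq> solid_torus m n"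
    proof
      fix v assume "v \<in> closed_segment p (0, snd p)"
      then obtain u where u: "0 \<le> u" "u \<le> 1" "v = (1 - u) *\<^sub>R p + u *\<^sub>R (0, snd p)" by (auto simp: in_segment)
      then have "v = (of_real (1 - u) * fst p, snd p)"
        by (cases p) (auto simp: scaleR_conv_of_real algebra_simps)
      then show "v \<in> solid_torus m n" using solid_torus_scale[OF assms, of "fst p" "snd p" m "1 - u"] u that by simp
    qed
  qed
  fix p q assume pq: "p \<in> solid_torus m n" "q \<in> solid_torus m n"
  have "path_connected (Pair (0::complex) ` (- {0::complex}))"
    by (intro path_connected_continuous_image continuous_intros path_connected_punctured_universe) simp
  moreover have "Pair 0 ` (- {0}) \<subseteq> solid_torus m n" by (auto simp: solid_torus_def)
  moreover have "(0, snd p) \<in> Pair 0 ` (- {0})" "(0, snd q) \<in> Pair 0 ` (- {0})"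
    using pq by (auto simp: solid_torus_def)
  ultimately have "path_component (solid_torus m n) (0, snd p) (0, snd q)"
    unfolding path_connected_component using path_component_of_subset by blast
  with core[OF pq(1)] core[OF pq(2)] show "path_component (solid_torus m n) p q"
    by (meson path_component_sym path_component_trans)
qed

lemma snd_solid_torus: "continuous_on (solid_torus m n) snd" "0 \<notin> snd ` solid_torus m n"
  by (auto intro: continuous_intros simp: solid_torus_def)

text \<open>Scaling \<open>z\<close> to zero moves the loop into the punctured \<open>w\<close>-line, where winding numbers decide contractibility.\<close>
lemma solid_torus_null_loop:
  assumes n: "n > 0" and p: "p \<in> loops_at (solid_torus m n) b" and wn: "winding_number (snd \<circ> p) 0 = 0"
  shows "homotopic_loops (solid_torus m n) p (linepath (0, snd b) (0, snd b))"
proof -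
  have pp: "path p" "path_image p \<subseteq> solid_torus m n" "p 0 = b" "p 1 = b"
    using p by (auto simp: loops_at_def pathstart_def pathfinish_def)
  have pt: "p t \<in> solid_torus m n" if "t \<in> {0..1}" for t using pp(2) that unfolding path_image_def by blast
  have "homotopic_loops (solid_torus m n) p (Pair 0 \<circ> (snd \<circ> p))"
    unfolding homotopic_loops
  proof (intro exI conjI ballI)
    let ?h = "\<lambda>x. (of_real (1 - fst x) * fst (p (snd x)), snd (p (snd x)))"
    have "continuous_on ({0..1} \<times> {0..1}) (\<lambda>x::real\<times>real. p (snd x))"
      using pp(1) unfolding path_def by (rule continuous_on_compose2) (auto intro: continuous_intros)
    then show "continuous_on ({0..1} \<times> {0..1}) ?h" by (intro continuous_intros)
    show "?h \<in> {0..1} \<times> {0..1} \<rightarrow> solid_torus m n"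
    proof
      fix x :: "real \<times> real" assume x: "x \<in> {0..1} \<times> {0..1}"
      then have "p (snd x) \<in> solid_torus m n" by (intro pt) auto
      then show "?h x \<in> solid_torus m n" using x by (intro solid_torus_scale[OF n]) auto
    qed
  qed (auto simp: pathfinish_def pathstart_def pp)
  moreover have "homotopic_loops (solid_torus m n) (Pair 0 \<circ> (snd \<circ> p)) (Pair 0 \<circ> (linepath (snd b) (snd b)))"
  proof (rule homotopic_loops_continuous_image)
    have "path (snd \<circ> p)" "0 \<notin> path_image (snd \<circ> p)"
      using winding_compose(1)[OF snd_solid_torus pp(1,2)] by auto
    then have "homotopic_paths (- {0}) (snd \<circ> p) (linepath (snd b) (snd b))"
      using winding_number_homotopic_paths_null_explicit_eq[of "snd \<circ> p" 0] wn pp(3) by (simp add: pathstart_def)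
    then show "homotopic_loops (- {0}) (snd \<circ> p) (linepath (snd b) (snd b))"
      using pp by (intro homotopic_paths_imp_homotopic_loops) (auto simp: pathfinish_def pathstart_def linepath_refl)
    show "continuous_on (- {0}) (Pair (0::complex) :: complex \<Rightarrow> _)" by (intro continuous_intros)
    show "Pair 0 \<in> - {0} \<rightarrow> solid_torus m n" by (auto simp: solid_torus_def)
  qed
  ultimately show ?thesis
    using homotopic_loops_trans by (fastforce simp: linepath_refl o_def)
qed

lemma solid_torus_loops_homotopic:
  assumes n: "n > 0" and p: "p \<in> loops_at (solid_torus m n) b" and q: "q \<in> loops_at (solid_torus m n) b"
    and wn: "winding_number (snd \<circ> p) 0 = winding_number (snd \<circ> q) 0"
  shows "homotopic_paths (solid_torus m n) p q"
proof (rule homotopic_paths_loop_parts)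
  have r: "p +++ reversepath q \<in> loops_at (solid_torus m n) b"
    using p q by (intro loops_at_join loops_at_reversepath)
  have "winding_number (snd \<circ> (p +++ reversepath q)) 0 = winding_number (snd \<circ> p) 0 + winding_number (snd \<circ> reversepath q) 0"
    using p q by (intro winding_compose_join[OF snd_solid_torus]) (auto simp: loops_at_def)
  also have "winding_number (snd \<circ> reversepath q) 0 = - winding_number (snd \<circ> q) 0"
    unfolding path_compose_reversepath
    using winding_compose(1)[OF snd_solid_torus, of q] q by (intro winding_number_reversepath) (auto simp: loops_at_def)
  finally have "winding_number (snd \<circ> (p +++ reversepath q)) 0 = 0" by (simp only: wn add.right_inverse)
  then show "homotopic_loops (solid_torus m n) (p +++ reversepath q) (linepath (0, snd b) (0, snd b))"
    by (rule solid_torus_null_loop[OF n r])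
  show "path q" using q by (simp add: loops_at_def)
qed

lemma solid_torus_core_loop:
  assumes n: "n > 0" and b: "b \<in> solid_torus m n"
  shows "\<exists>l\<in>loops_at (solid_torus m n) b. winding_number (snd \<circ> l) 0 = 1"
proof -
  obtain z w where zw: "b = (z, w)" "w \<noteq> 0" using b by (auto simp: solid_torus_def)
  define c where "c t = (0::complex, exp (2 * of_real pi * \<i> * of_real t + Ln w))" for t
  define g where "g = linepath b (0, w)"
  have c: "path c" "path_image c \<subseteq> solid_torus m n" "pathstart c = (0, w)" "pathfinish c = (0, w)"
    using zw by (auto simp: c_def path_def path_image_def pathstart_def pathfinish_def solid_torus_def exp_add
        intro!: continuous_intros)
  have g: "path g" "path_image g \<subseteq> solid_torus m n" "pathstart g = b" "pathfinish g = (0, w)"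
  proof -
    show "path_image g \<subseteq> solid_torus m n"
    proof
      fix v assume "v \<in> path_image g"
      then obtain u where u: "0 \<le> u" "u \<le> 1" "v = (1 - u) *\<^sub>R b + u *\<^sub>R (0, w)" by (auto simp: g_def in_segment)
      then have "v = (of_real (1 - u) * z, w)"
        using zw by (auto simp: scaleR_conv_of_real algebra_simps)
      then show "v \<in> solid_torus m n" using solid_torus_scale[OF n, of z w m "1 - u"] u b zw by simp
    qed
  qed (auto simp: g_def)
  have sg: "snd \<circ> g = linepath w w"
    by (auto simp: fun_eq_iff g_def zw linepath_def scaleR_conv_of_real algebra_simps)
  have "winding_number (exp \<circ> (\<lambda>t. 2 * of_real pi * \<i> * of_real t + Ln w)) 0 = 1"
    by (subst winding_number_compose_exp) (auto simp: path_def pathfinish_def pathstart_def intro!: continuous_intros)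
  moreover have "snd \<circ> c = exp \<circ> (\<lambda>t. 2 * of_real pi * \<i> * of_real t + Ln w)" by (auto simp: c_def)
  ultimately have sc: "winding_number (snd \<circ> c) 0 = 1" by simp
  let ?l = "g +++ (c +++ reversepath g)"
  have "?l \<in> loops_at (solid_torus m n) b" using c g by (auto simp: loops_at_def path_image_join)
  moreover have "winding_number (snd \<circ> ?l) 0 = winding_number (snd \<circ> g) 0 + (winding_number (snd \<circ> c) 0 + winding_number (snd \<circ> reversepath g) 0)"
    using c g by (simp add: winding_compose_join[OF snd_solid_torus] path_image_join)
  moreover have "winding_number (snd \<circ> g) 0 = 0" "winding_number (snd \<circ> reversepath g) 0 = 0"
    unfolding path_compose_reversepath sg using zw(2) by simp_all
  ultimately show ?thesis using sc by (intro bexI[of _ ?l]) auto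
qed

lemma fst_opposite_torus: "continuous_on (opposite_torus m n) fst" "0 \<notin> fst ` opposite_torus m n"
  by (auto intro: continuous_intros simp: opposite_torus_iff)

lemma opposite_torus_image: "opposite_torus m n = prod.swap ` solid_torus n m"
  by (force simp: opposite_torus_def)

lemma loops_at_opposite: "p \<in> loops_at (opposite_torus m n) b \<Longrightarrow> prod.swap \<circ> p \<in> loops_at (solid_torus n m) (prod.swap b)"
  by (auto simp: loops_at_def opposite_torus_def pathstart_compose pathfinish_compose path_image_compose
      intro!: path_continuous_image continuous_on_swap)

lemma path_connected_opposite_torus: "m > 0 \<Longrightarrow> path_connected (opposite_torus m n)"
  unfolding opposite_torus_image
  by (intro path_connected_continuous_image path_connected_solid_torus continuous_on_swap)

lemma opposite_torus_loops_homotopic: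
  assumes m: "m > 0" and p: "p \<in> loops_at (opposite_torus m n) b" and q: "q \<in> loops_at (opposite_torus m n) b"
    and wn: "winding_number (fst \<circ> p) 0 = winding_number (fst \<circ> q) 0"
  shows "homotopic_paths (opposite_torus m n) p q"
proof -
  have "snd \<circ> (prod.swap \<circ> p) = fst \<circ> p" for p :: "real \<Rightarrow> complex \<times> complex" by auto
  then have "homotopic_paths (solid_torus n m) (prod.swap \<circ> p) (prod.swap \<circ> q)"
    using solid_torus_loops_homotopic[OF m loops_at_opposite[OF p] loops_at_opposite[OF q]] wn by simp
  then have "homotopic_paths (opposite_torus m n) (prod.swap \<circ> (prod.swap \<circ> p)) (prod.swap \<circ> (prod.swap \<circ> q))"
    by (rule homotopic_paths_continuous_image) (auto simp: opposite_torus_def intro: continuous_on_swap)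
  then show ?thesis by (simp add: o_assoc[symmetric] o_def)
qed

lemma opposite_torus_core_loop:
  assumes m: "m > 0" and b: "b \<in> opposite_torus m n"
  shows "\<exists>l\<in>loops_at (opposite_torus m n) b. winding_number (fst \<circ> l) 0 = 1"
proof -
  obtain l where l: "l \<in> loops_at (solid_torus n m) (prod.swap b)" "winding_number (snd \<circ> l) 0 = 1"
    using solid_torus_core_loop[OF m, of "prod.swap b" n] b by (auto simp: opposite_torus_def)
  have "prod.swap \<circ> l \<in> loops_at (opposite_torus m n) b"
    using l(1) by (auto simp: loops_at_def opposite_torus_def pathstart_compose pathfinish_compose path_image_compose
      intro!: path_continuous_image continuous_on_swap)
  moreover have "fst \<circ> (prod.swap \<circ> l) = snd \<circ> l" by auto
  ultimately show ?thesis using l(2) by (intro bexI[of _ "prod.swap \<circ> l"]) simp_all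
qed

section \<open>Homomorphisms out of the group of the exterior\<close>

abbreviation (input) two_pi_i :: complex where "two_pi_i \<equiv> 2 * of_real pi * \<i>"

lemma exp_two_pi_i_eq_1:
  assumes "exp (two_pi_i * x) = 1"
  shows "x \<in> \<int>"
proof -
  from assms obtain k :: int where k: "Re (two_pi_i * x) = 0" "Im (two_pi_i * x) = of_int (2 * k) * pi"
    by (auto simp: exp_eq_1)
  then have "x = of_int k" by (simp add: complex_eq_iff)
  then show ?thesis by simp
qed

text \<open>Both the winding number and the difference of the logarithms measure the quotient of the end points.\<close>
lemma winding_minus_log_integer:
  assumes "path c" "0 \<notin> path_image c" "exp (two_pi_i * a) = pathstart c" "exp (two_pi_i * a') = pathfinish c"
  shows "winding_number c 0 - (a' - a) \<in> \<int>"
proof (rule exp_two_pi_i_eq_1)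
  have "pathfinish c = exp (two_pi_i * winding_number c 0) * pathstart c"
    using winding_number_exp_2pi[OF assms(1,2)] by simp
  then have "exp (two_pi_i * a') = exp (two_pi_i * winding_number c 0) * exp (two_pi_i * a)"
    using assms by simp
  then show "exp (two_pi_i * (winding_number c 0 - (a' - a))) = 1"
    by (simp add: right_diff_distrib exp_diff)
qed

text \<open>A logarithm of \<open>z ^ n / w ^ m\<close> on the intersection of the tori, where this quotient avoids the nonnegative reals.\<close>
definition slit_log :: "nat \<Rightarrow> nat \<Rightarrow> complex \<times> complex \<Rightarrow> complex" where
  "slit_log m n v = Ln (- (fst v ^ n / snd v ^ m)) + of_real pi * \<i>"

lemma exp_slit_log:
  assumes "v \<in> solid_torus m n \<inter> opposite_torus m n"
  shows "- (fst v ^ n / snd v ^ m) \<notin> \<real>\<^sub>\<le>\<^sub>0" "exp (slit_log m n v) = fst v ^ n / snd v ^ m" "fst v \<noteq> 0" "snd v \<noteq> 0"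
proof -
  obtain z w where v: "v = (z, w)" by force
  then have zw: "z \<noteq> 0" "w \<noteq> 0" "\<not> aligned m n z w" using assms intersection_iff by blast+
  show "- (fst v ^ n / snd v ^ m) \<notin> \<real>\<^sub>\<le>\<^sub>0"
  proof
    assume "- (fst v ^ n / snd v ^ m) \<in> \<real>\<^sub>\<le>\<^sub>0"
    then have "z ^ n / w ^ m \<in> \<real>\<^sub>\<ge>\<^sub>0" using v by simp
    then obtain t where t: "t \<ge> 0" "z ^ n / w ^ m = of_real t" by (rule nonneg_Reals_cases) simp
    from arg_cong[OF t(2), of norm] have "norm z ^ n / norm w ^ m = t" using t(1) by (simp add: norm_divide norm_power)
    then have "z ^ n / w ^ m = of_real (norm z ^ n / norm w ^ m)" using t(2) by simp
    then have "aligned m n z w" using zw by (simp add: aligned_def field_simps)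
    then show False using zw by blast
  qed
  show "exp (slit_log m n v) = fst v ^ n / snd v ^ m"
    using v zw by (simp add: slit_log_def exp_add)
  show "fst v \<noteq> 0" "snd v \<noteq> 0" using v zw by auto
qed

text \<open>Along a path, logarithms of \<open>z\<close> and \<open>w\<close> can be continued, and \<open>n\<close> times the first minus \<open>m\<close> times the second differs
  from the single-valued logarithm of \<open>z ^ n / w ^ m\<close> by a constant.\<close>
lemma winding_numbers_in_intersection:
  assumes p: "path p" "path_image p \<subseteq> solid_torus m n \<inter> opposite_torus m n"
  shows "two_pi_i * (of_nat n * winding_number (fst \<circ> p) 0 - of_nat m * winding_number (snd \<circ> p) 0) =
    slit_log m n (p 1) - slit_log m n (p 0)"
proof -
  have pt: "p t \<in> solid_torus m n \<inter> opposite_torus m n" if "t \<in> {0..1}" for t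
    using p(2) that unfolding path_image_def by blast
  have c: "path (fst \<circ> p) \<and> 0 \<notin> path_image (fst \<circ> p)" "path (snd \<circ> p) \<and> 0 \<notin> path_image (snd \<circ> p)"
    using winding_compose(1)[OF fst_opposite_torus p(1)] winding_compose(1)[OF snd_solid_torus p(1)] p(2) by blast+
  obtain f where f: "path f" "pathfinish f - pathstart f = two_pi_i * winding_number (fst \<circ> p) 0"
    "\<And>t. t \<in> {0..1} \<Longrightarrow> (fst \<circ> p) t = 0 + exp (f t)"
    using winding_number_as_continuous_log[of "fst \<circ> p" 0] c(1) by metis
  obtain g where g: "path g" "pathfinish g - pathstart g = two_pi_i * winding_number (snd \<circ> p) 0"
    "\<And>t. t \<in> {0..1} \<Longrightarrow> (snd \<circ> p) t = 0 + exp (g t)"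
    using winding_number_as_continuous_log[of "snd \<circ> p" 0] c(2) by metis
  define r where "r t = of_nat n * f t - of_nat m * g t - slit_log m n (p t)" for t
  have "continuous_on {0..1} p" using p(1) by (simp add: path_def)
  then have "continuous_on {0..1} (\<lambda>t. slit_log m n (p t))"
    unfolding slit_log_def using exp_slit_log[OF pt] by (intro continuous_intros) auto
  then have "path r" using f(1) g(1) unfolding path_def r_def by (intro continuous_intros)
  have "exp (r t) = 1" if "t \<in> {0..1}" for t
  proof -
    have "exp (of_nat n * f t) = fst (p t) ^ n" "exp (of_nat m * g t) = snd (p t) ^ m"
      using f(3)[OF that] g(3)[OF that] by (simp_all add: exp_of_nat_mult)
    then show ?thesis using exp_slit_log[OF pt[OF that]] by (simp add: r_def exp_diff)
  qed
  then have "winding_number (exp \<circ> r) 0 = winding_number (\<lambda>t. 1) 0"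
    by (intro winding_number_cong) auto
  then have "pathfinish r - pathstart r = 0"
    using winding_number_compose_exp[OF \<open>path r\<close>] by (simp add: winding_number_zero_const)
  then show ?thesis using f(2) g(2) by (simp add: r_def pathfinish_def pathstart_def algebra_simps)
qed

lemma coprime_combination:
  assumes "coprime m n"
  shows "\<exists>i j. int n * i - int m * j = e"
proof -
  from bezout_int[of "int n" "int m"] obtain u t where "u * int n + t * int m = 1"
    using assms by (auto simp: gcd.commute coprime_iff_gcd_eq_1)
  then have "(u * int n + t * int m) * e = e" by simp
  then have "int n * (u * e) - int m * (- t * e) = e" by (simp add: algebra_simps)
  then show ?thesis by blast
qed

text \<open>Pointwise logarithms \<open>a\<close> of \<open>w\<close> and \<open>b\<close> of \<open>z\<close> are free up to integers, and coprimality makes every integer a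
  combination of these ambiguities.\<close>
lemma compatible_logarithms:
  assumes "coprime m n"
  shows "\<exists>a b. (snd v \<noteq> 0 \<longrightarrow> exp (two_pi_i * a) = snd v) \<and> (fst v \<noteq> 0 \<longrightarrow> exp (two_pi_i * b) = fst v) \<and>
    (v \<in> solid_torus m n \<inter> opposite_torus m n \<longrightarrow> two_pi_i * (of_nat n * b - of_nat m * a) = slit_log m n v)"
proof -
  define a0 where "a0 = Ln (snd v) / two_pi_i"
  define b0 where "b0 = Ln (fst v) / two_pi_i"
  have ab: "snd v \<noteq> 0 \<Longrightarrow> exp (two_pi_i * a0) = snd v" "fst v \<noteq> 0 \<Longrightarrow> exp (two_pi_i * b0) = fst v"
    by (simp_all add: a0_def b0_def)
  show ?thesis
  proof (cases "v \<in> solid_torus m n \<inter> opposite_torus m n")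
    case True
    note L = exp_slit_log[OF True]
    have "exp (two_pi_i * (slit_log m n v / two_pi_i - (of_nat n * b0 - of_nat m * a0))) = 1"
    proof -
      have "exp (of_nat n * (two_pi_i * b0)) = fst v ^ n" "exp (of_nat m * (two_pi_i * a0)) = snd v ^ m"
        unfolding exp_of_nat_mult using ab L(3,4) by simp_all
      moreover have "two_pi_i * (slit_log m n v / two_pi_i - (of_nat n * b0 - of_nat m * a0)) =
         slit_log m n v - (of_nat n * (two_pi_i * b0) - of_nat m * (two_pi_i * a0))" by (simp add: algebra_simps)
      ultimately show ?thesis using L by (simp only: exp_diff) simp
    qed
    from exp_two_pi_i_eq_1[OF this] obtain e :: int where
      e: "slit_log m n v / two_pi_i = of_nat n * b0 - of_nat m * a0 + of_int e" by (auto elim!: Ints_cases simp: diff_eq_eq add.commute)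
    obtain i j where ij: "int n * i - int m * j = e"
      using coprime_combination[OF assms] by blast
    have per: "exp (two_pi_i * (x + of_int k)) = exp (two_pi_i * x)" for x k
    proof -
      have "exp (two_pi_i * of_int k) = 1" using exp_integer_2pi[of "of_int k"] by (simp add: mult_ac)
      then show ?thesis by (simp add: distrib_left exp_add)
    qed
    have "of_nat n * (b0 + of_int i) - of_nat m * (a0 + of_int j) = of_nat n * b0 - of_nat m * a0 + of_int (int n * i - int m * j)"
      by (simp add: algebra_simps)
    then have "of_nat n * (b0 + of_int i) - of_nat m * (a0 + of_int j) = slit_log m n v / two_pi_i"
      unfolding ij e .
    then have "two_pi_i * (of_nat n * (b0 + of_int i) - of_nat m * (a0 + of_int j)) = slit_log m n v" by simp
    then show ?thesis using ab per by (intro exI[of _ "a0 + of_int j"] exI[of _ "b0 + of_int i"]) simp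
  qed (use ab in blast)
qed

text \<open>For a path in the first torus the increment of the continued logarithm of \<open>w\<close> minus that of a fixed pointwise, possibly
  discontinuous, logarithm is an integer \<open>k\<close>, and the path is sent to \<open>X ^ k\<close>; similarly with \<open>z\<close> and \<open>Y\<close> for the second torus. For
  the compatible choice of logarithms, the two integers of a path in the intersection are \<open>n * j\<close> and \<open>m * j\<close> for the
  same \<open>j\<close>, so the relation between \<open>X\<close> and \<open>Y\<close> makes the two rules agree.\<close>
theorem holonomy_representation:
  fixes H (structure)
  assumes "group H" and XY: "X \<in> carrier H" "Y \<in> carrier H" "X [^] n = Y [^] m"
    and mn: "coprime m n" "m > 0" "n > 0"
    and b: "b \<in> solid_torus m n \<inter> opposite_torus m n"
  shows "\<exists>\<phi>\<in>hom (fundamental_group (solid_torus m n \<union> opposite_torus m n) b) H.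
    (\<forall>l\<in>loops_at (solid_torus m n) b. winding_number (snd \<circ> l) 0 = 1 \<longrightarrow>
       \<phi> (loop_class (solid_torus m n \<union> opposite_torus m n) l) = X) \<and>
    (\<forall>l\<in>loops_at (opposite_torus m n) b. winding_number (fst \<circ> l) 0 = 1 \<longrightarrow>
       \<phi> (loop_class (solid_torus m n \<union> opposite_torus m n) l) = Y)"
proof -
  interpret group H by fact
  let ?U = "solid_torus m n" and ?V = "opposite_torus m n"
  \<comment> \<open>Pointwise logarithms of both coordinates, chosen without regard to continuity.\<close>
  obtain \<alpha> \<beta> where \<alpha>: "\<And>v. snd v \<noteq> 0 \<Longrightarrow> exp (two_pi_i * \<alpha> v) = snd v"
    and \<beta>: "\<And>v. fst v \<noteq> 0 \<Longrightarrow> exp (two_pi_i * \<beta> v) = fst v"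
    and \<alpha>\<beta>: "\<And>v. v \<in> ?U \<inter> ?V \<Longrightarrow> two_pi_i * (of_nat n * \<beta> v - of_nat m * \<alpha> v) = slit_log m n v"
    using compatible_logarithms[OF mn(1)] by metis
  define kU where "kU p = \<lfloor>Re (winding_number (snd \<circ> p) 0 - (\<alpha> (p 1) - \<alpha> (p 0)))\<rfloor>" for p
  define kV where "kV p = \<lfloor>Re (winding_number (fst \<circ> p) 0 - (\<beta> (p 1) - \<beta> (p 0)))\<rfloor>" for p
  have ends: "p 0 \<in> W" "p 1 \<in> W" if "path_image p \<subseteq> W" for p :: "real \<Rightarrow> complex \<times> complex" and W
    using that by (auto simp: path_image_def)
  have kU: "of_int (kU p) = winding_number (snd \<circ> p) 0 - (\<alpha> (p 1) - \<alpha> (p 0))" if "path p" "path_image p \<subseteq> ?U" for p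
  proof -
    have "winding_number (snd \<circ> p) 0 - (\<alpha> (p 1) - \<alpha> (p 0)) \<in> \<int>"
      using winding_compose(1)[OF snd_solid_torus that] ends[OF that(2)] snd_solid_torus(2)[of m n]
      by (intro winding_minus_log_integer) (auto simp: pathstart_def pathfinish_def intro!: \<alpha>)
    then obtain z where z: "winding_number (snd \<circ> p) 0 - (\<alpha> (p 1) - \<alpha> (p 0)) = of_int z" by (rule Ints_cases)
    then have "kU p = z" unfolding kU_def z by simp
    then show ?thesis using z by simp
  qed
  have kV: "of_int (kV p) = winding_number (fst \<circ> p) 0 - (\<beta> (p 1) - \<beta> (p 0))" if "path p" "path_image p \<subseteq> ?V" for p
  proof -
    have "winding_number (fst \<circ> p) 0 - (\<beta> (p 1) - \<beta> (p 0)) \<in> \<int>"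
      using winding_compose(1)[OF fst_opposite_torus that] ends[OF that(2)] fst_opposite_torus(2)[of m n]
      by (intro winding_minus_log_integer) (auto simp: pathstart_def pathfinish_def intro!: \<beta>)
    then obtain z where z: "winding_number (fst \<circ> p) 0 - (\<beta> (p 1) - \<beta> (p 0)) = of_int z" by (rule Ints_cases)
    then have "kV p = z" unfolding kV_def z by simp
    then show ?thesis using z by simp
  qed
  have kU_join: "kU (p +++ q) = kU p + kU q"
    if "path p" "path_image p \<subseteq> ?U" "path q" "path_image q \<subseteq> ?U" "pathfinish p = pathstart q" for p q
  proof -
    have "path (p +++ q)" "path_image (p +++ q) \<subseteq> ?U" using that by (auto simp: path_image_join)
    from kU[OF this] have "(of_int (kU (p +++ q)) :: complex) = of_int (kU p + kU q)"
      using kU[OF that(1,2)] kU[OF that(3,4)] winding_compose_join[OF snd_solid_torus that] that(5)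
      by (simp add: joinpaths_def pathstart_def pathfinish_def)
    then show ?thesis by (simp only: of_int_eq_iff)
  qed
  have kV_join: "kV (p +++ q) = kV p + kV q"
    if "path p" "path_image p \<subseteq> ?V" "path q" "path_image q \<subseteq> ?V" "pathfinish p = pathstart q" for p q
  proof -
    have "path (p +++ q)" "path_image (p +++ q) \<subseteq> ?V" using that by (auto simp: path_image_join)
    from kV[OF this] have "(of_int (kV (p +++ q)) :: complex) = of_int (kV p + kV q)"
      using kV[OF that(1,2)] kV[OF that(3,4)] winding_compose_join[OF fst_opposite_torus that] that(5)
      by (simp add: joinpaths_def pathstart_def pathfinish_def)
    then show ?thesis by (simp only: of_int_eq_iff)
  qed
  have kU_hom: "kU p = kU q" if "homotopic_paths ?U p q" for p q
    using winding_compose(2)[OF snd_solid_torus that] homotopic_paths_imp_pathstart[OF that] homotopic_paths_imp_pathfinish[OF that]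
    by (simp add: kU_def pathstart_def pathfinish_def)
  have kV_hom: "kV p = kV q" if "homotopic_paths ?V p q" for p q
    using winding_compose(2)[OF fst_opposite_torus that] homotopic_paths_imp_pathstart[OF that] homotopic_paths_imp_pathfinish[OF that]
    by (simp add: kV_def pathstart_def pathfinish_def)
  have agree: "X [^] kU p = Y [^] kV p" if p: "path p" "path_image p \<subseteq> ?U" "path_image p \<subseteq> ?V" for p
  proof -
    have pUV: "path_image p \<subseteq> ?U \<inter> ?V" using p by blast
    have "two_pi_i * of_int (int n * kV p - int m * kU p) =
       two_pi_i * (of_nat n * winding_number (fst \<circ> p) 0 - of_nat m * winding_number (snd \<circ> p) 0)
       - (two_pi_i * (of_nat n * \<beta> (p 1) - of_nat m * \<alpha> (p 1)) - two_pi_i * (of_nat n * \<beta> (p 0) - of_nat m * \<alpha> (p 0)))"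
      by (simp only: of_int_diff of_int_mult of_int_of_nat_eq kU[OF p(1,2)] kV[OF p(1,3)]) (simp add: algebra_simps)
    also have "\<dots> = 0"
      unfolding winding_numbers_in_intersection[OF p(1) pUV] \<alpha>\<beta>[OF ends(1)[OF pUV]] \<alpha>\<beta>[OF ends(2)[OF pUV]] by simp
    finally have "int n * kV p = int m * kU p" by (simp only: mult_eq_0_iff of_int_eq_0_iff) simp
    moreover have "coprime (int n) (int m)" using mn(1) by (simp add: coprime_commute)
    ultimately have "int n dvd kU p" by (metis coprime_dvd_mult_right_iff dvd_triv_left)
    then obtain j where j: "kU p = int n * j" by (elim dvdE)
    then have "kV p = int m * j" using \<open>int n * kV p = int m * kU p\<close> mn(3) by simp
    then show ?thesis using j XY by (simp add: int_pow_pow[symmetric] int_pow_int)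
  qed
  define h where "h p = (if path_image p \<subseteq> ?U then X [^] kU p else Y [^] kV p)" for p
  have hV: "h p = Y [^] kV p" if "path p" "path_image p \<subseteq> ?V" for p
    using that agree by (simp add: h_def)
  interpret local_holonomy H "{?U, ?V}" h
  proof
    fix W p assume W: "W \<in> {?U, ?V}"
    then show "open W" using open_solid_torus open_opposite_torus by auto
    assume p: "path p" "path_image p \<subseteq> W"
    show "h p \<in> carrier H" using XY by (simp add: h_def)
    fix q assume q: "path q" "path_image q \<subseteq> W" "pathfinish p = pathstart q"
    have j: "path (p +++ q)" "path_image (p +++ q) \<subseteq> W" using p q by (auto simp: path_image_join)
    show "h (p +++ q) = h p \<otimes> h q"
    proof (cases "W = ?U")
      case True
      then show ?thesis using p q j kU_join XY by (simp add: h_def int_pow_mult)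
    next
      case False
      then have "W = ?V" using W by blast
      then show ?thesis using p q j kV_join[of p q] XY hV by (simp add: int_pow_mult)
    qed
  next
    fix W p q assume W: "W \<in> {?U, ?V}" and hom: "homotopic_paths W p q"
    note i = homotopic_paths_imp_path[OF hom] homotopic_paths_imp_subset[OF hom]
    show "h p = h q"
    proof (cases "W = ?U")
      case True
      then show ?thesis using i kU_hom[of p q] hom by (simp add: h_def)
    next
      case False
      then have "W = ?V" using W by blast
      then show ?thesis using i kV_hom[of p q] hom hV by simp
    qed
  qed
  have cover: "\<Union>{?U, ?V} = ?U \<union> ?V" by simp
  have "b \<in> \<Union>{?U, ?V}" using b by simp
  from holonomy_hom[OF this] obtain \<phi> where \<phi>: "\<phi> \<in> hom (fundamental_group (?U \<union> ?V) b) H"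
    "\<And>p. p \<in> loops_at (?U \<union> ?V) b \<Longrightarrow> \<phi> (loop_class (?U \<union> ?V) p) = holonomy p"
    unfolding cover by blast
  show ?thesis
  proof (intro bexI[OF _ \<phi>(1)] conjI ballI impI)
    fix l assume l: "l \<in> loops_at ?U b" "winding_number (snd \<circ> l) 0 = 1"
    then have lp: "path l" "path_image l \<subseteq> ?U" "l 0 = b" "l 1 = b" "l \<in> loops_at (?U \<union> ?V) b"
      by (auto simp: loops_at_def pathstart_def pathfinish_def)
    have "holonomy l = h l" using lp by (intro holonomy_h[of ?U]) auto
    moreover have "kU l = 1" using l lp by (simp add: kU_def)
    ultimately show "\<phi> (loop_class (?U \<union> ?V) l) = X" using \<phi>(2)[OF lp(5)] lp XY by (simp add: h_def)
  next
    fix l assume l: "l \<in> loops_at ?V b" "winding_number (fst \<circ> l) 0 = 1"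
    then have lp: "path l" "path_image l \<subseteq> ?V" "l 0 = b" "l 1 = b" "l \<in> loops_at (?U \<union> ?V) b"
      by (auto simp: loops_at_def pathstart_def pathfinish_def)
    have "holonomy l = h l" using lp by (intro holonomy_h[of ?V]) auto
    moreover have "kV l = 1" using l lp by (simp add: kV_def)
    ultimately show "\<phi> (loop_class (?U \<union> ?V) l) = Y" using \<phi>(2)[OF lp(5)] lp XY hV by simp
  qed
qed

section \<open>A presentation of the group of the exterior\<close>

text \<open>In logarithmic coordinates the intersection is a convex slab, since coprimality allows the argument of
  \<open>z ^ n / w ^ m\<close> to be normalised to lie between \<open>0\<close> and \<open>2 * pi\<close>.\<close>
lemma intersection_exp_image:
  assumes mn: "coprime m n" "m > 0" "n > 0"
  shows "solid_torus m n \<inter> opposite_torus m n =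
    (\<lambda>(u, v). (exp u, exp v)) ` {(u, v). 0 < Im (of_nat n * u - of_nat m * v) \<and> Im (of_nat n * u - of_nat m * v) < 2 * pi}"
    (is "?I = ?E ` ?C")
proof
  have al: "aligned m n (exp u) (exp v) \<longleftrightarrow> exp (\<i> * of_real (Im (of_nat n * u - of_nat m * v))) = 1" for u v
  proof -
    have e: "exp u = of_real (exp (Re u)) * exp (\<i> * of_real (Im u))" for u
      by (metis exp_eq_polar exp_of_real cis_conv_exp)
    have "aligned m n (exp u) (exp v) \<longleftrightarrow> exp (\<i> * of_real (Im u)) ^ n = exp (\<i> * of_real (Im v)) ^ m"
      unfolding aligned_def by (subst (1 2) e) (simp add: power_mult_distrib norm_mult mult_ac)
    also have "\<dots> \<longleftrightarrow> exp (\<i> * of_real (Im u)) ^ n / exp (\<i> * of_real (Im v)) ^ m = 1" by simp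
    also have "exp (\<i> * of_real (Im u)) ^ n / exp (\<i> * of_real (Im v)) ^ m = exp (\<i> * of_real (Im (of_nat n * u - of_nat m * v)))"
      by (simp add: exp_of_nat_mult[symmetric] exp_diff[symmetric] algebra_simps)
    finally show ?thesis .
  qed
  show "?E ` ?C \<subseteq> ?I"
  proof clarify
    fix u v assume uv: "0 < Im (of_nat n * u - of_nat m * v)" "Im (of_nat n * u - of_nat m * v) < 2 * pi"
    have "\<not> aligned m n (exp u) (exp v)"
    proof
      assume "aligned m n (exp u) (exp v)"
      then obtain k :: int where "Im (of_nat n * u - of_nat m * v) = of_int (2 * k) * pi"
        unfolding al exp_eq_1 by auto
      then have k: "Im (of_nat n * u - of_nat m * v) = real_of_int k * (2 * pi)" by simp
      have "0 < real_of_int k * (2 * pi)" "real_of_int k * (2 * pi) < 1 * (2 * pi)"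
        using uv unfolding k by simp_all
      then have "0 < real_of_int k" "real_of_int k < 1"
        by (simp_all only: mult_less_cancel_right zero_less_mult_iff) auto
      then have "0 < k" "k < 1" by simp_all
      then show False by simp
    qed
    then show "(exp u, exp v) \<in> ?I" by (simp only: intersection_iff) simp
  qed
  show "?I \<subseteq> ?E ` ?C"
  proof
    fix p assume p: "p \<in> ?I"
    obtain z w where pz: "p = (z, w)" by force
    then have zw: "z \<noteq> 0" "w \<noteq> 0" "\<not> aligned m n z w" using p intersection_iff by blast+
    define d where "d = Im (of_nat n * Ln z - of_nat m * Ln w)"
    \<comment> \<open>The number of full turns to be removed from the argument \<open>d\<close> of \<open>z ^ n / w ^ m\<close>.\<close>
    define e where "e = \<lfloor>d / (2 * pi)\<rfloor>"
    obtain i j where ij: "int n * i - int m * j = e"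
      using coprime_combination[OF mn(1)] by blast
    define u where "u = Ln z - two_pi_i * of_int i"
    define v where "v = Ln w - two_pi_i * of_int j"
    have per: "exp (x - two_pi_i * of_int k) = exp x" for x k
    proof -
      have "exp (two_pi_i * of_int k) = 1" using exp_integer_2pi[of "of_int k"] by (simp add: mult_ac)
      then show ?thesis by (simp add: exp_diff)
    qed
    have uv: "exp u = z" "exp v = w" using zw per by (simp_all add: u_def v_def)
    have "Im (of_nat n * u - of_nat m * v) = d - 2 * pi * of_int (int n * i - int m * j)"
      by (simp add: u_def v_def d_def algebra_simps)
    then have im: "Im (of_nat n * u - of_nat m * v) = d - 2 * pi * of_int e" unfolding ij .
    have "of_int e \<le> d / (2 * pi)" "d / (2 * pi) < of_int e + 1" by (auto simp: e_def)
    then have "0 \<le> Im (of_nat n * u - of_nat m * v)" "Im (of_nat n * u - of_nat m * v) < 2 * pi"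
      unfolding im by (simp_all add: field_simps)
    moreover have "Im (of_nat n * u - of_nat m * v) \<noteq> 0"
    proof
      assume "Im (of_nat n * u - of_nat m * v) = 0"
      then have "exp (\<i> * of_real (Im (of_nat n * u - of_nat m * v))) = 1" by (simp only: of_real_0) simp
      then have "aligned m n (exp u) (exp v)" by (simp only: al)
      then show False using zw(3) uv by simp
    qed
    ultimately show "p \<in> ?E ` ?C" using uv pz by (intro image_eqI[of _ _ "(u, v)"]) auto
  qed
qed

lemma path_connected_intersection:
  assumes mn: "coprime m n" "m > 0" "n > 0"
  shows "path_connected (solid_torus m n \<inter> opposite_torus m n)"
  unfolding intersection_exp_image[OF assms]
proof (rule path_connected_continuous_image)
  let ?C = "{(u, v). 0 < Im (of_nat n * u - of_nat m * v) \<and> Im (of_nat n * u - of_nat m * v) < 2 * pi}"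
  show "continuous_on ?C (\<lambda>(u, v). (exp u, exp v))" by (auto simp: case_prod_beta intro!: continuous_intros)
  have "linear (\<lambda>p :: complex \<times> complex. Im (of_nat n * fst p - of_nat m * snd p))"
    by (intro linearI) (auto simp: algebra_simps)
  then have "convex ((\<lambda>p :: complex \<times> complex. Im (of_nat n * fst p - of_nat m * snd p)) -` {0<..<2*pi})"
    by (rule convex_linear_vimage) simp
  also have "(\<lambda>p :: complex \<times> complex. Im (of_nat n * fst p - of_nat m * snd p)) -` {0<..<2*pi} = ?C" by auto
  finally show "path_connected ?C" by (rule convex_imp_path_connected)
qed

text \<open>The relation comes from a curve parallel to the knot. It lies in the intersection and has winding numbers \<open>n\<close> and
  \<open>m\<close>, so it represents both \<open>x ^ n\<close> and \<open>y ^ m\<close>.\<close>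
theorem torus_knot_group_presentation:
  assumes mn: "coprime m n" "m > 0" "n > 0" and b: "b \<in> solid_torus m n \<inter> opposite_torus m n"
  defines "G \<equiv> fundamental_group (solid_torus m n \<union> opposite_torus m n) b"
  obtains x y where "x \<in> carrier G" "y \<in> carrier G" "generate G {x, y} = carrier G"
    "x [^]\<^bsub>G\<^esub> n = y [^]\<^bsub>G\<^esub> m"
    "\<And>(H :: 'h monoid) X Y. group H \<Longrightarrow> X \<in> carrier H \<Longrightarrow> Y \<in> carrier H \<Longrightarrow> X [^]\<^bsub>H\<^esub> n = Y [^]\<^bsub>H\<^esub> m \<Longrightarrow>
       \<exists>\<phi>\<in>hom G H. \<phi> x = X \<and> \<phi> y = Y"
proof -
  let ?U = "solid_torus m n" and ?V = "opposite_torus m n"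
  let ?Y = "?U \<union> ?V"
  have bY: "b \<in> ?Y" "b \<in> ?U" "b \<in> ?V" using b by auto
  interpret group G unfolding G_def by (rule group_fundamental_group[OF bY(1)])
  obtain lU where lU: "lU \<in> loops_at ?U b" "winding_number (snd \<circ> lU) 0 = 1"
    using solid_torus_core_loop[OF mn(3) bY(2)] by blast
  obtain lV where lV: "lV \<in> loops_at ?V b" "winding_number (fst \<circ> lV) 0 = 1"
    using opposite_torus_core_loop[OF mn(2) bY(3)] by blast
  define x where "x = loop_class ?Y lU"
  define y where "y = loop_class ?Y lV"
  have xy: "x \<in> carrier G" "y \<in> carrier G"
    using lU lV by (auto simp: x_def y_def G_def fundamental_group_carrier loops_at_def)
  note cU = loops_generated_by_unit_winding[OF _ bY(2) snd_solid_torus solid_torus_loops_homotopic[OF mn(3), where b = b] lU, of ?Y]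
  note cV = loops_generated_by_unit_winding[OF _ bY(3) fst_opposite_torus opposite_torus_loops_homotopic[OF mn(2), where b = b] lV, of ?Y]
  have sub: "subgroup (generate G {x, y}) G" using xy by (intro generate_is_subgroup) auto
  have gen: "generate G {x, y} = carrier G"
  proof
    show "generate G {x, y} \<subseteq> carrier G" using sub by (rule subgroup.subset)
    have "carrier G = generate G (loop_class ?Y ` (loops_at ?U b \<union> loops_at ?V b))"
      unfolding G_def by (intro fundamental_group_generated_by_cover open_solid_torus open_opposite_torus
         path_connected_solid_torus path_connected_opposite_torus path_connected_intersection mn b)
    also have "\<dots> \<subseteq> generate G {x, y}"
    proof (rule generate_subgroup_incl[OF _ sub])
      have "generate G {x} \<subseteq> generate G {x, y}" "generate G {y} \<subseteq> generate G {x, y}"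
        by (auto intro!: mono_generate)
      then show "loop_class ?Y ` (loops_at ?U b \<union> loops_at ?V b) \<subseteq> generate G {x, y}"
        using cU(2) cV(2) unfolding x_def y_def G_def by blast
    qed
    finally show "carrier G \<subseteq> generate G {x, y}" .
  qed
  have rel: "x [^]\<^bsub>G\<^esub> n = y [^]\<^bsub>G\<^esub> m"
  proof -
    obtain u v where uv: "b = (exp u, exp v)" "0 < Im (of_nat n * u - of_nat m * v)" "Im (of_nat n * u - of_nat m * v) < 2 * pi"
      using b unfolding intersection_exp_image[OF mn] by auto
    \<comment> \<open>The orbit of \<open>b\<close> under the circle action with weights \<open>m\<close> and \<open>n\<close>.\<close>
    define c where "c t = (exp (two_pi_i * of_nat m * of_real t + u), exp (two_pi_i * of_nat n * of_real t + v))" for t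
    have per: "exp (two_pi_i * of_nat k + x) = exp x" for x k
    proof -
      have "exp (two_pi_i * of_nat k) = 1" using exp_integer_2pi[of "of_nat k"] by (simp add: mult_ac)
      then show ?thesis by (simp add: exp_add)
    qed
    have "c t \<in> ?U \<inter> ?V" for t
      unfolding intersection_exp_image[OF mn] c_def
      by (rule image_eqI[of _ _ "(two_pi_i * of_nat m * of_real t + u, two_pi_i * of_nat n * of_real t + v)"])
        (use uv in \<open>auto simp: algebra_simps\<close>)
    moreover have "path c" unfolding path_def c_def by (intro continuous_intros)
    moreover have "c 0 = b" "c 1 = b" using uv(1) per[of m u] per[of n v] by (simp_all add: c_def)
    ultimately have c: "c \<in> loops_at ?U b" "c \<in> loops_at ?V b"
      by (auto simp: loops_at_def path_image_def pathstart_def pathfinish_def)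
    have wind: "winding_number (exp \<circ> (\<lambda>t. two_pi_i * of_nat k * of_real t + w)) 0 = of_nat k" for k w
      by (subst winding_number_compose_exp) (auto simp: path_def pathfinish_def pathstart_def intro!: continuous_intros)
    have "snd \<circ> c = exp \<circ> (\<lambda>t. two_pi_i * of_nat n * of_real t + v)"
      "fst \<circ> c = exp \<circ> (\<lambda>t. two_pi_i * of_nat m * of_real t + u)" by (auto simp: c_def)
    then have "winding_number (snd \<circ> c) 0 = of_nat n" "winding_number (fst \<circ> c) 0 = of_nat m"
      using wind by simp_all
    note w = this
    have "loop_class ?Y c = x [^]\<^bsub>G\<^esub> n" unfolding x_def G_def by (rule cU(1)) (use c w in auto)
    moreover have "loop_class ?Y c = y [^]\<^bsub>G\<^esub> m" unfolding y_def G_def by (rule cV(1)) (use c w in auto)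
    ultimately show ?thesis by simp
  qed
  show ?thesis
  proof (rule that[OF xy gen rel])
    fix H :: "'h monoid" and X Y
    assume H: "group H" "X \<in> carrier H" "Y \<in> carrier H" "X [^]\<^bsub>H\<^esub> n = Y [^]\<^bsub>H\<^esub> m"
    from holonomy_representation[OF H mn b] lU lV
    show "\<exists>\<phi>\<in>hom G H. \<phi> x = X \<and> \<phi> y = Y" unfolding G_def x_def y_def by blast
  qed
qed

section \<open>Injections between fundamental groups\<close>

text \<open>It thus suffices to bound the spectrum after an injective homomorphism.\<close>
lemma torsion_spectrum_hom:
  assumes "group G" "group H" "\<phi> \<in> hom G H" "g \<in> carrier G"
  shows "torsion_spectrum G g \<subseteq> torsion_spectrum H (\<phi> g)"
proof
  interpret group_hom G H \<phi> using assms by (simp add: group_hom_def group_hom_axioms_def)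
  fix r assume "r \<in> torsion_spectrum G g"
  then obtain xs where xs: "r \<ge> 1" "length xs = r" "set xs \<subseteq> carrier G"
    "foldr (\<otimes>\<^bsub>G\<^esub>) (map (conj_by G g) xs) \<one>\<^bsub>G\<^esub> = \<one>\<^bsub>G\<^esub>" by (auto simp: torsion_spectrum_def)
  have conj: "conj_by G g x \<in> carrier G" "\<phi> (conj_by G g x) = conj_by H (\<phi> g) (\<phi> x)" if "x \<in> carrier G" for x
    using that assms(4) by (simp_all add: conj_by_def)
  have "\<phi> (foldr (\<otimes>\<^bsub>G\<^esub>) (map (conj_by G g) ys) \<one>\<^bsub>G\<^esub>) = foldr (\<otimes>\<^bsub>H\<^esub>) (map (conj_by H (\<phi> g)) (map \<phi> ys)) \<one>\<^bsub>H\<^esub>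
     \<and> foldr (\<otimes>\<^bsub>G\<^esub>) (map (conj_by G g) ys) \<one>\<^bsub>G\<^esub> \<in> carrier G"
    if "set ys \<subseteq> carrier G" for ys
    using that by (induction ys) (simp_all add: conj)
  from this[OF xs(3)] have "foldr (\<otimes>\<^bsub>H\<^esub>) (map (conj_by H (\<phi> g)) (map \<phi> xs)) \<one>\<^bsub>H\<^esub> = \<one>\<^bsub>H\<^esub>"
    unfolding xs(4) by simp
  moreover have "set (map \<phi> xs) \<subseteq> carrier H" using xs(3) by auto
  ultimately show "r \<in> torsion_spectrum H (\<phi> g)"
    unfolding torsion_spectrum_def using xs(1,2) by (auto intro!: exI[of _ "map \<phi> xs"])
qed

text \<open>Both injections below, by a retraction and by a change of base point, come from maps of loops. They are
  compatible with concatenation only up to homotopy.\<close>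
lemma loop_class_map_hom:
  fixes S :: "'a::real_normed_vector set" and T :: "'b::real_normed_vector set"
  assumes loops: "\<And>p. p \<in> loops_at S x \<Longrightarrow> F p \<in> loops_at T y"
    and homot: "\<And>p q. p \<in> loops_at S x \<Longrightarrow> homotopic_paths S p q \<Longrightarrow> homotopic_paths T (F p) (F q)"
    and join: "\<And>p q. p \<in> loops_at S x \<Longrightarrow> q \<in> loops_at S x \<Longrightarrow> homotopic_paths T (F p +++ F q) (F (p +++ q))"
    and kernel: "\<And>p. p \<in> loops_at S x \<Longrightarrow> homotopic_paths T (F p) (linepath y y) \<Longrightarrow> homotopic_paths S p (linepath x x)"
  shows "\<exists>\<phi>\<in>hom (fundamental_group S x) (fundamental_group T y).
    \<forall>g\<in>carrier (fundamental_group S x). \<phi> g = \<one>\<^bsub>fundamental_group T y\<^esub> \<longrightarrow> g = \<one>\<^bsub>fundamental_group S x\<^esub>"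
proof -
  define \<phi> where "\<phi> C = loop_class T (F (SOME p. p \<in> C))" for C
  have \<phi>: "\<phi> (loop_class S p) = loop_class T (F p)" if p: "p \<in> loops_at S x" for p
  proof -
    have "p \<in> loop_class S p" using p by (simp add: loop_class_def loops_at_def)
    then have "(SOME q. q \<in> loop_class S p) \<in> loop_class S p" by (rule someI[of "\<lambda>q. q \<in> loop_class S p"])
    then have "homotopic_paths T (F p) (F (SOME q. q \<in> loop_class S p))"
      using homot[OF p] by (simp add: loop_class_def)
    then show ?thesis unfolding \<phi>_def by (rule loop_class_eqI[symmetric])
  qed
  have "\<phi> \<in> hom (fundamental_group S x) (fundamental_group T y)"
  proof (rule homI)
    fix A assume "A \<in> carrier (fundamental_group S x)"
    then obtain p where p: "p \<in> loops_at S x" "A = loop_class S p" by (auto simp: fundamental_group_carrier)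
    then show "\<phi> A \<in> carrier (fundamental_group T y)" using \<phi> loops by (auto simp: fundamental_group_carrier)
    fix B assume "B \<in> carrier (fundamental_group S x)"
    then obtain q where q: "q \<in> loops_at S x" "B = loop_class S q" by (auto simp: fundamental_group_carrier)
    show "\<phi> (A \<otimes>\<^bsub>fundamental_group S x\<^esub> B) = \<phi> A \<otimes>\<^bsub>fundamental_group T y\<^esub> \<phi> B"
      using p q \<phi> loops loops_at_join[OF p(1) q(1)] loop_class_eqI[OF join[OF p(1) q(1)]]
      by (simp add: mult_loop_class)
  qed
  moreover have "g = \<one>\<^bsub>fundamental_group S x\<^esub>"
    if g: "g \<in> carrier (fundamental_group S x)" "\<phi> g = \<one>\<^bsub>fundamental_group T y\<^esub>" for g
  proof -
    obtain p where p: "p \<in> loops_at S x" "g = loop_class S p" using g by (auto simp: fundamental_group_carrier)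
    have "homotopic_paths T (F p) (linepath y y)"
      using g(2) p \<phi> loop_class_eq_iff[OF loops[OF p(1)]] by (simp add: fundamental_group_one)
    then show ?thesis using kernel[OF p(1)] p by (simp add: fundamental_group_one loop_class_eqI)
  qed
  ultimately show ?thesis by blast
qed

lemma fundamental_group_retract_injective:
  fixes S :: "'a::real_normed_vector set" and T :: "'b::real_normed_vector set"
  assumes f: "continuous_on S f" "f ` S \<subseteq> T" and r: "continuous_on T r" "r ` T \<subseteq> S" "\<And>x. x \<in> S \<Longrightarrow> r (f x) = x"
    and x: "x \<in> S"
  shows "\<exists>\<phi>\<in>hom (fundamental_group S x) (fundamental_group T (f x)).
    \<forall>g\<in>carrier (fundamental_group S x). \<phi> g = \<one>\<^bsub>fundamental_group T (f x)\<^esub> \<longrightarrow> g = \<one>\<^bsub>fundamental_group S x\<^esub>"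
proof (rule loop_class_map_hom[where F = "\<lambda>p. f \<circ> p"])
  have loops: "f \<circ> p \<in> loops_at T (f x)" if "p \<in> loops_at S x" for p
    using that f by (auto simp: loops_at_def pathstart_compose pathfinish_compose path_image_compose
        intro!: path_continuous_image continuous_on_subset[OF f(1)])
  then show "p \<in> loops_at S x \<Longrightarrow> f \<circ> p \<in> loops_at T (f x)" for p .
  show "homotopic_paths S p q \<Longrightarrow> homotopic_paths T (f \<circ> p) (f \<circ> q)" for p q
    using f by (intro homotopic_paths_continuous_image) auto
  show "homotopic_paths T ((f \<circ> p) +++ (f \<circ> q)) (f \<circ> (p +++ q))" if "p \<in> loops_at S x" "q \<in> loops_at S x" for p q
    unfolding path_compose_join[symmetric] using loops[OF loops_at_join[OF that]] by (simp add: loops_at_def)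
  fix p assume p: "p \<in> loops_at S x" and null: "homotopic_paths T (f \<circ> p) (linepath (f x) (f x))"
  have "homotopic_paths S p (r \<circ> (f \<circ> p))"
  proof (rule homotopic_paths_eq)
    show "path p" "path_image p \<subseteq> S" using p by (simp_all add: loops_at_def)
    fix t :: real assume "t \<in> {0..1}"
    then have "p t \<in> S" using p unfolding loops_at_def path_image_def by blast
    then show "p t = (r \<circ> (f \<circ> p)) t" by (simp add: r(3))
  qed
  also have "homotopic_paths S \<dots> (r \<circ> linepath (f x) (f x))"
    using null r by (intro homotopic_paths_continuous_image) auto
  also have "r \<circ> linepath (f x) (f x) = linepath x x" using r(3)[OF x] by (auto simp: linepath_refl)
  finally show "homotopic_paths S p (linepath x x)" .
qed

lemma fundamental_group_basepoint_change:
  fixes S :: "'a::real_normed_vector set"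
  assumes g: "path g" "path_image g \<subseteq> S" "pathstart g = b" "pathfinish g = x"
  shows "\<exists>\<phi>\<in>hom (fundamental_group S x) (fundamental_group S b).
    \<forall>h\<in>carrier (fundamental_group S x). \<phi> h = \<one>\<^bsub>fundamental_group S b\<^esub> \<longrightarrow> h = \<one>\<^bsub>fundamental_group S x\<^esub>"
proof (rule loop_class_map_hom[where F = "\<lambda>p. g +++ (p +++ reversepath g)"])
  show "p \<in> loops_at S x \<Longrightarrow> g +++ (p +++ reversepath g) \<in> loops_at S b" for p
    using g by (auto simp: loops_at_def path_image_join)
  show "homotopic_paths S (g +++ (p +++ reversepath g)) (g +++ (q +++ reversepath g))"
    if "p \<in> loops_at S x" "homotopic_paths S p q" for p q
    using that g by (intro homotopic_paths_join) (auto simp: loops_at_def)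
  show "homotopic_paths S ((g +++ (p +++ reversepath g)) +++ (g +++ (q +++ reversepath g))) (g +++ ((p +++ q) +++ reversepath g))"
    if "p \<in> loops_at S x" "q \<in> loops_at S x" for p q
    using that g by (intro homotopic_paths_splice) (auto simp: loops_at_def)
  fix p assume p: "p \<in> loops_at S x" and null: "homotopic_paths S (g +++ (p +++ reversepath g)) (linepath b b)"
  have "homotopic_loops S (g +++ (p +++ reversepath g)) p"
    using p g by (intro homotopic_loops_conjugate) (auto simp: loops_at_def)
  moreover have "homotopic_loops S (g +++ (p +++ reversepath g)) (linepath b b)"
    using null g by (intro homotopic_paths_imp_homotopic_loops) auto
  ultimately have "homotopic_loops S p (linepath b b)" using homotopic_loops_sym homotopic_loops_trans by blast
  from homotopic_loops_imp_homotopic_paths_null[OF this] show "homotopic_paths S p (linepath x x)"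
    using p by (simp add: loops_at_def)
qed

section \<open>Torus knots up to ambient isotopy\<close>

text \<open>The complement in the punctured plane \<open>\<complex>\<^sup>2\<close> of the cone over the standard knot. It is invariant under positive scaling and so
  retracts onto the knot complement in the sphere.\<close>
definition exterior :: "nat \<Rightarrow> nat \<Rightarrow> (complex \<times> complex) set" where
  "exterior m n = solid_torus m n \<union> opposite_torus m n"

lemma exterior_iff: "(z, w) \<in> exterior m n \<longleftrightarrow> (z, w) \<noteq> (0, 0) \<and> \<not> (norm z = norm w \<and> aligned m n z w)"
  by (cases "norm z" "norm w" rule: linorder_cases) (auto simp: exterior_def opposite_torus_iff solid_torus_def)

lemma aligned_scale:
  assumes "c > 0"
  shows "aligned m n (c *\<^sub>R z) (c *\<^sub>R w) \<longleftrightarrow> aligned m n z w"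
proof -
  have "aligned m n (c *\<^sub>R z) (c *\<^sub>R w) \<longleftrightarrow>
    of_real (c ^ (n + m)) * (z ^ n * of_real (norm w ^ m)) = of_real (c ^ (n + m)) * (w ^ m * of_real (norm z ^ n))"
    using assms by (simp add: aligned_def scaleR_conv_of_real power_mult_distrib norm_mult power_add mult_ac)
  then show ?thesis using assms by (simp add: aligned_def)
qed

lemma aligned_cis: "aligned m n (cis s) (cis t) \<longleftrightarrow> cis (real n * s) = cis (real m * t)"
  by (simp only: aligned_def norm_cis Complex.DeMoivre power_one of_real_1 mult_1_right)

lemma exterior_scale:
  assumes "c > 0" "v \<in> exterior m n"
  shows "c *\<^sub>R v \<in> exterior m n"
proof -
  obtain z w where v: "v = (z, w)" by force
  show ?thesis using assms unfolding v by (auto simp: exterior_iff aligned_scale)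
qed

lemma standard_torus_knot_disjoint: "standard_torus_knot m n \<inter> exterior m n = {}"
proof -
  have "(1 / sqrt 2) *\<^sub>R (cis (real m * t), cis (real n * t)) \<notin> exterior m n" for t
  proof -
    have "aligned m n ((1 / sqrt 2) *\<^sub>R cis (real m * t)) ((1 / sqrt 2) *\<^sub>R cis (real n * t))"
      by (subst aligned_scale) (simp_all add: aligned_cis mult_ac)
    then show ?thesis by (simp add: exterior_iff)
  qed
  then show ?thesis by (auto simp: standard_torus_knot_def)
qed

text \<open>On the sphere, equal norms force both to be \<open>1 / sqrt 2\<close>. The arguments of \<open>z\<close> and \<open>w\<close> can be shifted by multiples of
  \<open>2 * pi\<close> such that \<open>n\<close> times the first equals \<open>m\<close> times the second; this gives the parameter of the point.\<close>
lemma sphere_minus_exterior: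
  assumes mn: "coprime m n" "m > 0" "n > 0" and v: "v \<in> sphere3" "v \<notin> exterior m n"
  shows "v \<in> standard_torus_knot m n"
proof -
  obtain z w where zw: "v = (z, w)" by force
  have "norm (z, w) = 1" using v zw by simp
  then have n1: "norm z ^ 2 + norm w ^ 2 = 1" by (simp add: norm_Pair)
  then have "(z, w) \<noteq> (0, 0)" by auto
  then have al: "norm z = norm w" "aligned m n z w" using v zw exterior_iff by blast+
  have "norm z ^ 2 = (1 / sqrt 2) ^ 2" using n1 al by (simp add: power_divide)
  then have nz: "norm z = 1 / sqrt 2" by (rule power2_eq_imp_eq) auto
  define a where "a = Arg z"
  define b where "b = Arg w"
  have "z \<noteq> 0" "w \<noteq> 0" using nz al by auto
  then have z: "z = (1 / sqrt 2) *\<^sub>R cis a" "w = (1 / sqrt 2) *\<^sub>R cis b"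
    using Arg_eq[of z] Arg_eq[of w] nz al by (auto simp: a_def b_def cis_conv_exp scaleR_conv_of_real)
  have "aligned m n (cis a) (cis b)" using al(2) unfolding z by (subst (asm) aligned_scale) auto
  then have "cis (real n * a) = cis (real m * b)" by (simp only: aligned_cis)
  then have "cis (real n * a - real m * b) = 1" by (simp add: cis_divide[symmetric])
  then obtain k :: int where k: "real n * a - real m * b = of_int (2 * k) * pi"
    by (auto simp: cis_conv_exp exp_eq_1)
  obtain i j where ij: "int n * i - int m * j = k"
      using coprime_combination[OF mn(1)] by blast
  define t where "t = (a - 2 * pi * of_int i) / real m"
  have per: "cis (x - 2 * pi * of_int l) = cis x" for x l
    by (simp add: cis_divide[symmetric] cis_multiple_2pi)
  have ma: "real m * t = a - 2 * pi * of_int i" using mn by (simp add: t_def)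
  have "real m * (real n * t) = real n * (a - 2 * pi * of_int i)" using ma by (simp add: mult.left_commute)
  also have "\<dots> = real m * b + 2 * pi * of_int k - 2 * pi * of_int (int n * i)" using k by (simp add: algebra_simps)
  also have "\<dots> = real m * (b - 2 * pi * of_int j)" unfolding ij[symmetric] by (simp add: algebra_simps)
  finally have nb: "real n * t = b - 2 * pi * of_int j" using mn by simp
  have "v = (1 / sqrt 2) *\<^sub>R (cis (real m * t), cis (real n * t))"
    unfolding ma nb per zw by (simp add: z)
  then show ?thesis by (simp add: standard_torus_knot_def)
qed

text \<open>The end of the isotopy is a homeomorphism of the sphere that identifies the two knot complements; then the knot complement is a retract of
  the exterior by radial projection.\<close>
lemma knot_group_embeds:
  assumes K: "is_torus_knot m n K" and mn: "coprime m n" "m > 0" "n > 0" and x0: "x0 \<in> sphere3 - K"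
    and b: "b \<in> solid_torus m n \<inter> opposite_torus m n"
  shows "\<exists>\<phi>\<in>hom (knot_group K x0) (fundamental_group (exterior m n) b).
    \<forall>g\<in>carrier (knot_group K x0). \<phi> g = \<one>\<^bsub>fundamental_group (exterior m n) b\<^esub> \<longrightarrow> g = \<one>\<^bsub>knot_group K x0\<^esub>"
proof -
  let ?T = "standard_torus_knot m n"
  obtain H :: "real \<Rightarrow> complex \<times> complex \<Rightarrow> complex \<times> complex" where
    H: "\<forall>t\<in>{0..1}. \<exists>g. homeomorphism sphere3 sphere3 (H t) g" "H 1 ` ?T = K"
    using K unfolding is_torus_knot_def ambient_isotopic_def by blast
  obtain f where f: "homeomorphism sphere3 sphere3 (H 1) f" using bspec[OF H(1), of 1] by auto
  have f': "continuous_on sphere3 (H 1)" "continuous_on sphere3 f" "\<And>x. x \<in> sphere3 \<Longrightarrow> f (H 1 x) = x"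
    "\<And>x. x \<in> sphere3 \<Longrightarrow> H 1 (f x) = x" "\<And>x. x \<in> sphere3 \<Longrightarrow> f x \<in> sphere3" "\<And>x. x \<in> sphere3 \<Longrightarrow> H 1 x \<in> sphere3"
    using f by (auto simp: homeomorphism_def)
  have "f x \<in> exterior m n" if "x \<in> sphere3 - K" for x
  proof (rule ccontr)
    assume "f x \<notin> exterior m n"
    then have "f x \<in> ?T" using that f'(5) by (intro sphere_minus_exterior[OF mn]) auto
    then have "H 1 (f x) \<in> K" using H(2) by blast
    then show False using that f'(4) by simp
  qed
  then have fi: "f ` (sphere3 - K) \<subseteq> exterior m n" by blast
  define r where "r v = H 1 ((1 / norm v) *\<^sub>R v)" for v
  have nz: "norm v > 0" if "v \<in> exterior m n" for v using that by (cases v) (auto simp: exterior_iff zero_prod_def)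
  have unit: "(1 / norm v) *\<^sub>R v \<in> sphere3" if "v \<in> exterior m n" for v using nz[OF that] by simp
  have rc: "continuous_on (exterior m n) r"
    unfolding r_def
    by (rule continuous_on_compose2[OF f'(1)]) (use nz unit in \<open>fastforce intro!: continuous_intros\<close>)+
  have ri: "r ` exterior m n \<subseteq> sphere3 - K"
  proof (rule image_subsetI)
    fix v assume v: "v \<in> exterior m n"
    have "(1 / norm v) *\<^sub>R v \<in> exterior m n" using nz[OF v] by (intro exterior_scale[OF _ v]) simp
    then have nT: "(1 / norm v) *\<^sub>R v \<notin> ?T" using standard_torus_knot_disjoint by blast
    have "r v \<notin> K"
    proof
      assume "r v \<in> K"
      then obtain t where t: "t \<in> ?T" "r v = H 1 t" using H(2) by blast
      then have "t \<in> sphere3" using standard_torus_knot_subset by blast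
      then have "t = f (r v)" using f'(3) t(2) by simp
      then have "t = (1 / norm v) *\<^sub>R v" using f'(3)[OF unit[OF v]] by (simp add: r_def)
      then show False using t nT by simp
    qed
    then show "r v \<in> sphere3 - K" using f'(6)[OF unit[OF v]] by (simp add: r_def)
  qed
  have rf: "r (f x) = x" if "x \<in> sphere3 - K" for x
    using f'(4)[of x] f'(5)[of x] that by (simp add: r_def)
  obtain \<phi> where \<phi>: "\<phi> \<in> hom (knot_group K x0) (fundamental_group (exterior m n) (f x0))"
    "\<And>g. g \<in> carrier (knot_group K x0) \<Longrightarrow> \<phi> g = \<one>\<^bsub>fundamental_group (exterior m n) (f x0)\<^esub> \<Longrightarrow> g = \<one>\<^bsub>knot_group K x0\<^esub>"
    using fundamental_group_retract_injective[OF continuous_on_subset[OF f'(2)] fi rc ri rf x0] by blast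
  have "path_connected (exterior m n)"
    unfolding exterior_def using b
    by (intro path_connected_Un path_connected_solid_torus path_connected_opposite_torus mn) auto
  moreover have "b \<in> exterior m n" using b by (simp add: exterior_def)
  moreover have "f x0 \<in> exterior m n" using fi x0 by blast
  ultimately obtain c where "path c" "path_image c \<subseteq> exterior m n" "pathstart c = b" "pathfinish c = f x0"
    unfolding path_connected_def by blast
  from fundamental_group_basepoint_change[OF this] obtain \<psi> where
    \<psi>: "\<psi> \<in> hom (fundamental_group (exterior m n) (f x0)) (fundamental_group (exterior m n) b)"
    "\<And>h. h \<in> carrier (fundamental_group (exterior m n) (f x0)) \<Longrightarrow> \<psi> h = \<one>\<^bsub>fundamental_group (exterior m n) b\<^esub> \<Longrightarrow>
       h = \<one>\<^bsub>fundamental_group (exterior m n) (f x0)\<^esub>" by blast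
  show ?thesis
  proof (intro bexI[of _ "\<psi> \<circ> \<phi>"] ballI impI)
    show "\<psi> \<circ> \<phi> \<in> hom (knot_group K x0) (fundamental_group (exterior m n) b)"
      using \<phi>(1) \<psi>(1) by (rule hom_compose)
    fix g assume g: "g \<in> carrier (knot_group K x0)" "(\<psi> \<circ> \<phi>) g = \<one>\<^bsub>fundamental_group (exterior m n) b\<^esub>"
    have "\<phi> g \<in> carrier (fundamental_group (exterior m n) (f x0))" using \<phi>(1) g(1) by (rule hom_in_carrier)
    then show "g = \<one>\<^bsub>knot_group K x0\<^esub>" using g \<psi>(2) \<phi>(2) by simp
  qed
qed

lemma intersection_nonempty:
  assumes mn: "coprime m n" "m > 0" "n > 0"
  shows "solid_torus m n \<inter> opposite_torus m n \<noteq> {}"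
proof -
  have "(\<i> * of_real (pi / real n), 0) \<in> {(u, v). 0 < Im (of_nat n * u - of_nat m * v) \<and> Im (of_nat n * u - of_nat m * v) < 2 * pi}"
    using mn by simp
  then show ?thesis unfolding intersection_exp_image[OF mn] by blast
qed

theorem corollary6p5:
  fixes p q a b :: nat
    and K :: "(complex \<times> complex) set"
    and x0 :: "complex \<times> complex"
    and g :: "(real \<Rightarrow> complex \<times> complex) set"
  assumes "prime p" and "prime q" and "p < q"
    and "a \<ge> 1" and "b \<ge> 1"
    and "is_torus_knot (p ^ a) (q ^ b) K"
    and "x0 \<in> sphere3 - K"
    and "g \<in> carrier (knot_group K x0)" and "g \<noteq> \<one>\<^bsub>knot_group K x0\<^esub>"
  shows "torsion_spectrum (knot_group K x0) g \<subseteq> {n. p dvd n} \<union> {n. n \<ge> q}"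
proof
  let ?m = "p ^ a" and ?n = "q ^ b"
  have "coprime p q" using assms(1-3) by (simp add: primes_coprime)
  then have co: "coprime ?m ?n" by simp
  have gt: "?m > 1" "?n > 1" using one_less_power[OF prime_gt_1_nat[OF assms(1)]] one_less_power[OF prime_gt_1_nat[OF assms(2)]] assms(4,5)
    by simp_all
  then have pos: "?m > 0" "?n > 0" by linarith+
  obtain c where c: "c \<in> solid_torus ?m ?n \<inter> opposite_torus ?m ?n"
    using intersection_nonempty[OF co pos] by blast
  define G where "G = fundamental_group (exterior ?m ?n) c"
  have cE: "c \<in> exterior ?m ?n" using c by (simp add: exterior_def)
  have grpG: "group G" unfolding G_def by (rule group_fundamental_group[OF cE])
  obtain x y where xy: "x \<in> carrier G" "y \<in> carrier G" "generate G {x, y} = carrier G"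
    "x [^]\<^bsub>G\<^esub> ?n = y [^]\<^bsub>G\<^esub> ?m"
    and ex: "\<And>(H :: (complex poly^2^2) monoid) X Y. group H \<Longrightarrow> X \<in> carrier H \<Longrightarrow> Y \<in> carrier H \<Longrightarrow> X [^]\<^bsub>H\<^esub> ?n = Y [^]\<^bsub>H\<^esub> ?m \<Longrightarrow>
       \<exists>\<phi>\<in>hom G H. \<phi> x = X \<and> \<phi> y = Y"
    using torus_knot_group_presentation[OF co pos c, where 'h = "complex poly^2^2"] unfolding G_def exterior_def by metis
  obtain \<rho> where \<rho>: "\<rho> \<in> hom G GL2_poly" "\<rho> x = X_mat ?m ?n" "\<rho> y = Y_mat ?m ?n"
    using ex[OF group_GL2_poly X_mat_closed Y_mat_closed X_mat_Y_mat_relation[OF pos]] by blast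
  interpret torus_knot_rep G x y ?m ?n \<rho>
    using grpG xy gt \<rho> by (simp add: torus_knot_rep_def torus_knot_rep_axioms_def)
  obtain \<phi> where \<phi>: "\<phi> \<in> hom (knot_group K x0) G"
    "\<And>g. g \<in> carrier (knot_group K x0) \<Longrightarrow> \<phi> g = \<one>\<^bsub>G\<^esub> \<Longrightarrow> g = \<one>\<^bsub>knot_group K x0\<^esub>"
    using knot_group_embeds[OF assms(6) co pos assms(7) c] unfolding G_def by blast
  fix r assume r: "r \<in> torsion_spectrum (knot_group K x0) g"
  have "r \<in> torsion_spectrum G (\<phi> g)"
    using torsion_spectrum_hom[OF group_fundamental_group[OF assms(7)] grpG \<phi>(1) assms(8)] r by blast
  moreover have "\<phi> g \<in> carrier G" using \<phi>(1) assms(8) by (rule hom_in_carrier)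
  moreover have "\<phi> g \<noteq> \<one>\<^bsub>G\<^esub>" using \<phi>(2) assms(8,9) by blast
  ultimately obtain e :: "nat \<Rightarrow> nat" where e: "(\<Sum>i<r. prim_root (?m * ?n) ^ e i) = 0"
    using torsion_spectrum_root_sum by blast
  have "prim_root (?m * ?n) ^ (?m * ?n) = 1" using prim_root_power_eq_1_iff[of "?m * ?n" "?m * ?n"] pos by simp
  from vanishing_sum_of_roots_of_unity[OF assms(1,2) this e]
  show "r \<in> {n. p dvd n} \<union> {n. n \<ge> q}" by blast
qed

end
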